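(* Let $y_0\in L^2(\Omega)$ and $Q\in\mathcal{F}$ satisfy $y_0\in L^2(\Omega)\setminus Q$. For $M\ge0$ let $\mathcal{J}_M:=\{t\in\mathbb{R}^+ : N(t,y_0,Q)\le M\}$, with the convention $\inf\mathcal{J}_M:=+\infty$ when $\mathcal{J}_M=\emptyset$. Then $$T(M,y_0,Q)=\inf\mathcal{J}_M\quad\text{for all } M\ge0.$$
   Context: $\Omega\subset\mathbb{R}^n$ ($n\ge 1$) is a bounded open domain with $C^2$ boundary $\partial\Omega$; $\omega\subset\Omega$ is an open nonempty subset with characteristic function $\chi_\omega$; $\mathbb{R}^+=(0,+\infty)$; $\|\cdot\|$ is the norm of $L^2(\Omega)$. For $y_0\in L^2(\Omega)$ and $u\in L^\infty(\mathbb{R}^+;L^2(\Omega))$, $y(\cdot;y_0,u)$ is the solution of $\partial_t y-\Delta y=\chi_\omega u$ in $\mathbb{R}^+\times\Omega$, $y=0$ on $\mathbb{R}^+\times\partial\Omega$, $y(0)=y_0$. For $T>0$ and $v\in L^\infty(0,T;L^2(\Omega))$, $\hat y(\cdot;y_0,v)$ is the solution of the same equation on $(0,T)$ with control $v$. $\mathcal{F}$ is the set of all bounded closed convex subsets of $L^2(\Omega)$ with nonempty interior. Minimal time: for $M\ge0$, with $\mathcal{U}^M=\{u\in L^\infty(\mathbb{R}^+;L^2(\Omega)):\|u(t)\|\le M\text{ for a.e. }t\in\mathbb{R}^+\}$, $T(M,y_0,Q)=\inf\{\hat t\ge0:\exists u\in\mathcal{U}^M\text{ s.t. }y(\hat t;y_0,u)\in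 Q\}$, with $T(M,y_0,Q)=+\infty$ if this set is empty. Minimal norm: for $T>0$, $N(T,y_0,Q)=\inf\{\|v\|_{L^\infty(0,T;L^2(\Omega))}:\hat y(T;y_0,v)\in Q\}$. *)

theory Defs
  imports "HOL-Probability.Essential_Supremum"
begin

section \<open>The Hilbert space of real square integrable functions\<close>

definition square_integrable :: "('a::euclidean_space \<Rightarrow> real) \<Rightarrow> bool" where
  "square_integrable f \<longleftrightarrow>
     f \<in> borel_measurable lebesgue \<and> integrable lebesgue (\<lambda>x. (f x)\<^sup>2)"

lemma square_integrable_measurable [measurable_dest]:
  "square_integrable f \<Longrightarrow> f \<in> borel_measurable lebesgue"
  by (simp add: square_integrable_def)

lemma square_integrable_zero: "square_integrable (\<lambda>x. 0)"
  by (simp add: square_integrable_def)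

lemma square_integrable_scale:
  "square_integrable f \<Longrightarrow> square_integrable (\<lambda>x. c * f x)"
  by (auto simp: square_integrable_def power_mult_distrib)

lemma square_integrable_mult:
  assumes "square_integrable f" "square_integrable g"
  shows "integrable lebesgue (\<lambda>x. f x * g x)"
proof (rule Bochner_Integration.integrable_bound[where f = "\<lambda>x. (f x)\<^sup>2 + (g x)\<^sup>2"])
  show "integrable lebesgue (\<lambda>x. (f x)\<^sup>2 + (g x)\<^sup>2)"
    using assms by (simp add: square_integrable_def)
  show "(\<lambda>x. f x * g x) \<in> borel_measurable lebesgue"
    using assms by (intro borel_measurable_times) (simp_all add: square_integrable_def)
  have "\<bar>a * b\<bar> \<le> a\<^sup>2 + b\<^sup>2" for a b :: real
  proof -
    have "0 \<le> (\<bar>a\<bar> - \<bar>b\<bar>)\<^sup>2" "0 \<le> a\<^sup>2" "0 \<le> b\<^sup>2" by simp_all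
    moreover have "(\<bar>a\<bar> - \<bar>b\<bar>)\<^sup>2 = a\<^sup>2 + b\<^sup>2 - 2 * \<bar>a * b\<bar>"
      by (simp add: power2_diff abs_mult)
    ultimately show ?thesis by linarith
  qed
  then show "AE x in lebesgue. norm (f x * g x) \<le> norm ((f x)\<^sup>2 + (g x)\<^sup>2)"
    by (intro AE_I2) simp
qed

lemma square_integrable_self_zero:
  assumes f: "square_integrable f"
  shows "integral\<^sup>L lebesgue (\<lambda>x. f x * f x) = 0 \<longleftrightarrow> (AE x in lebesgue. f x = 0)"
  using integral_nonneg_eq_0_iff_AE[OF square_integrable_mult[OF f f]] by simp

lemma square_integrable_add:
  assumes "square_integrable f" "square_integrable g"
  shows "square_integrable (\<lambda>x. f x + g x)"
proof -
  have "integrable lebesgue (\<lambda>x. ((f x)\<^sup>2 + (g x)\<^sup>2) + 2 * (f x * g x))"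
    using assms square_integrable_mult[OF assms]
    by (intro Bochner_Integration.integrable_add integrable_mult_right)
       (auto simp: square_integrable_def)
  moreover have "(\<lambda>x. ((f x)\<^sup>2 + (g x)\<^sup>2) + 2 * (f x * g x)) = (\<lambda>x. (f x + g x)\<^sup>2)"
    by (auto simp: power2_sum)
  moreover have "(\<lambda>x. f x + g x) \<in> borel_measurable lebesgue"
    using assms by (intro borel_measurable_add) (simp_all add: square_integrable_def)
  ultimately show ?thesis
    by (simp add: square_integrable_def)
qed

quotient_type (overloaded) 'a L2 = "'a::euclidean_space \<Rightarrow> real" / partial:
  "\<lambda>f g. square_integrable f \<and> square_integrable g \<and> (AE x in lebesgue. f x = g x)"
proof (rule part_equivpI)
  show "\<exists>f. square_integrable f \<and> square_integrable f \<and> (AE x in lebesgue. f x = f x)"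
    using square_integrable_zero by (intro exI[of _ "\<lambda>x. 0"]) simp
  show "symp (\<lambda>f g. square_integrable f \<and> square_integrable g \<and> (AE x in lebesgue. f x = g x))"
    by (auto intro!: sympI elim: eventually_mono)
  show "transp (\<lambda>f g. square_integrable f \<and> square_integrable g \<and> (AE x in lebesgue. f x = g x))"
    by (auto intro!: transpI)
qed

instantiation L2 :: (euclidean_space) real_inner
begin

lift_definition zero_L2 :: "'a L2" is "\<lambda>x. 0"
  by (simp add: square_integrable_zero)

lift_definition plus_L2 :: "'a L2 \<Rightarrow> 'a L2 \<Rightarrow> 'a L2" is "\<lambda>f g x. f x + g x"
  by (auto simp: square_integrable_add)

lift_definition scaleR_L2 :: "real \<Rightarrow> 'a L2 \<Rightarrow> 'a L2" is "\<lambda>c f x. c * f x"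
  by (auto simp: square_integrable_scale)

lift_definition uminus_L2 :: "'a L2 \<Rightarrow> 'a L2" is "\<lambda>f x. - f x"
  using square_integrable_scale[where c = "-1"] by auto

lift_definition minus_L2 :: "'a L2 \<Rightarrow> 'a L2 \<Rightarrow> 'a L2" is "\<lambda>f g x. f x - g x"
  using square_integrable_add[OF _ square_integrable_scale[where c = "-1"]] by auto

lift_definition inner_L2 :: "'a L2 \<Rightarrow> 'a L2 \<Rightarrow> real" is
  "\<lambda>f g. integral\<^sup>L lebesgue (\<lambda>x. f x * g x)"
  by (intro integral_cong_AE borel_measurable_times square_integrable_measurable) auto

definition norm_L2 :: "'a L2 \<Rightarrow> real" where
  "norm_L2 f = sqrt (inner f f)"

definition sgn_L2 :: "'a L2 \<Rightarrow> 'a L2" where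
  "sgn_L2 f = inverse (norm f) *\<^sub>R f"

definition dist_L2 :: "'a L2 \<Rightarrow> 'a L2 \<Rightarrow> real" where
  "dist_L2 f g = norm (f - g)"

definition uniformity_L2 :: "('a L2 \<times> 'a L2) filter" where
  "uniformity_L2 = (INF e\<in>{0<..}. principal {(f, g). dist f g < e})"

definition open_L2 :: "'a L2 set \<Rightarrow> bool" where
  "open_L2 U \<longleftrightarrow> (\<forall>f\<in>U. eventually (\<lambda>(f', g). f' = f \<longrightarrow> g \<in> U) uniformity)"

instance
proof
  fix f g h :: "'a L2" and a b :: real and U :: "'a L2 set"
  show "f + g + h = f + (g + h)"
    by transfer (auto simp: add.assoc square_integrable_add)
  show "f + g = g + f"
    by transfer (auto simp: add.commute square_integrable_add)
  show "0 + f = f"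
    by transfer auto
  show "- f + f = 0"
    by transfer (auto simp: square_integrable_zero)
  show "f - g = f + - g"
    by transfer
       (use square_integrable_add[OF _ square_integrable_scale[where c = "-1"]] in auto)
  show "a *\<^sub>R (f + g) = a *\<^sub>R f + a *\<^sub>R g"
    by transfer (auto simp: distrib_left square_integrable_add square_integrable_scale)
  show "(a + b) *\<^sub>R f = a *\<^sub>R f + b *\<^sub>R f"
    by transfer (auto simp: distrib_right square_integrable_add square_integrable_scale)
  show "a *\<^sub>R b *\<^sub>R f = (a * b) *\<^sub>R f"
    by transfer (auto simp: mult.assoc square_integrable_scale)
  show "1 *\<^sub>R f = f"
    by transfer auto
  show "inner f g = inner g f"
    by transfer (simp add: mult.commute)
  show "inner (f + g) h = inner f h + inner g h"
    by transfer (simp add: distrib_right square_integrable_mult)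
  show "inner (a *\<^sub>R f) g = a * inner f g"
    by transfer (simp add: mult.assoc)
  show "0 \<le> inner f f"
    by transfer simp
  show "(inner f f = 0) = (f = 0)"
    by transfer (simp add: square_integrable_self_zero square_integrable_zero)
  show "norm f = sqrt (inner f f)"
    by (rule norm_L2_def)
  show "sgn f = inverse (norm f) *\<^sub>R f"
    by (rule sgn_L2_def)
  show "dist f g = norm (f - g)"
    by (rule dist_L2_def)
  show "uniformity = (INF e\<in>{0<..}. principal {(f :: 'a L2, g). dist f g < e})"
    by (rule uniformity_L2_def)
  show "open U = (\<forall>f\<in>U. eventually (\<lambda>(f', g). f' = f \<longrightarrow> g \<in> U) uniformity)"
    by (rule open_L2_def)
qed

end

text \<open>
  The type \<open>'a L2\<close> is the space of square integrable functions on the whole space.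
  For \<open>\<Omega>\<close> measurable, \<open>L\<^sup>2(\<Omega>)\<close> is identified, via extension by zero, with its closed subspace
  of functions vanishing almost everywhere outside \<open>\<Omega>\<close>.
\<close>

lift_definition vanishes_outside :: "'a::euclidean_space L2 \<Rightarrow> 'a set \<Rightarrow> bool" is
  "\<lambda>f A. AE x in lebesgue. x \<notin> A \<longrightarrow> f x = 0"
proof -
  fix f g :: "'a \<Rightarrow> real"
  assume "square_integrable f \<and> square_integrable g \<and> (AE x in lebesgue. f x = g x)"
  then have eq: "AE x in lebesgue. f x = g x" by blast
  show "(\<lambda>A. AE x in lebesgue. x \<notin> A \<longrightarrow> f x = 0) = (\<lambda>A. AE x in lebesgue. x \<notin> A \<longrightarrow> g x = 0)"
    by (rule ext, rule eventually_cong) (use eq in auto)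
qed

definition L2_on :: "'a::euclidean_space set \<Rightarrow> 'a L2 set" where
  "L2_on \<Omega> = {f. vanishes_outside f \<Omega>}"

text \<open>The class of a function; the value 0 is used when it is not square integrable.\<close>

lift_definition to_L2 :: "('a::euclidean_space \<Rightarrow> real) \<Rightarrow> 'a L2" is
  "\<lambda>f. if square_integrable f then f else (\<lambda>x. 0)"
  by (auto simp: square_integrable_zero)

text \<open>Multiplication by the characteristic function of a measurable set.\<close>

lift_definition cutoff :: "'a::euclidean_space set \<Rightarrow> 'a L2 \<Rightarrow> 'a L2" is
  "\<lambda>A f. if A \<in> sets lebesgue then (\<lambda>x. indicator A x * f x) else (\<lambda>x. 0)"
proof -
  fix A :: "'a set" and f g :: "'a \<Rightarrow> real"
  have *: "square_integrable (\<lambda>x. indicator A x * h x)"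
    if A: "A \<in> sets lebesgue" and h: "square_integrable h" for h :: "'a \<Rightarrow> real"
  proof -
    have "integrable lebesgue (\<lambda>x. indicator A x *\<^sub>R (h x)\<^sup>2)"
      using A h by (intro integrable_mult_indicator) (auto simp: square_integrable_def)
    moreover have "(\<lambda>x. indicator A x *\<^sub>R (h x)\<^sup>2) = (\<lambda>x. (indicator A x * h x)\<^sup>2)"
      by (auto simp: indicator_def)
    ultimately show ?thesis
      using A h by (auto simp: square_integrable_def)
  qed
  assume "square_integrable f \<and> square_integrable g \<and> (AE x in lebesgue. f x = g x)"
  then show "square_integrable (if A \<in> sets lebesgue then \<lambda>x. indicator A x * f x else (\<lambda>x. 0)) \<and>
      square_integrable (if A \<in> sets lebesgue then \<lambda>x. indicator A x * g x else (\<lambda>x. 0)) \<and>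
      (AE x in lebesgue. (if A \<in> sets lebesgue then \<lambda>x. indicator A x * f x else (\<lambda>x. 0)) x =
        (if A \<in> sets lebesgue then \<lambda>x. indicator A x * g x else (\<lambda>x. 0)) x)"
    by (auto simp: * square_integrable_zero)
qed


section \<open>Smooth functions and domains with \<open>C\<^sup>2\<close> boundary\<close>

definition partial :: "'a::euclidean_space \<Rightarrow> ('a \<Rightarrow> real) \<Rightarrow> 'a \<Rightarrow> real" where
  "partial e f x = frechet_derivative f (at x) e"

primrec Ck :: "nat \<Rightarrow> ('a::euclidean_space \<Rightarrow> real) \<Rightarrow> bool" where
  "Ck 0 f \<longleftrightarrow> continuous_on UNIV f"
| "Ck (Suc k) f \<longleftrightarrow> (\<forall>x. f differentiable (at x)) \<and> (\<forall>e\<in>Basis. Ck k (partial e f))"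

text \<open>\<open>C\<^sub>c\<^sup>\<infinity>(\<Omega>)\<close>, extended by zero to the whole space.\<close>

definition test_function :: "'a::euclidean_space set \<Rightarrow> ('a \<Rightarrow> real) \<Rightarrow> bool" where
  "test_function \<Omega> \<phi> \<longleftrightarrow>
     (\<forall>k. Ck k \<phi>) \<and> compact (closure {x. \<phi> x \<noteq> 0}) \<and> closure {x. \<phi> x \<noteq> 0} \<subseteq> \<Omega>"

text \<open>
  Near each boundary point, up to relabelling and reorienting the coordinate axes, \<open>\<Omega>\<close> is the
  part of a ball above the graph of a \<open>C\<^sup>2\<close> function of the remaining coordinates: \<open>e\<close> is the
  distinguished axis, \<open>\<sigma>\<close> its orientation, and \<open>\<gamma>\<close> is only evaluated at points orthogonal to \<open>e\<close>.
\<close>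

definition C2_boundary :: "'a::euclidean_space set \<Rightarrow> bool" where
  "C2_boundary \<Omega> \<longleftrightarrow>
     (\<forall>p\<in>frontier \<Omega>. \<exists>r>0. \<exists>e\<in>Basis. \<exists>\<sigma>\<in>{1, -1}. \<exists>\<gamma>. Ck 2 \<gamma> \<and>
        \<Omega> \<inter> ball p r = {x \<in> ball p r. \<sigma> * (x \<bullet> e) > \<gamma> (x - (x \<bullet> e) *\<^sub>R e)})"


section \<open>The Sobolev space \<open>H\<^sup>1\<^sub>0(\<Omega>)\<close>\<close>

definition has_weak_partial ::
  "'a::euclidean_space set \<Rightarrow> 'a \<Rightarrow> 'a L2 \<Rightarrow> 'a L2 \<Rightarrow> bool" where
  "has_weak_partial \<Omega> e f g \<longleftrightarrow>
     g \<in> L2_on \<Omega> \<and>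
     (\<forall>\<phi>. test_function \<Omega> \<phi> \<longrightarrow> f \<bullet> to_L2 (partial e \<phi>) = - (g \<bullet> to_L2 \<phi>))"

definition weak_partial :: "'a::euclidean_space set \<Rightarrow> 'a \<Rightarrow> 'a L2 \<Rightarrow> 'a L2" where
  "weak_partial \<Omega> e f = (THE g. has_weak_partial \<Omega> e f g)"

definition H1 :: "'a::euclidean_space set \<Rightarrow> 'a L2 set" where
  "H1 \<Omega> = {f \<in> L2_on \<Omega>. \<forall>e\<in>Basis. \<exists>g. has_weak_partial \<Omega> e f g}"

text \<open>The closure of \<open>C\<^sub>c\<^sup>\<infinity>(\<Omega>)\<close> in \<open>H\<^sup>1(\<Omega>)\<close>.\<close>

definition H10 :: "'a::euclidean_space set \<Rightarrow> 'a L2 set" where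
  "H10 \<Omega> = {f \<in> H1 \<Omega>. \<exists>\<phi>. (\<forall>k. test_function \<Omega> (\<phi> k)) \<and>
     (\<lambda>k. to_L2 (\<phi> k)) \<longlonglongrightarrow> f \<and>
     (\<forall>e\<in>Basis. (\<lambda>k. to_L2 (partial e (\<phi> k))) \<longlonglongrightarrow> weak_partial \<Omega> e f)}"


section \<open>Controls and the controlled heat equation\<close>

text \<open>The norm of \<open>L\<^sup>\<infinity>(I; L\<^sup>2)\<close>, possibly infinite.\<close>

definition Linf_norm :: "real set \<Rightarrow> (real \<Rightarrow> 'a::euclidean_space L2) \<Rightarrow> ereal" where
  "Linf_norm I u = esssup (lebesgue_on I) (\<lambda>t. ereal (norm (u t)))"

text \<open>
  \<open>L\<^sup>\<infinity>(I; L\<^sup>2(\<Omega>))\<close>, given by representatives. Since \<open>L\<^sup>2\<close> is separable, Borel measurability is the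
  same as strong measurability.
\<close>

definition Linf :: "real set \<Rightarrow> 'a::euclidean_space set \<Rightarrow> (real \<Rightarrow> 'a L2) set" where
  "Linf I \<Omega> = {u. u \<in> borel_measurable (lebesgue_on I) \<and> (\<forall>t\<in>I. u t \<in> L2_on \<Omega>) \<and>
     Linf_norm I u < \<infinity>}"

text \<open>
  Weak solutions of \<open>\<partial>\<^sub>t y - \<Delta> y = \<chi>\<^sub>\<omega> u\<close> with homogeneous Dirichlet condition and
  \<open>y(0) = y\<^sub>0\<close>, on a time interval \<open>J\<close> of the form \<open>[0,T]\<close> or \<open>[0,\<infinity>)\<close>: \<open>y \<in> C(J; L\<^sup>2(\<Omega>))\<close>,
  \<open>y \<in> L\<^sup>2(0,t; H\<^sup>1\<^sub>0(\<Omega>))\<close> for every \<open>t \<in> J\<close>, and the equation, tested against elements of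
  \<open>H\<^sup>1\<^sub>0(\<Omega>)\<close>, holds in its form integrated over time.
\<close>

definition is_heat_solution ::
  "'a::euclidean_space set \<Rightarrow> 'a set \<Rightarrow> real set \<Rightarrow> 'a L2 \<Rightarrow> (real \<Rightarrow> 'a L2) \<Rightarrow> (real \<Rightarrow> 'a L2) \<Rightarrow> bool"
where
  "is_heat_solution \<Omega> \<omega> J y0 u y \<longleftrightarrow>
     continuous_on J y \<and> (\<forall>t\<in>J. y t \<in> L2_on \<Omega>) \<and> y 0 = y0 \<and>
     (AE t in lebesgue_on J. y t \<in> H10 \<Omega>) \<and>
     (\<forall>e\<in>Basis. (\<lambda>t. weak_partial \<Omega> e (y t)) \<in> borel_measurable (lebesgue_on J) \<and>
        (\<forall>t\<in>J. set_integrable lebesgue {0<..<t} (\<lambda>s. (norm (weak_partial \<Omega> e (y s)))\<^sup>2))) \<and>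
     (\<forall>\<phi>\<in>H10 \<Omega>. \<forall>t\<in>J.
        y t \<bullet> \<phi> = y0 \<bullet> \<phi> +
          (LINT s:{0<..<t}|lebesgue.
             cutoff \<omega> (u s) \<bullet> \<phi> - (\<Sum>e\<in>Basis. weak_partial \<Omega> e (y s) \<bullet> weak_partial \<Omega> e \<phi>)))"

text \<open>The value at time \<open>t \<in> J\<close> of the solution, which is unique on \<open>J\<close>.\<close>

definition heat_solution ::
  "'a::euclidean_space set \<Rightarrow> 'a set \<Rightarrow> real set \<Rightarrow> 'a L2 \<Rightarrow> (real \<Rightarrow> 'a L2) \<Rightarrow> real \<Rightarrow> 'a L2" where
  "heat_solution \<Omega> \<omega> J y0 u t = (THE z. \<exists>y. is_heat_solution \<Omega> \<omega> J y0 u y \<and> y t = z)"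


section \<open>Targets, minimal time and minimal norm\<close>

definition target_sets :: "'a::euclidean_space set \<Rightarrow> 'a L2 set set" where
  "target_sets \<Omega> = {Q. Q \<subseteq> L2_on \<Omega> \<and> bounded Q \<and> convex Q \<and>
     closedin (top_of_set (L2_on \<Omega>)) Q \<and> top_of_set (L2_on \<Omega>) interior_of Q \<noteq> {}}"

definition admissible_controls ::
  "'a::euclidean_space set \<Rightarrow> real \<Rightarrow> (real \<Rightarrow> 'a L2) set" where
  "admissible_controls \<Omega> M =
     {u \<in> Linf {0<..} \<Omega>. AE t in lebesgue_on {0<..}. norm (u t) \<le> M}"

text \<open>In both definitions the infimum of the empty set is \<open>\<infinity>\<close>.\<close>

definition minimal_time ::
  "'a::euclidean_space set \<Rightarrow> 'a set \<Rightarrow> real \<Rightarrow> 'a L2 \<Rightarrow> 'a L2 set \<Rightarrow> ereal" where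
  "minimal_time \<Omega> \<omega> M y0 Q =
     Inf {ereal t | t. t \<ge> 0 \<and>
       (\<exists>u\<in>admissible_controls \<Omega> M. heat_solution \<Omega> \<omega> {0..} y0 u t \<in> Q)}"

definition minimal_norm ::
  "'a::euclidean_space set \<Rightarrow> 'a set \<Rightarrow> real \<Rightarrow> 'a L2 \<Rightarrow> 'a L2 set \<Rightarrow> ereal" where
  "minimal_norm \<Omega> \<omega> T y0 Q =
     Inf {Linf_norm {0<..<T} v | v.
       v \<in> Linf {0<..<T} \<Omega> \<and> heat_solution \<Omega> \<omega> {0..T} y0 v T \<in> Q}"

definition time_set ::
  "'a::euclidean_space set \<Rightarrow> 'a set \<Rightarrow> real \<Rightarrow> 'a L2 \<Rightarrow> 'a L2 set \<Rightarrow> real set" where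
  "time_set \<Omega> \<omega> M y0 Q = {t. 0 < t \<and> minimal_norm \<Omega> \<omega> t y0 Q \<le> ereal M}"

end

theory Submission
  imports Defs
begin

text \<open>
  Both infima range over the same set of times. If an admissible control steers the state into \<open>Q\<close> at
  time \<open>t\<close>, then \<open>t > 0\<close> since \<open>y0\<close> is not in \<open>Q\<close>, and the restriction of the control to \<open>(0, t)\<close> shows
  \<open>N(t) \<le> M\<close> (\<open>admissible_control_steering_time\<close>). Conversely, if \<open>N(t) \<le> M\<close>, then some control of
  norm at most \<open>M\<close> steers the state into \<open>Q\<close> at time \<open>t\<close>, because norm-optimal controls exist
  (\<open>minimal_norm_le_attained\<close>), and its continuation by zero is admissible for the time problem.

  Behind these two steps stands the well-posedness of the heat equation: solutions are given by a
  definite description, so the solution on \<open>[0, T]\<close> is the restriction of the one on \<open>[0, \<infinity>)\<close> only once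
  existence and uniqueness are known on both intervals (\<open>heat_solution_eq\<close>). It is proved for an
  abstract equation \<open>y' + D\<^sup>*D y = f\<close> in a separable Hilbert space, where \<open>D\<close> is linear on a subspace
  \<open>V\<close> with closed graph, and \<open>f\<close> is bounded and measurable.

  \<^item> \<^emph>\<open>Uniqueness\<close> (\<open>weak_sol_zero\<close>): test the equation for \<open>w\<close> at almost every time \<open>t\<close> with \<open>w t\<close>
    and integrate. By symmetry the double integral of \<open>\<langle>D (w s), D (w t)\<rangle>\<close> over \<open>s < t\<close> is half the
    square of the norm of the integral of \<open>D w\<close>, so the integral of \<open>\<bar>w\<bar>\<^sup>2\<close> is not positive.

  \<^item> \<^emph>\<open>Existence\<close> (\<open>weak_sol_exists\<close>): replace \<open>D\<^sup>*D\<close> by its Yosida approximations, which are bounded,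
    and solve the resulting ordinary differential equations. For initial values in \<open>V\<close> the energy
    identity bounds the Yosida terms in the mean square, and this makes both the approximations and
    their images under \<open>D\<close> Cauchy sequences with a rate. Dissipativity then allows initial values in
    the closure of \<open>V\<close>.

  \<^item> \<^emph>\<open>Stability\<close> (\<open>weak_sol_stability\<close>): the distance of two states with the same initial value is at
    most twice the \<open>L\<^sup>1\<close> distance of the sources.

  All limits are strong limits. In particular norm-optimal controls are found without weak
  compactness: controls of norm at most \<open>M + (1/2)^n\<close> that steer into the convex set \<open>Q\<close> form
  decreasing convex sets, and by the parallelogram law a sequence of nearly minimal \<open>L\<^sup>2\<close> norm along
  these sets is Cauchy (\<open>midpoint_minimizing_sequence\<close>).

  To apply this with \<open>V = H\<^sup>1\<^sub>0(\<Omega>)\<close> and \<open>D\<close> the weak gradient, \<open>L\<^sup>2\<close> has to be complete and separable, test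
  functions have to be dense in \<open>L\<^sup>2(\<Omega>)\<close> -- which makes weak derivatives unique and \<open>V\<close> dense -- and
  the gradient on \<open>V\<close> has to be closed.
\<close>

section \<open>Minimizing sequences and orthogonal projections\<close>

text \<open>
  Minimizing sequences in convex sets are Cauchy by the parallelogram law; here only the
  inequality behind this is extracted, for an abstract functional \<open>q\<close> and midpoint operation, and
  for a decreasing family \<open>C n\<close> in place of one set. If \<open>c n\<close> is the infimum of \<open>q\<close> over \<open>C n\<close>, then
  the numbers \<open>c n\<close> increase to a finite limit, and the midpoint of \<open>x m\<close> and \<open>x n\<close> still lies in
  \<open>C m\<close>, so that \<open>q\<close> is at least \<open>c m\<close> there. A constant family gives orthogonal projections;
  the control sets for the bounds \<open>M + (1/2)^n\<close> give norm-optimal controls. The tolerances \<open>\<epsilon>\<close> are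
  free, so that no subsequence has to be chosen later.
\<close>

lemma midpoint_minimizing_sequence:
  fixes C :: "nat \<Rightarrow> 'v set" and q :: "'v \<Rightarrow> real" and mid :: "'v \<Rightarrow> 'v \<Rightarrow> 'v"
  assumes decr: "\<And>m n. m \<le> n \<Longrightarrow> C n \<subseteq> C m"
    and mid: "\<And>n x y. x \<in> C n \<Longrightarrow> y \<in> C n \<Longrightarrow> mid x y \<in> C n"
    and nonneg: "\<And>x. x \<in> C 0 \<Longrightarrow> 0 \<le> q x"
    and bdd: "\<And>n. \<exists>x\<in>C n. q x \<le> B"
    and \<epsilon>: "\<And>n. 0 < \<epsilon> n"
  obtains x where "\<And>n. x n \<in> C n"
    and "\<And>m n. m \<le> n \<Longrightarrow> 2 * q (x m) + 2 * q (x n) - 4 * q (mid (x m) (x n)) \<le> \<epsilon> m"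
    and "\<And>m y. (\<And>n. y \<in> C n) \<Longrightarrow> q (x m) \<le> q y + \<epsilon> m"
proof -
  define c where "c n = (INF x\<in>C n. q x)" for n
  have ne: "C n \<noteq> {}" for n using bdd by blast
  have bb: "bdd_below (q ` C n)" for n
    using decr[of 0 n] nonneg by (intro bdd_belowI[of _ 0]) auto
  have c_le: "c n \<le> q x" if "x \<in> C n" for n x
    unfolding c_def using that bb by (intro cINF_lower) auto
  have c_mono: "c m \<le> c n" if "m \<le> n" for m n
    unfolding c_def using that bb ne decr by (intro cINF_superset_mono) auto
  have c_B: "c n \<le> B" for n
    using bdd[of n] c_le order_trans by blast
  have conv: "c \<longlonglongrightarrow> (SUP n. c n)"
    by (rule LIMSEQ_incseq_SUP) (use c_B c_mono in \<open>auto intro!: bdd_aboveI simp: incseq_def\<close>)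
  define c' where "c' = (SUP n. c n)"
  have c_le_c': "c n \<le> c'" for n
    unfolding c'_def using c_B by (intro cSUP_upper bdd_aboveI[of _ B]) auto
  \<comment> \<open>Running minimum of the tolerances, so that they decrease.\<close>
  define \<delta> where "\<delta> n = Min (\<epsilon> ` {..n}) / 8" for n
  have \<delta>_pos: "0 < \<delta> n" for n using \<epsilon> by (auto simp: \<delta>_def)
  have \<delta>_le: "\<delta> n \<le> \<epsilon> m / 8" if "m \<le> n" for m n
    using that by (auto simp: \<delta>_def intro!: Min_le)
  have "\<exists>k\<ge>n. c' - c k < \<delta> n" for n
  proof -
    have "eventually (\<lambda>k. dist (c k) c' < \<delta> n) sequentially"
      using conv \<delta>_pos unfolding c'_def by (rule tendstoD)
    moreover have "eventually (\<lambda>k. k \<ge> n) sequentially" by (rule eventually_ge_at_top)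
    ultimately have "eventually (\<lambda>k. k \<ge> n \<and> c' - c k < \<delta> n) sequentially"
      by eventually_elim (auto simp: dist_real_def)
    then show ?thesis by (auto simp: eventually_sequentially)
  qed
  then obtain k0 where k0: "\<And>n. k0 n \<ge> n" "\<And>n. c' - c (k0 n) < \<delta> n" by metis
  define k where "k n = Max (k0 ` {..n})" for n
  have k_ge: "k n \<ge> k0 n" for n by (auto simp: k_def)
  have k_mono: "k m \<le> k n" if "m \<le> n" for m n
    using that unfolding k_def by (intro Max_mono) auto
  have k_n: "k n \<ge> n" for n using k0 k_ge order_trans by blast
  have ck: "c' - c (k n) < \<delta> n" for n
    using k0(2)[of n] c_mono[OF k_ge[of n]] by linarith
  have "\<exists>x\<in>C (k n). q x < c (k n) + \<delta> n" for n
    using cINF_less_iff[OF ne bb, of "k n" "c (k n) + \<delta> n"] \<delta>_pos[of n] by (auto simp: c_def)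
  then obtain x where x: "\<And>n. x n \<in> C (k n)" "\<And>n. q (x n) < c (k n) + \<delta> n" by metis
  show ?thesis
  proof (rule that[of x])
    show "x n \<in> C n" for n using x(1) decr[OF k_n] by blast
    fix m n :: nat assume mn: "m \<le> n"
    have "x n \<in> C (k m)" using x(1)[of n] decr[OF k_mono[OF mn]] by blast
    then have "c (k m) \<le> q (mid (x m) (x n))"
      using x(1) mid c_le by blast
    then show "2 * q (x m) + 2 * q (x n) - 4 * q (mid (x m) (x n)) \<le> \<epsilon> m"
      using x(2)[of m] x(2)[of n] ck[of m] c_le_c'[of "k n"] \<delta>_le[OF mn] \<delta>_le[of m m] \<epsilon>[of m] by linarith
  next
    fix m y assume "\<And>n. y \<in> C n"
    then have "c (k m) \<le> q y" using c_le by blast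
    then show "q (x m) \<le> q y + \<epsilon> m" using x(2)[of m] \<delta>_le[of m m] \<epsilon>[of m] by linarith
  qed
qed

lemma parallelogram_midpoint:
  fixes x y :: "'h::real_inner"
  shows "(norm (x - y))\<^sup>2 = 2 * (norm x)\<^sup>2 + 2 * (norm y)\<^sup>2 - 4 * (norm ((1/2) *\<^sub>R (x + y)))\<^sup>2"
  unfolding power2_norm_eq_inner by (simp add: inner_simps inner_commute[of y x]) (simp add: field_simps)

text \<open>
  The point of \<open>S\<close> closest to \<open>p\<close> exists by completeness, since a minimizing sequence is Cauchy.
\<close>

lemma orthogonal_projection_exists:
  fixes S :: "'h::{real_inner, banach} set"
  assumes S: "subspace S" and cl: "closed S"
  obtains z where "z \<in> S" and "\<And>w. w \<in> S \<Longrightarrow> inner (p - z) w = 0"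
proof -
  have mids: "(1/2) *\<^sub>R (x + y) \<in> S" if "x \<in> S" "y \<in> S" for x y
    using that S by (simp add: subspace_add subspace_scale)
  obtain X where X: "\<And>n::nat. X n \<in> S"
    and X': "\<And>m n. m \<le> n \<Longrightarrow> 2 * (norm (p - X m))\<^sup>2 + 2 * (norm (p - X n))\<^sup>2
         - 4 * (norm (p - (1/2) *\<^sub>R (X m + X n)))\<^sup>2 \<le> (inverse (real (Suc m)))\<^sup>2"
    and X_min: "\<And>m y. (\<And>n::nat. y \<in> S) \<Longrightarrow> (norm (p - X m))\<^sup>2 \<le> (norm (p - y))\<^sup>2 + (inverse (real (Suc m)))\<^sup>2"
  proof (rule midpoint_minimizing_sequence[where C = "\<lambda>_. S" and q = "\<lambda>x. (norm (p - x))\<^sup>2" and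
        mid = "\<lambda>x y. (1/2) *\<^sub>R (x + y)" and B = "(norm p)\<^sup>2" and
        \<epsilon> = "\<lambda>m. (inverse (real (Suc m)))\<^sup>2"])
    show "\<exists>x\<in>S. (norm (p - x))\<^sup>2 \<le> (norm p)\<^sup>2"
      by (rule bexI[of _ 0]) (auto simp: subspace_0 S)
  qed (use mids in auto)
  have near: "norm (X m - X n) \<le> inverse (real (Suc m))" if "m \<le> n" for m n
  proof -
    have "p - (1/2) *\<^sub>R (X m + X n) = (1/2) *\<^sub>R ((p - X m) + (p - X n))"
      by (simp add: scaleR_diff_right scaleR_add_right flip: scaleR_add_left)
    then have "(norm ((p - X m) - (p - X n)))\<^sup>2 \<le> (inverse (real (Suc m)))\<^sup>2"
      using X'[OF that] parallelogram_midpoint[of "p - X m" "p - X n"] by simp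
    then have "norm ((p - X m) - (p - X n)) \<le> inverse (real (Suc m))"
      by (rule power2_le_imp_le) simp
    then show ?thesis by (simp add: norm_minus_commute)
  qed
  have "Cauchy X"
    unfolding Cauchy_altdef2
  proof safe
    fix e :: real assume "e > 0"
    then obtain N where N: "inverse (real (Suc N)) < e" using reals_Archimedean by blast
    have "dist (X n) (X N) < e" if "n \<ge> N" for n
      using near[OF that] N by (simp add: dist_norm norm_minus_commute)
    then show "\<exists>N. \<forall>n\<ge>N. dist (X n) (X N) < e" by blast
  qed
  then obtain z where z: "X \<longlonglongrightarrow> z" using Cauchy_convergent_iff convergent_def by blast
  have zS: "z \<in> S" using closed_sequentially[OF cl _ z] X by blast
  have min: "(norm (p - z))\<^sup>2 \<le> (norm (p - w))\<^sup>2" if w: "w \<in> S" for w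
  proof (rule LIMSEQ_le)
    show "(\<lambda>m. (norm (p - X m))\<^sup>2) \<longlonglongrightarrow> (norm (p - z))\<^sup>2"
      by (intro tendsto_intros z)
    have "(\<lambda>m. (norm (p - w))\<^sup>2 + (inverse (real (Suc m)))\<^sup>2) \<longlonglongrightarrow> (norm (p - w))\<^sup>2 + 0\<^sup>2"
      by (intro tendsto_intros LIMSEQ_inverse_real_of_nat)
    then show "(\<lambda>m. (norm (p - w))\<^sup>2 + (inverse (real (Suc m)))\<^sup>2) \<longlonglongrightarrow> (norm (p - w))\<^sup>2" by simp
  qed (use X_min w in blast)
  have "inner (p - z) w = 0" if w: "w \<in> S" for w
  proof (rule ccontr)
    assume neq: "inner (p - z) w \<noteq> 0"
    define a where "a = inner (p - z) w"
    define b where "b = inner w w"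
    have b: "b > 0" using neq by (auto simp: b_def)
    have "z + (a / b) *\<^sub>R w \<in> S" using zS w S by (simp add: subspace_add subspace_scale)
    from min[OF this] have "inner (p - z) (p - z) \<le> inner ((p - z) - (a/b) *\<^sub>R w) ((p - z) - (a/b) *\<^sub>R w)"
      by (simp add: power2_norm_eq_inner diff_diff_eq)
    also have "\<dots> = inner (p - z) (p - z) - 2 * (a/b) * a + (a/b)\<^sup>2 * b"
      unfolding inner_diff_left[of "p - z" "(a/b) *\<^sub>R w"] inner_diff_right[of _ "p - z" "(a/b) *\<^sub>R w"]
      by (simp add: a_def b_def inner_commute power2_eq_square)
    also have "2 * (a/b) * a - (a/b)\<^sup>2 * b = a\<^sup>2 / b"
      using b by (simp add: power2_eq_square field_simps)
    then have "inner (p - z) (p - z) - 2 * (a/b) * a + (a/b)\<^sup>2 * b = inner (p - z) (p - z) - a\<^sup>2 / b"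
      by linarith
    finally have "a\<^sup>2 / b \<le> 0" by simp
    moreover have "a\<^sup>2 / b > 0" using neq b by (simp add: a_def)
    ultimately show False by simp
  qed
  with zS that show ?thesis by blast
qed

section \<open>Rapidly Cauchy sequences of square integrable functions\<close>

lemma summable_if_weighted_squares_summable:
  fixes d :: "nat \<Rightarrow> real"
  assumes nn: "\<And>n. 0 \<le> d n" and s: "summable (\<lambda>n. 2 ^ n * (d n)\<^sup>2)"
  shows "summable d"
proof (rule summable_comparison_test'[where N = 0])
  show "summable (\<lambda>n. 2 ^ n * (d n)\<^sup>2 + (1/2) ^ n)"
    by (intro summable_add s summable_geometric) simp
  fix n :: nat
  have "0 \<le> (2 ^ n * d n - 1)\<^sup>2" by simp
  then have "2 * (2 ^ n * d n) \<le> 2 ^ n * 2 ^ n * (d n)\<^sup>2 + 1"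
    by (simp add: power2_eq_square algebra_simps)
  then have "2 * d n \<le> 2 ^ n * (d n)\<^sup>2 + (1/2) ^ n"
    by (simp add: power_divide) (simp add: field_simps)
  then show "norm (d n) \<le> 2 ^ n * (d n)\<^sup>2 + (1/2) ^ n"
    using nn[of n] by simp
qed

text \<open>
  The core of the completeness of \<open>L\<^sup>2(M; B)\<close>. The squares of the increments, weighted by \<open>2 ^ n\<close>,
  still have summable integrals, so almost everywhere the weighted squares, and then the increments
  themselves, are summable. Fatou's lemma turns the Cauchy bounds into bounds on the distance to the
  limit. It is applied on the whole space, to see that \<open>L2\<close> is complete, and on time intervals.
\<close>

lemma AE_limit_of_fast_L2_Cauchy:
  fixes f :: "nat \<Rightarrow> 'a \<Rightarrow> 'b::{banach, second_countable_topology}"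
  assumes f[measurable]: "\<And>n. f n \<in> borel_measurable M"
    and fast: "\<And>m n. m \<le> n \<Longrightarrow> (\<integral>\<^sup>+x. ennreal ((norm (f m x - f n x))\<^sup>2) \<partial>M) \<le> ennreal (c * (1/4) ^ m)"
  obtains g where "g \<in> borel_measurable M" and "AE x in M. (\<lambda>n. f n x) \<longlonglongrightarrow> g x"
    and "\<And>m. (\<integral>\<^sup>+x. ennreal ((norm (f m x - g x))\<^sup>2) \<partial>M) \<le> ennreal (c * (1/4) ^ m)"
proof -
  define d where "d n x = norm (f n x - f (Suc n) x)" for n x
  have d[measurable]: "d n \<in> borel_measurable M" for n unfolding d_def by measurable
  have "(\<integral>\<^sup>+x. (\<Sum>n. ennreal (2 ^ n * (d n x)\<^sup>2)) \<partial>M) = (\<Sum>n. \<integral>\<^sup>+x. ennreal (2 ^ n * (d n x)\<^sup>2) \<partial>M)"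
    by (intro nn_integral_suminf) measurable
  also have "\<dots> \<le> (\<Sum>n. ennreal (\<bar>c\<bar> * (1/2) ^ n))"
  proof (intro suminf_le allI)
    fix n
    have "(\<integral>\<^sup>+x. ennreal (2 ^ n * (d n x)\<^sup>2) \<partial>M) = ennreal (2 ^ n) * (\<integral>\<^sup>+x. ennreal ((d n x)\<^sup>2) \<partial>M)"
      by (subst nn_integral_cmult[symmetric]) (auto simp: ennreal_mult)
    also have "\<dots> \<le> ennreal (2 ^ n) * ennreal (\<bar>c\<bar> * (1/4) ^ n)"
      unfolding d_def by (intro mult_left_mono order_trans[OF fast] ennreal_leI mult_right_mono) auto
    also have "\<dots> = ennreal (\<bar>c\<bar> * (1/2) ^ n)"
    proof -
      have "(2::real) ^ n * (1/4) ^ n = (1/2) ^ n" by (simp flip: power_mult_distrib)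
      then have "2 ^ n * (\<bar>c\<bar> * (1/4) ^ n) = \<bar>c\<bar> * (1/2) ^ n" by simp
      then show ?thesis by (subst ennreal_mult[symmetric]) auto
    qed
    finally show "(\<integral>\<^sup>+x. ennreal (2 ^ n * (d n x)\<^sup>2) \<partial>M) \<le> ennreal (\<bar>c\<bar> * (1/2) ^ n)" .
  qed auto
  also have "\<dots> < \<infinity>"
  proof -
    have "summable (\<lambda>n. \<bar>c\<bar> * (1/2::real) ^ n)" by (intro summable_mult summable_geometric) simp
    then show ?thesis by (subst suminf_ennreal2) auto
  qed
  finally have "(\<integral>\<^sup>+x. (\<Sum>n. ennreal (2 ^ n * (d n x)\<^sup>2)) \<partial>M) \<noteq> \<infinity>" by simp
  then have "AE x in M. (\<Sum>n. ennreal (2 ^ n * (d n x)\<^sup>2)) \<noteq> \<infinity>"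
    by (intro nn_integral_PInf_AE) measurable
  then have conv: "AE x in M. convergent (\<lambda>n. f n x)"
  proof eventually_elim
    case (elim x)
    then have "summable (\<lambda>n. 2 ^ n * (d n x)\<^sup>2)"
      by (intro summable_suminf_not_top) auto
    then have "summable (\<lambda>n. d n x)"
      by (rule summable_if_weighted_squares_summable[rotated]) (simp add: d_def)
    then have "summable (\<lambda>n. norm (f (Suc n) x - f n x))"
      by (simp only: d_def norm_minus_commute[of "f _ x" "f (Suc _) x"])
    then have "summable (\<lambda>n. f (Suc n) x - f n x)"
      by (rule summable_norm_cancel)
    then have "convergent (\<lambda>n. \<Sum>i<n. f (Suc i) x - f i x)" by (simp add: summable_iff_convergent)
    then have "convergent (\<lambda>n. f n x - f 0 x)" by (simp add: sum_lessThan_telescope[of "\<lambda>n. f n x"])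
    then have "convergent (\<lambda>n. (f n x - f 0 x) + f 0 x)" by (intro convergent_add convergent_const)
    then show ?case by simp
  qed
  define g where "g x = lim (\<lambda>n. f n x)" for x
  have g[measurable]: "g \<in> borel_measurable M" unfolding g_def by measurable
  have lim: "AE x in M. (\<lambda>n. f n x) \<longlonglongrightarrow> g x"
    using conv by eventually_elim (simp add: g_def convergent_LIMSEQ_iff)
  have "(\<integral>\<^sup>+x. ennreal ((norm (f m x - g x))\<^sup>2) \<partial>M) \<le> ennreal (c * (1/4) ^ m)" for m
  proof -
    have "(\<integral>\<^sup>+x. ennreal ((norm (f m x - g x))\<^sup>2) \<partial>M)
        = (\<integral>\<^sup>+x. liminf (\<lambda>n. ennreal ((norm (f m x - f n x))\<^sup>2)) \<partial>M)"
    proof (rule nn_integral_cong_AE)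
      show "AE x in M. ennreal ((norm (f m x - g x))\<^sup>2) = liminf (\<lambda>n. ennreal ((norm (f m x - f n x))\<^sup>2))"
        using lim
      proof eventually_elim
        case (elim x)
        then have "(\<lambda>n. ennreal ((norm (f m x - f n x))\<^sup>2)) \<longlonglongrightarrow> ennreal ((norm (f m x - g x))\<^sup>2)"
          by (intro tendsto_intros)
        then show ?case by (rule lim_imp_Liminf[OF sequentially_bot, symmetric])
      qed
    qed
    also have "\<dots> \<le> liminf (\<lambda>n. \<integral>\<^sup>+x. ennreal ((norm (f m x - f n x))\<^sup>2) \<partial>M)"
      by (rule nn_integral_liminf) measurable
    also have "\<dots> \<le> liminf (\<lambda>n. ennreal (c * (1/4) ^ m))"
      by (intro Liminf_mono eventually_mono[OF eventually_ge_at_top[of m]] fast)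
    also have "\<dots> = ennreal (c * (1/4) ^ m)" by (simp add: Liminf_const)
    finally show ?thesis .
  qed
  with g lim that show ?thesis by blast
qed

lemma AE_tendsto_zero_if_fast:
  fixes u :: "nat \<Rightarrow> 'a \<Rightarrow> 'b::{banach, second_countable_topology}"
  assumes u[measurable]: "\<And>n. u n \<in> borel_measurable M"
    and fast: "\<And>n. (\<integral>\<^sup>+x. ennreal ((norm (u n x))\<^sup>2) \<partial>M) \<le> ennreal (c * (1/4) ^ n)"
  shows "AE x in M. (\<lambda>n. u n x) \<longlonglongrightarrow> 0"
proof -
  have "(\<integral>\<^sup>+x. (\<Sum>n. ennreal ((norm (u n x))\<^sup>2)) \<partial>M) = (\<Sum>n. \<integral>\<^sup>+x. ennreal ((norm (u n x))\<^sup>2) \<partial>M)"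
    by (intro nn_integral_suminf) measurable
  also have "\<dots> \<le> (\<Sum>n. ennreal (\<bar>c\<bar> * (1/4) ^ n))"
    by (intro suminf_le allI order_trans[OF fast] ennreal_leI mult_right_mono) auto
  also have "\<dots> < \<infinity>"
  proof -
    have "summable (\<lambda>n. \<bar>c\<bar> * (1/4::real) ^ n)" by (intro summable_mult summable_geometric) simp
    then show ?thesis by (subst suminf_ennreal2) auto
  qed
  finally have "(\<integral>\<^sup>+x. (\<Sum>n. ennreal ((norm (u n x))\<^sup>2)) \<partial>M) \<noteq> \<infinity>" by simp
  then have "AE x in M. (\<Sum>n. ennreal ((norm (u n x))\<^sup>2)) \<noteq> \<infinity>"
    by (intro nn_integral_PInf_AE) measurable
  then show ?thesis
  proof eventually_elim
    case (elim x)
    then have "summable (\<lambda>n. (norm (u n x))\<^sup>2)" by (intro summable_suminf_not_top) auto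
    then have "(\<lambda>n. (norm (u n x))\<^sup>2) \<longlonglongrightarrow> 0" by (rule summable_LIMSEQ_zero)
    then have "(\<lambda>n. norm (u n x)) \<longlonglongrightarrow> 0" using tendsto_real_sqrt by fastforce
    then show ?case by (simp add: tendsto_norm_zero_iff)
  qed
qed

section \<open>Separability of metric spaces\<close>

text \<open>
  The class \<open>second_countable_topology\<close> is what makes sums of measurable functions measurable and
  Bochner integrals available; for \<open>L2\<close> and for vectors over \<open>L2\<close> it is obtained from a countable
  dense set.
\<close>

lemma second_countable_if_separable:
  assumes "countable (S :: 'a::metric_space set)" and "closure S = UNIV"
  shows "\<exists>B::'a set set. countable B \<and> open = generate_topology B"
proof -
  define B where "B = (\<lambda>(s, n::nat). ball s (inverse (real (Suc n)))) ` (S \<times> UNIV)"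
  have "topological_basis B"
  proof (rule topological_basisI)
    show "open b" if "b \<in> B" for b using that by (auto simp: B_def)
    fix U :: "'a set" and x assume "open U" "x \<in> U"
    then obtain e where e: "e > 0" "ball x e \<subseteq> U" by (auto simp: open_contains_ball)
    then obtain n where n: "inverse (real (Suc n)) < e / 2" using reals_Archimedean[of "e/2"] by auto
    have "x \<in> closure S" using assms by simp
    then obtain s where s: "s \<in> S" "dist s x < inverse (real (Suc n))"
      unfolding closure_approachable by (meson inverse_positive_iff_positive of_nat_0_less_iff zero_less_Suc)
    show "\<exists>b\<in>B. x \<in> b \<and> b \<subseteq> U"
    proof (intro bexI conjI)
      show "ball s (inverse (real (Suc n))) \<in> B" using s by (auto simp: B_def)
      show "x \<in> ball s (inverse (real (Suc n)))" using s by (simp add: dist_commute)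
      have "ball s (inverse (real (Suc n))) \<subseteq> ball x e"
      proof
        fix z assume "z \<in> ball s (inverse (real (Suc n)))"
        then have "dist s z < e / 2" "dist s x < e / 2" using s n by auto
        then show "z \<in> ball x e" using dist_triangle[of x z s] by (simp add: dist_commute)
      qed
      then show "ball s (inverse (real (Suc n))) \<subseteq> U" using e by blast
    qed
  qed
  moreover have "countable B" unfolding B_def using assms by auto
  ultimately show ?thesis
    using topological_basis_imp_subbasis by blast
qed

lemma countable_dense_exists:
  "\<exists>S::'a::second_countable_topology set. countable S \<and> closure S = UNIV"
proof -
  obtain D :: "'a set" where D: "countable D" "\<And>X. open X \<Longrightarrow> X \<noteq> {} \<Longrightarrow> \<exists>d\<in>D. d \<in> X"
    using countable_dense_setE by blast
  have "closure D = UNIV"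
  proof (rule ccontr)
    assume "closure D \<noteq> UNIV"
    then have "\<exists>d\<in>D. d \<in> - closure D" by (intro D(2)) auto
    then show False using closure_subset[of D] by blast
  qed
  then show ?thesis using D by blast
qed

instance vec :: ("{metric_space, second_countable_topology}", finite) second_countable_topology
proof
  \<comment> \<open>Vectors with components from a countable dense set are dense.\<close>
  obtain S :: "'a set" where S: "countable S" "closure S = UNIV" using countable_dense_exists by blast
  define T where "T = (\<lambda>f. (\<chi> i. f i) :: 'a ^ 'b) ` (PiE UNIV (\<lambda>_. S))"
  have "countable T" unfolding T_def using S by (intro countable_image countable_PiE) auto
  moreover have "closure T = UNIV"
  proof -
    have "\<exists>y\<in>T. dist y x < e" if e: "e > 0" for x :: "'a ^ 'b" and e
    proof -
      define \<delta> where "\<delta> = e / (2 * real CARD('b))"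
      have \<delta>: "\<delta> > 0" using e by (simp add: \<delta>_def)
      have "\<exists>s\<in>S. dist s (x $ i) < \<delta>" for i
        using S(2) \<delta> closure_approachable[of "x $ i" S] by auto
      then obtain f where f: "\<And>i. f i \<in> S" "\<And>i. dist (f i) (x $ i) < \<delta>" by metis
      have "dist (\<chi> i. f i) x \<le> (\<Sum>i\<in>UNIV. dist (f i) (x $ i))"
        unfolding dist_vec_def by (simp add: L2_set_le_sum)
      also have "\<dots> \<le> (\<Sum>i\<in>(UNIV::'b set). \<delta>)" by (intro sum_mono less_imp_le f)
      also have "\<dots> < e" using e by (simp add: \<delta>_def)
      finally show ?thesis using f by (auto simp: T_def)
    qed
    then show ?thesis by (auto simp: closure_approachable)
  qed
  ultimately show "\<exists>B::('a ^ 'b) set set. countable B \<and> open = generate_topology B"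
    by (rule second_countable_if_separable)
qed

section \<open>Functions with vanishing integrals over boxes\<close>

definition rational_vectors :: "'a::euclidean_space set" where
  "rational_vectors = {a. \<forall>i\<in>Basis. a \<bullet> i \<in> \<rat>}"

lemma countable_rational_vectors: "countable (rational_vectors :: 'a::euclidean_space set)"
proof -
  have "rational_vectors \<subseteq> (\<lambda>f. (\<Sum>i\<in>Basis. f i *\<^sub>R i) :: 'a) ` (PiE Basis (\<lambda>_. \<rat>))"
  proof
    fix a :: 'a assume "a \<in> rational_vectors"
    then show "a \<in> (\<lambda>f. (\<Sum>i\<in>Basis. f i *\<^sub>R i) :: 'a) ` (PiE Basis (\<lambda>_. \<rat>))"
      by (intro image_eqI[of _ _ "restrict (\<lambda>i. a \<bullet> i) Basis"])
         (auto simp: rational_vectors_def euclidean_representation)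
  qed
  then show ?thesis
    by (rule countable_subset) (intro countable_image countable_PiE finite_Basis countable_rat)
qed

lemma borel_eq_rational_box:
  "sets borel = sigma_sets UNIV {box a b | a b :: 'a::euclidean_space. a \<in> rational_vectors \<and> b \<in> rational_vectors}"
    (is "_ = sigma_sets _ ?E")
proof
  interpret S: sigma_algebra UNIV "sigma_sets UNIV ?E" by (rule sigma_algebra_sigma_sets) simp
  have "U \<in> sigma_sets UNIV ?E" if U: "open U" for U :: "'a set"
  proof -
    define I where "I = {(a, b). a \<in> rational_vectors \<and> b \<in> rational_vectors \<and> box a b \<subseteq> U}"
    have "I \<subseteq> rational_vectors \<times> rational_vectors" by (auto simp: I_def)
    then have "countable I" by (rule countable_subset) (simp add: countable_rational_vectors)
    moreover have "U = (\<Union>p\<in>I. box (fst p) (snd p))"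
    proof safe
      fix x assume "x \<in> U"
      then obtain e where "e > 0" "ball x e \<subseteq> U" using openE[OF U] by blast
      moreover obtain a b where "\<forall>i\<in>Basis. a \<bullet> i \<in> \<rat> \<and> b \<bullet> i \<in> \<rat>" "x \<in> box a b" "box a b \<subseteq> ball x e"
        using rational_boxes[OF \<open>e > 0\<close>] by metis
      ultimately show "x \<in> (\<Union>p\<in>I. box (fst p) (snd p))"
        by (intro UN_I[of "(a, b)"]) (auto simp: I_def rational_vectors_def)
    qed (auto simp: I_def)
    moreover have "(\<Union>p\<in>I. box (fst p) (snd p)) \<in> sigma_sets UNIV ?E"
      by (intro S.countable_UN' \<open>countable I\<close> subsetI)
         (auto simp: I_def intro!: sigma_sets.Basic; blast)
    ultimately show ?thesis by simp
  qed
  then have "{U. open U} \<subseteq> sigma_sets UNIV ?E" by blast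
  then show "sets borel \<subseteq> sigma_sets UNIV ?E"
    unfolding borel_def using S.sigma_sets_subset by simp
  show "sigma_sets UNIV ?E \<subseteq> sets borel"
  proof -
    have "?E \<subseteq> sets borel" by auto
    then show ?thesis using sets.sigma_sets_subset[of ?E "borel :: 'a measure"] by simp
  qed
qed

text \<open>
  The positive and the negative part of \<open>h\<close> are densities of finite measures that agree on the
  intersection-stable generator of rational boxes, hence agree.
\<close>

lemma AE_zero_if_box_integrals_zero:
  fixes h :: "'a::euclidean_space \<Rightarrow> real"
  assumes int: "integrable lborel h"
    and zero: "\<And>a b. a \<in> rational_vectors \<Longrightarrow> b \<in> rational_vectors \<Longrightarrow>
        (LINT x|lborel. indicator (box a b) x * h x) = 0"
  shows "AE x in lborel. h x = 0"
proof -
  let ?E = "{box a b | a b :: 'a. a \<in> rational_vectors \<and> b \<in> rational_vectors}"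
  let ?P = "density lborel (\<lambda>x. ennreal (h x))" and ?N = "density lborel (\<lambda>x. ennreal (- h x))"
  have h[measurable]: "h \<in> borel_measurable borel" using int by auto
  have fin: "(\<integral>\<^sup>+x. ennreal (h x) \<partial>lborel) \<noteq> \<infinity>" "(\<integral>\<^sup>+x. ennreal (- h x) \<partial>lborel) \<noteq> \<infinity>"
    using int by (auto simp: real_integrable_def)
  have "?P = ?N"
  proof (rule measure_eqI_generator_eq)
    show "Int_stable ?E"
    proof (rule Int_stableI)
      fix A B assume "A \<in> ?E" "B \<in> ?E"
      then obtain a b c d :: 'a where AB: "A = box a b" "B = box c d"
        "{a, b, c, d} \<subseteq> rational_vectors" by auto
      let ?c = "\<Sum>i\<in>Basis. max (a\<bullet>i) (c\<bullet>i) *\<^sub>R i" and ?d = "\<Sum>i\<in>Basis. min (b\<bullet>i) (d\<bullet>i) *\<^sub>R i"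
      have "?c \<in> rational_vectors" "?d \<in> rational_vectors"
        using AB by (auto simp: rational_vectors_def min_def max_def)
      moreover have "A \<inter> B = box ?c ?d" using AB by (simp only: box_Int_box)
      ultimately show "A \<inter> B \<in> ?E" by blast
    qed
    show "?E \<subseteq> Pow UNIV" by simp
    show "sets ?P = sigma_sets UNIV ?E" "sets ?N = sigma_sets UNIV ?E"
      using borel_eq_rational_box by auto
    fix X assume "X \<in> ?E"
    then obtain a b where X: "X = box a b" "a \<in> rational_vectors" "b \<in> rational_vectors" by auto
    define k where "k x = indicator (box a b) x * h x" for x
    have [measurable]: "k \<in> borel_measurable borel" unfolding k_def by measurable
    have ki: "integrable lborel k"
      unfolding k_def using integrable_mult_indicator[OF _ int, of "box a b"] by simp
    have "(LINT x|lborel. k x) = 0" unfolding k_def by (rule zero[OF X(2,3)])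
    then have "enn2real (\<integral>\<^sup>+x. ennreal (k x) \<partial>lborel) = enn2real (\<integral>\<^sup>+x. ennreal (- k x) \<partial>lborel)"
      by (simp add: real_lebesgue_integral_def[OF ki])
    moreover have "(\<integral>\<^sup>+x. ennreal (k x) \<partial>lborel) \<noteq> \<infinity>" "(\<integral>\<^sup>+x. ennreal (- k x) \<partial>lborel) \<noteq> \<infinity>"
      using ki by (auto simp: real_integrable_def)
    ultimately have "(\<integral>\<^sup>+x. ennreal (k x) \<partial>lborel) = (\<integral>\<^sup>+x. ennreal (- k x) \<partial>lborel)"
      by (metis ennreal_enn2real infinity_ennreal_def less_top)
    moreover have "ennreal (k x) = ennreal (h x) * indicator X x" "ennreal (- k x) = ennreal (- h x) * indicator X x" for x
      by (auto simp: k_def X indicator_def)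
    ultimately show "emeasure ?P X = emeasure ?N X"
      using X by (simp add: emeasure_density)
  next
    let ?A = "\<lambda>n::nat. box (- (real n *\<^sub>R One)) (real n *\<^sub>R One) :: 'a set"
    show "range ?A \<subseteq> ?E" by (force simp: rational_vectors_def)
    show "(\<Union>i. ?A i) = UNIV" by (rule UN_box_eq_UNIV)
    fix i
    have "emeasure ?P (?A i) \<le> emeasure ?P UNIV" by (intro emeasure_mono) auto
    also have "\<dots> < \<infinity>" using fin by (simp add: emeasure_density less_top)
    finally show "emeasure ?P (?A i) \<noteq> \<infinity>" by simp
  qed
  then have "AE x in lborel. ennreal (h x) = ennreal (- h x)"
    using finite_density_unique[of "\<lambda>x. ennreal (h x)" lborel "\<lambda>x. ennreal (- h x)"] fin by simp
  then show ?thesis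
    by eventually_elim (metis ennreal_eq_0_iff ennreal_neg ennreal_inj le_less_linear less_imp_le neg_le_0_iff_le
        order_antisym neg_0_less_iff_less)
qed

text \<open>
  Two uses: with \<open>\<Omega> = UNIV\<close> it shows that countably many functions span a dense subspace of \<open>L2\<close>
  (whence the restriction to rational boxes), with a general open set it shows that test functions
  are dense in \<open>L2_on \<Omega>\<close> (whence the restriction to boxes whose closure lies in \<open>\<Omega>\<close>).
\<close>

lemma AE_zero_on_open_if_box_integrals_zero:
  fixes f :: "'a::euclidean_space \<Rightarrow> real"
  assumes f: "f \<in> borel_measurable lebesgue" and \<Omega>: "open \<Omega>"
    and int: "\<And>a b. cbox a b \<subseteq> \<Omega> \<Longrightarrow> integrable lebesgue (\<lambda>x. indicator (box a b) x * f x)"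
    and zero: "\<And>a b. a \<in> rational_vectors \<Longrightarrow> b \<in> rational_vectors \<Longrightarrow> cbox a b \<subseteq> \<Omega> \<Longrightarrow>
        (LINT x|lebesgue. indicator (box a b) x * f x) = 0"
  shows "AE x in lebesgue. x \<in> \<Omega> \<longrightarrow> f x = 0"
proof -
  obtain f' where f'[measurable]: "f' \<in> borel_measurable lborel" and ae: "AE x in lborel. f x = f' x"
    using completion_ex_borel_measurable_real[OF f] by blast
  have aeL: "AE x in lebesgue. f x = f' x" by (rule AE_completion[OF ae])
  have f'L: "f' \<in> borel_measurable lebesgue"
    using f' by (simp add: measurable_completion)
  define I where "I = {(a, b). a \<in> rational_vectors \<and> b \<in> rational_vectors \<and> cbox a b \<subseteq> \<Omega>}"
  have "I \<subseteq> rational_vectors \<times> rational_vectors" by (auto simp: I_def)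
  then have cI: "countable I" by (rule countable_subset) (simp add: countable_rational_vectors)
  have "AE x in lborel. x \<in> box (fst p) (snd p) \<longrightarrow> f' x = 0" if p: "p \<in> I" for p
  proof -
    obtain a b where ab: "p = (a, b)" "a \<in> rational_vectors" "b \<in> rational_vectors" "cbox a b \<subseteq> \<Omega>"
      using p by (auto simp: I_def)
    define h where "h x = indicator (box a b) x * f' x" for x
    have h[measurable]: "h \<in> borel_measurable borel" unfolding h_def by measurable
    have eq: "integrable lborel (\<lambda>x. indicator (box c d) x * f' x) \<and>
        (LINT x|lborel. indicator (box c d) x * f' x) = (LINT x|lebesgue. indicator (box c d) x * f x)"
      if "cbox c d \<subseteq> \<Omega>" for c d
    proof -
      have m: "(\<lambda>x. indicator (box c d) x * f' x) \<in> borel_measurable lborel" by measurable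
      have mL: "(\<lambda>x. indicator (box c d) x * f x) \<in> borel_measurable lebesgue"
        using f by (intro borel_measurable_times borel_measurable_indicator) auto
      have mL': "(\<lambda>x. indicator (box c d) x * f' x) \<in> borel_measurable lebesgue"
        using f'L by (intro borel_measurable_times borel_measurable_indicator) auto
      have "AE x in lebesgue. indicator (box c d) x * f x = indicator (box c d) x * f' x"
        using aeL by eventually_elim simp
      then have "integrable lebesgue (\<lambda>x. indicator (box c d) x * f' x)"
        "(LINT x|lebesgue. indicator (box c d) x * f' x) = (LINT x|lebesgue. indicator (box c d) x * f x)"
        using int[OF that] integrable_cong_AE[OF mL mL'] integral_cong_AE[OF mL mL'] by auto
      then show ?thesis
        using m integrable_completion[OF m] integral_completion[OF m] by simp
    qed
    have "AE x in lborel. h x = 0"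
    proof (rule AE_zero_if_box_integrals_zero)
      show "integrable lborel h" unfolding h_def using eq ab by blast
      fix c d :: 'a assume cd: "c \<in> rational_vectors" "d \<in> rational_vectors"
      let ?c = "\<Sum>i\<in>Basis. max (c\<bullet>i) (a\<bullet>i) *\<^sub>R i" and ?d = "\<Sum>i\<in>Basis. min (d\<bullet>i) (b\<bullet>i) *\<^sub>R i"
      have r: "?c \<in> rational_vectors" "?d \<in> rational_vectors"
        using cd ab by (auto simp: rational_vectors_def min_def max_def)
      have "cbox ?c ?d \<subseteq> cbox a b" by (auto simp: mem_box)
      then have sub: "cbox ?c ?d \<subseteq> \<Omega>" using ab by blast
      have "indicator (box c d) x * h x = indicator (box ?c ?d) x * f' x" for x
        unfolding h_def box_Int_box[symmetric] by (simp add: indicator_inter_arith)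
      then show "(LINT x|lborel. indicator (box c d) x * h x) = 0"
        using eq[OF sub] zero[OF r sub] by simp
    qed
    then show ?thesis by eventually_elim (auto simp: h_def ab indicator_def)
  qed
  then have "AE x in lborel. \<forall>p\<in>I. x \<in> box (fst p) (snd p) \<longrightarrow> f' x = 0"
    by (intro AE_ball_countable[OF cI, THEN iffD2] ballI)
  then have "AE x in lebesgue. \<forall>p\<in>I. x \<in> box (fst p) (snd p) \<longrightarrow> f' x = 0"
    by (rule AE_completion)
  with aeL show ?thesis
  proof eventually_elim
    case (elim x)
    show ?case
    proof
      assume "x \<in> \<Omega>"
      then obtain e where e: "e > 0" "cball x e \<subseteq> \<Omega>" using \<Omega> by (auto simp: open_contains_cball)
      obtain a b where ab: "\<forall>i\<in>Basis. a \<bullet> i \<in> \<rat> \<and> b \<bullet> i \<in> \<rat>" "x \<in> box a b" "box a b \<subseteq> ball x e"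
        using rational_boxes[OF \<open>e > 0\<close>] by metis
      have "cbox a b = closure (box a b)" using ab(2) closure_box by blast
      also have "\<dots> \<subseteq> cball x e" using ab(3) closure_minimal[OF _ closed_cball] ball_subset_cball by blast
      finally have "(a, b) \<in> I" using e ab by (auto simp: I_def rational_vectors_def)
      then show "f x = 0" using elim ab(2) by fastforce
    qed
  qed
qed


section \<open>The space \<open>L\<^sup>2\<close> is complete and separable\<close>

lemma L2_representative:
  obtains f where "square_integrable f" and "to_L2 f = F"
proof -
  have "\<exists>f. square_integrable f \<and> to_L2 f = F" by transfer auto
  then show ?thesis using that by blast
qed

lemma to_L2_add:
  "square_integrable f \<Longrightarrow> square_integrable g \<Longrightarrow> to_L2 f + to_L2 g = to_L2 (\<lambda>x. f x + g x)"
  by transfer (simp add: square_integrable_add)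

lemma square_integrable_diff:
  "square_integrable f \<Longrightarrow> square_integrable g \<Longrightarrow> square_integrable (\<lambda>x. f x - g x)"
  using square_integrable_add[OF _ square_integrable_scale[where c = "-1"]] by auto

lemma to_L2_diff:
  "square_integrable f \<Longrightarrow> square_integrable g \<Longrightarrow> to_L2 f - to_L2 g = to_L2 (\<lambda>x. f x - g x)"
  by transfer (simp add: square_integrable_diff)

lemma to_L2_scaleR: "square_integrable f \<Longrightarrow> c *\<^sub>R to_L2 f = to_L2 (\<lambda>x. c * f x)"
  by transfer (simp add: square_integrable_scale)

lemma inner_to_L2:
  "square_integrable f \<Longrightarrow> square_integrable g \<Longrightarrow> inner (to_L2 f) (to_L2 g) = (LINT x|lebesgue. f x * g x)"
  by transfer simp

lemma to_L2_eq_0_iff: "square_integrable f \<Longrightarrow> to_L2 f = 0 \<longleftrightarrow> (AE x in lebesgue. f x = 0)"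
  by transfer (simp add: square_integrable_zero)

lemma norm_to_L2: "square_integrable f \<Longrightarrow> (norm (to_L2 f))\<^sup>2 = (LINT x|lebesgue. (f x)\<^sup>2)"
  unfolding power2_norm_eq_inner by (simp only: inner_to_L2) (simp add: power2_eq_square)

lemma nn_integral_norm_to_L2:
  "square_integrable f \<Longrightarrow> (\<integral>\<^sup>+x. ennreal ((f x)\<^sup>2) \<partial>lebesgue) = ennreal ((norm (to_L2 f))\<^sup>2)"
  by (subst nn_integral_eq_integral) (auto simp: norm_to_L2 square_integrable_def)

instance L2 :: (euclidean_space) banach
proof
  fix X :: "nat \<Rightarrow> 'a L2" assume X: "Cauchy X"
  have "\<exists>N. \<forall>m\<ge>N. \<forall>n\<ge>N. dist (X m) (X n) < (1/2) ^ k" for k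
    using X unfolding Cauchy_def by simp
  then obtain N where N: "\<And>k m n. m \<ge> N k \<Longrightarrow> n \<ge> N k \<Longrightarrow> dist (X m) (X n) < (1/2) ^ k" by metis
  define r where "r n = n + Max (N ` {..n})" for n
  have r_ge: "N k \<le> r n" if "k \<le> n" for k n
    unfolding r_def using that by (intro trans_le_add2 Max_ge) auto
  have "strict_mono r"
    unfolding strict_mono_Suc_iff
  proof
    fix n
    have "Max (N ` {..n}) \<le> Max (N ` {..Suc n})" by (intro Max_mono) auto
    then show "r n < r (Suc n)" unfolding r_def by linarith
  qed
  have "\<exists>f. square_integrable f \<and> to_L2 f = X (r n)" for n using L2_representative by metis
  then obtain f where f: "\<And>n. square_integrable (f n)" and Xf: "\<And>n. X (r n) = to_L2 (f n)" by metis
  have sq: "((1/2) ^ m)\<^sup>2 = (1/4 :: real) ^ m" for m :: nat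
    by (simp add: power2_eq_square flip: power_mult_distrib)
  have fast: "(\<integral>\<^sup>+x. ennreal ((norm (f m x - f n x))\<^sup>2) \<partial>lebesgue) \<le> ennreal (1 * (1/4) ^ m)" if "m \<le> n" for m n
  proof -
    have "(\<integral>\<^sup>+x. ennreal ((norm (f m x - f n x))\<^sup>2) \<partial>lebesgue) = ennreal ((norm (X (r m) - X (r n)))\<^sup>2)"
      using nn_integral_norm_to_L2[OF square_integrable_diff[OF f f], of m n]
      by (simp add: Xf to_L2_diff f)
    also have "norm (X (r m) - X (r n)) \<le> (1/2) ^ m"
      using N[OF r_ge r_ge, of m m n] that by (simp add: dist_norm)
    then have "(norm (X (r m) - X (r n)))\<^sup>2 \<le> ((1/2) ^ m)\<^sup>2" by (rule power_mono) simp
    then have "(norm (X (r m) - X (r n)))\<^sup>2 \<le> 1 * (1/4) ^ m"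
      unfolding sq by simp
    finally show ?thesis by (simp add: ennreal_leI)
  qed
  obtain g where g: "g \<in> borel_measurable lebesgue"
    and fg: "\<And>m. (\<integral>\<^sup>+x. ennreal ((norm (f m x - g x))\<^sup>2) \<partial>lebesgue) \<le> ennreal (1 * (1/4) ^ m)"
  proof (rule AE_limit_of_fast_L2_Cauchy[OF _ fast])
    show "f n \<in> borel_measurable lebesgue" for n using f by (simp add: square_integrable_def)
  next
    fix g assume "g \<in> borel_measurable lebesgue"
      "\<And>m. (\<integral>\<^sup>+x. ennreal ((norm (f m x - g x))\<^sup>2) \<partial>lebesgue) \<le> ennreal (1 * (1/4) ^ m)"
    then show ?thesis by (rule that)
  qed
  have si: "square_integrable (\<lambda>x. f m x - g x)" for m
    unfolding square_integrable_def
  proof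
    show m: "(\<lambda>x. f m x - g x) \<in> borel_measurable lebesgue"
      using f[of m] g by (intro borel_measurable_diff) (auto simp: square_integrable_def)
    show "integrable lebesgue (\<lambda>x. (f m x - g x)\<^sup>2)"
    proof (rule integrableI_nonneg)
      show "(\<lambda>x. (f m x - g x)\<^sup>2) \<in> borel_measurable lebesgue" using m by measurable
      show "(\<integral>\<^sup>+x. ennreal ((f m x - g x)\<^sup>2) \<partial>lebesgue) < \<infinity>"
        using fg[of m] by (auto simp: less_top[symmetric] top_unique)
    qed auto
  qed
  have "square_integrable (\<lambda>x. f 0 x - (f 0 x - g x))"
    by (intro square_integrable_diff f si)
  then have sg: "square_integrable g" by simp
  have "(\<lambda>n. X (r n)) \<longlonglongrightarrow> to_L2 g"
  proof -
    have "norm (X (r m) - to_L2 g) \<le> (1/2) ^ m" for m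
    proof -
      have "ennreal ((norm (X (r m) - to_L2 g))\<^sup>2) \<le> ennreal ((1/4) ^ m)"
        using fg[of m] nn_integral_norm_to_L2[OF si, of m] by (simp add: Xf to_L2_diff f sg)
      then have "(norm (X (r m) - to_L2 g))\<^sup>2 \<le> ((1/2) ^ m)\<^sup>2"
        unfolding sq by simp
      then show ?thesis by (rule power2_le_imp_le) simp
    qed
    moreover have "(\<lambda>m. (1/2 :: real) ^ m) \<longlonglongrightarrow> 0" by (rule LIMSEQ_power_zero) simp
    ultimately have "(\<lambda>m. X (r m) - to_L2 g) \<longlonglongrightarrow> 0"
      by (rule Lim_null_comparison[OF always_eventually[OF allI]])
    then show ?thesis by (simp add: LIM_zero_iff)
  qed
  then have "X \<longlonglongrightarrow> to_L2 g"
    using Cauchy_converges_subseq[OF X \<open>strict_mono r\<close>] by (simp add: o_def)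
  then show "convergent X" by (auto simp: convergent_def)
qed

lemma square_integrable_indicator_box: "square_integrable (indicator (box a b))"
  unfolding square_integrable_def
proof
  show "indicator (box a b) \<in> borel_measurable lebesgue" by (rule borel_measurable_indicator) simp
  have "(\<lambda>x. (indicator (box a b) x)\<^sup>2) = (indicator (box a b) :: 'a \<Rightarrow> real)"
    by (auto simp: indicator_def)
  moreover have "integrable lebesgue (indicator (box a b) :: 'a \<Rightarrow> real)"
    by (intro integrable_real_indicator) (use emeasure_lborel_box_finite[of a b] in \<open>auto simp: less_top\<close>)
  ultimately show "integrable lebesgue (\<lambda>x. (indicator (box a b) x :: real)\<^sup>2)" by simp
qed

lemma L2_zero_if_orthogonal_to_boxes:
  fixes F :: "'a::euclidean_space L2"
  assumes "\<And>a b. a \<in> rational_vectors \<Longrightarrow> b \<in> rational_vectors \<Longrightarrow> inner F (to_L2 (indicator (box a b))) = 0"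
  shows "F = 0"
proof -
  obtain f where f: "square_integrable f" and F: "to_L2 f = F" using L2_representative by blast
  have "AE x in lebesgue. x \<in> UNIV \<longrightarrow> f x = 0"
  proof (rule AE_zero_on_open_if_box_integrals_zero)
    show "f \<in> borel_measurable lebesgue" using f by (simp add: square_integrable_def)
    show "integrable lebesgue (\<lambda>x. indicator (box a b) x * f x)" for a b
      by (intro square_integrable_mult square_integrable_indicator_box f)
    fix a b :: 'a assume "a \<in> rational_vectors" "b \<in> rational_vectors"
    then show "(LINT x|lebesgue. indicator (box a b) x * f x) = 0"
      using assms[of a b] inner_to_L2[OF f square_integrable_indicator_box, of a b] F by (simp add: mult.commute)
  qed simp
  then show ?thesis using to_L2_eq_0_iff[OF f] F by simp
qed

lemma subspace_closure:
  fixes S :: "'h::real_normed_vector set"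
  assumes S: "subspace S"
  shows "subspace (closure S)"
  unfolding subspace_def
proof (intro conjI ballI allI)
  show "0 \<in> closure S" using subspace_0[OF S] closure_subset by blast
next
  fix x y assume "x \<in> closure S" "y \<in> closure S"
  then obtain f g where f: "\<forall>n. f n \<in> S" "f \<longlonglongrightarrow> x" and g: "\<forall>n. g n \<in> S" "g \<longlonglongrightarrow> y"
    unfolding closure_sequential by blast
  have "(\<lambda>n. f n + g n) \<longlonglongrightarrow> x + y" using f g by (intro tendsto_add) auto
  moreover have "\<forall>n. f n + g n \<in> S" using f g S by (simp add: subspace_add)
  ultimately show "x + y \<in> closure S" unfolding closure_sequential by (intro exI[of _ "\<lambda>n. f n + g n"]) auto
next
  fix c x assume "x \<in> closure S"
  then obtain f where f: "\<forall>n. f n \<in> S" "f \<longlonglongrightarrow> x"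
    unfolding closure_sequential by blast
  have "(\<lambda>n. c *\<^sub>R f n) \<longlonglongrightarrow> c *\<^sub>R x" using f by (intro tendsto_intros) auto
  moreover have "\<forall>n. c *\<^sub>R f n \<in> S" using f S by (simp add: subspace_scale)
  ultimately show "c *\<^sub>R x \<in> closure S" unfolding closure_sequential by (intro exI[of _ "\<lambda>n. c *\<^sub>R f n"]) auto
qed

text \<open>
  Project onto the closed span: the remainder is orthogonal to \<open>S\<close>, hence zero.
\<close>

lemma closure_span_eq_UNIV_if_orthogonal_zero:
  fixes S :: "'h::{real_inner, banach} set"
  assumes "\<And>x. (\<And>s. s \<in> S \<Longrightarrow> inner x s = 0) \<Longrightarrow> x = 0"
  shows "closure (span S) = UNIV"
proof -
  have sub: "subspace (closure (span S))" by (intro subspace_closure) simp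
  have "p \<in> closure (span S)" for p
  proof -
    obtain z where z: "z \<in> closure (span S)" "\<And>w. w \<in> closure (span S) \<Longrightarrow> inner (p - z) w = 0"
      using orthogonal_projection_exists[OF sub closed_closure] by metis
    have "p - z = 0"
    proof (rule assms)
      fix s assume "s \<in> S"
      then have "s \<in> closure (span S)" using closure_subset span_base by blast
      then show "inner (p - z) s = 0" by (rule z(2))
    qed
    then show ?thesis using z(1) by simp
  qed
  then show ?thesis by blast
qed

lemma countable_dense_subset_of_span:
  fixes S :: "'h::real_normed_vector set"
  assumes "countable S"
  obtains T where "countable T" and "span S \<subseteq> closure T"
proof -
  \<comment> \<open>Rational linear combinations, built up one summand at a time.\<close>
  define R where "R T = (\<lambda>(t, q, s). t + real_of_rat q *\<^sub>R s) ` (T \<times> UNIV \<times> S)" for T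
  define T where "T = (\<Union>n. (R ^^ n) {0})"
  have cn: "countable ((R ^^ n) {0})" for n
    by (induction n) (auto simp: R_def assms)
  then have "countable T" by (simp add: T_def)
  moreover have "span S \<subseteq> closure T"
  proof
    fix x assume "x \<in> span S"
    then show "x \<in> closure T"
    proof (induction rule: span_induct_alt)
      case base
      have "0 \<in> (R ^^ 0) {0}" by simp
      then have "0 \<in> T" unfolding T_def by blast
      then show ?case using closure_subset by blast
    next
      case (step c s y)
      show ?case
        unfolding closure_approachable
      proof safe
        fix e :: real assume e: "e > 0"
        obtain t where t: "t \<in> T" "dist t y < e / 2"
          using step(2) e unfolding closure_approachable by (meson half_gt_zero)
        obtain n where n: "t \<in> (R ^^ n) {0}" using t by (auto simp: T_def)
        define \<delta> where "\<delta> = e / (2 * (norm s + 1))"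
        have \<delta>: "\<delta> > 0" using e by (auto simp: \<delta>_def intro!: divide_pos_pos add_nonneg_pos)
        obtain q where q: "c < real_of_rat q" "real_of_rat q < c + \<delta>"
          using of_rat_dense[of c "c + \<delta>"] \<delta> by auto
        have "t + real_of_rat q *\<^sub>R s \<in> (R ^^ Suc n) {0}"
          using n step(1) unfolding funpow.simps o_apply R_def by (intro image_eqI[of _ _ "(t, q, s)"]) auto
        then have "t + real_of_rat q *\<^sub>R s \<in> T" unfolding T_def by blast
        moreover have "dist (t + real_of_rat q *\<^sub>R s) (c *\<^sub>R s + y) < e"
        proof -
          have "dist (t + real_of_rat q *\<^sub>R s) (c *\<^sub>R s + y) = norm ((t - y) + (real_of_rat q - c) *\<^sub>R s)"
            by (simp add: dist_norm algebra_simps)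
          also have "\<dots> \<le> norm (t - y) + \<bar>real_of_rat q - c\<bar> * norm s"
            by (rule order_trans[OF norm_triangle_ineq]) simp
          also have "\<bar>real_of_rat q - c\<bar> * norm s \<le> \<delta> * (norm s + 1)"
            using q by (intro mult_mono) auto
          also have "\<delta> * (norm s + 1) = e / 2"
            using norm_ge_zero[of s] by (simp add: \<delta>_def field_simps add_nonneg_eq_0_iff)
          finally show ?thesis using t by (simp add: dist_norm)
        qed
        ultimately show "\<exists>y'\<in>T. dist y' (c *\<^sub>R s + y) < e" by blast
      qed
    qed
  qed
  ultimately show ?thesis using that by blast
qed

instance L2 :: (euclidean_space) second_countable_topology
proof
  define S where "S = {to_L2 (indicator (box a b)) | a b :: 'a. a \<in> rational_vectors \<and> b \<in> rational_vectors}"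
  have "S = (\<lambda>(a, b). to_L2 (indicator (box a b))) ` (rational_vectors \<times> rational_vectors)"
    by (auto simp: S_def)
  then have "countable S" using countable_rational_vectors by auto
  then obtain T where T: "countable T" "span S \<subseteq> closure T" using countable_dense_subset_of_span by blast
  have "closure (span S) = UNIV"
    by (rule closure_span_eq_UNIV_if_orthogonal_zero)
       (rule L2_zero_if_orthogonal_to_boxes, auto simp: S_def)
  then have "closure T = UNIV" using T(2) closure_minimal[OF T(2) closed_closure] by auto
  with T(1) show "\<exists>B::'a L2 set set. countable B \<and> open = generate_topology B"
    by (rule second_countable_if_separable)
qed

section \<open>Integrals over time intervals\<close>

text \<open>
  All time integrals run over open intervals \<open>{0<..<t}\<close>; a finite measure space for each \<open>t\<close> is more
  convenient than indicator functions. For \<open>t \<le> 0\<close> it is the zero measure.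
\<close>

abbreviation Leb :: "real \<Rightarrow> real measure" where
  "Leb t \<equiv> lebesgue_on {0<..<t}"

lemma finite_measure_Leb: "finite_measure (Leb t)"
  using finite_measure_lebesgue_on[OF lmeasurable_box[of 0 t]] by (simp add: box_real)

lemma sigma_finite_Leb: "sigma_finite_measure (Leb t)"
  using finite_measure_Leb finite_measure_def by blast

lemma measure_Leb: "0 \<le> s \<Longrightarrow> s \<le> t \<Longrightarrow> measure (Leb t) {0<..<s} = s"
  by (subst measure_restrict_space) auto

lemma integrable_Leb_bounded:
  fixes f :: "real \<Rightarrow> 'b::{banach, second_countable_topology}"
  assumes "f \<in> borel_measurable (Leb t)" and "\<And>s. 0 < s \<Longrightarrow> s < t \<Longrightarrow> norm (f s) \<le> B"
  shows "integrable (Leb t) f"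
  by (rule finite_measure.integrable_const_bound[OF finite_measure_Leb, where B = B])
     (use assms in \<open>auto simp: space_restrict_space intro!: AE_I2\<close>)

lemma norm_integral_Leb_le:
  fixes f :: "real \<Rightarrow> 'b::{banach, second_countable_topology}"
  assumes B: "\<And>s. 0 < s \<Longrightarrow> s < t \<Longrightarrow> norm (f s) \<le> B" and t: "0 \<le> t" "0 \<le> B"
  shows "norm (LINT s|Leb t. f s) \<le> B * t"
proof (cases "integrable (Leb t) f")
  case True
  have "norm (LINT s|Leb t. f s) \<le> (LINT s|Leb t. norm (f s))" by (rule integral_norm_bound)
  also have "\<dots> \<le> (LINT s|Leb t. B)"
    using True B finite_measure_Leb[of t]
    by (intro integral_mono integrable_norm) (auto simp: space_restrict_space finite_measure.integrable_const)
  also have "\<dots> = B * t" using t by (simp add: measure_Leb space_restrict_space)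
  finally show ?thesis .
next
  case False
  then show ?thesis using t by (simp add: not_integrable_integral_eq)
qed

lemma measurable_Leb_restrict:
  "f \<in> borel_measurable (lebesgue_on J) \<Longrightarrow> {0<..<t} \<subseteq> J \<Longrightarrow> f \<in> borel_measurable (Leb t)"
  by (rule measurable_restrict_mono)

lemma measurable_Leb_lebesgue: "f \<in> borel_measurable lebesgue \<Longrightarrow> f \<in> borel_measurable (Leb t)"
  by (rule measurable_restrict_space1)

lemma measurable_Leb_continuous:
  fixes f :: "real \<Rightarrow> 'b::{metric_space, second_countable_topology}"
  assumes "continuous_on J f" "{0<..<t} \<subseteq> J"
  shows "f \<in> borel_measurable (Leb t)"
proof -
  have "continuous_on {0<..<t} f" using assms continuous_on_subset by blast
  then have "f \<in> borel_measurable (restrict_space borel {0<..<t})"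
    by (rule borel_measurable_continuous_on_restrict)
  then show ?thesis
    by (rule measurable_mono[THEN subsetD, rotated -1])
       (auto simp: sets_restrict_space space_restrict_space)
qed

lemma integrable_Leb_continuous:
  fixes g :: "real \<Rightarrow> 'b::{banach, second_countable_topology}"
  assumes "continuous_on UNIV g"
  shows "integrable (Leb t) g"
proof -
  have "compact (g ` {0..t})"
    by (intro compact_continuous_image continuous_on_subset[OF assms]) auto
  then obtain B where B: "\<And>s. s \<in> {0..t} \<Longrightarrow> norm (g s) \<le> B"
    using compact_imp_bounded bounded_iff by (metis (no_types, lifting) imageI)
  show ?thesis
    by (rule integrable_Leb_bounded[OF measurable_Leb_continuous[OF assms], of _ B]) (use B in auto)
qed

lemma integrable_Leb_bounded_lebesgue:
  fixes f :: "real \<Rightarrow> 'b::{banach, second_countable_topology}"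
  assumes "f \<in> borel_measurable lebesgue" and "\<And>s. norm (f s) \<le> M"
  shows "integrable (Leb t) f"
  by (rule integrable_Leb_bounded[OF measurable_Leb_lebesgue]) (rule assms)+

lemma integral_Leb_as_indicator:
  fixes g :: "real \<Rightarrow> 'b::{banach, second_countable_topology}"
  assumes "s \<le> t"
  shows "(LINT r|Leb s. g r) = (LINT r|Leb t. indicator {0<..<s} r *\<^sub>R g r)"
proof -
  have "(LINT r|Leb s. g r) = (LINT r|lebesgue. indicator {0<..<s} r *\<^sub>R g r)"
    by (rule integral_restrict_space) simp
  also have "\<dots> = (LINT r|lebesgue. indicator {0<..<t} r *\<^sub>R indicator {0<..<s} r *\<^sub>R g r)"
    using assms by (intro Bochner_Integration.integral_cong) (auto simp: indicator_def)
  also have "\<dots> = (LINT r|Leb t. indicator {0<..<s} r *\<^sub>R g r)"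
    by (rule integral_restrict_space[symmetric]) simp
  finally show ?thesis .
qed

lemma interval_in_sets_Leb: "s \<le> t \<Longrightarrow> {0<..<s} \<in> sets (Leb t)"
  by (simp add: sets_restrict_space_iff) auto

lemma integral_Leb_increment:
  fixes g :: "real \<Rightarrow> 'b::{banach, second_countable_topology}"
  assumes g: "g \<in> borel_measurable (Leb t)" and B: "\<And>r. 0 < r \<Longrightarrow> r < t \<Longrightarrow> norm (g r) \<le> B"
    and st: "0 \<le> s" "s \<le> t" and B0: "0 \<le> B"
  shows "norm ((LINT r|Leb t. g r) - (LINT r|Leb s. g r)) \<le> B * (t - s)"
proof -
  have int: "integrable (Leb t) g" by (rule integrable_Leb_bounded[OF g B])
  have int2: "integrable (Leb t) (\<lambda>r. indicator {0<..<s} r *\<^sub>R g r)"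
    using st by (intro integrable_mult_indicator int interval_in_sets_Leb)
  have int3: "integrable (Leb t) (\<lambda>r. B)" "integrable (Leb t) (\<lambda>r. B * indicator {0<..<s} r)"
    using st finite_measure.emeasure_finite[OF finite_measure_Leb, of t]
    by (auto intro!: integrable_Leb_bounded[where B = B] integrable_mult_right integrable_real_indicator
        interval_in_sets_Leb simp: B0 less_top[symmetric] simp del: integrable_mult_right_iff)
  have "(LINT r|Leb t. g r) - (LINT r|Leb s. g r) = (LINT r|Leb t. g r - indicator {0<..<s} r *\<^sub>R g r)"
    using int int2 st by (simp add: integral_Leb_as_indicator)
  also have "norm \<dots> \<le> (LINT r|Leb t. norm (g r - indicator {0<..<s} r *\<^sub>R g r))" by (rule integral_norm_bound)
  also have "\<dots> \<le> (LINT r|Leb t. B - B * indicator {0<..<s} r)"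
  proof (rule integral_mono)
    show "norm (g r - indicator {0<..<s} r *\<^sub>R g r) \<le> B - B * indicator {0<..<s} r" if "r \<in> space (Leb t)" for r
      using B[of r] that by (auto simp: indicator_def space_restrict_space)
  qed (use int int2 int3 in auto)
  also have "\<dots> = B * t - B * s"
    using int3 st by (simp add: measure_Leb space_restrict_space Int_absorb2 subset_iff)
  finally show ?thesis by (simp add: right_diff_distrib)
qed

section \<open>The energy identity\<close>

text \<open>
  The chain rule for \<open>t \<mapsto> \<langle>A G(t), G(t)\<rangle>\<close> with \<open>G\<close> the primitive of a function \<open>g\<close> that is merely
  integrable. Expanding the right-hand side gives the integral of \<open>\<langle>A (g r), g s\<rangle>\<close> over a square, and
  by symmetry of the kernel this is twice the integral over the triangle \<open>r < s\<close>. Controls are only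
  measurable, so \<open>G\<close> cannot be differentiated pointwise.
\<close>

lemma triangle_integral_eq_half_square:
  fixes g :: "real \<Rightarrow> 'h::{real_inner, banach, second_countable_topology}"
  assumes A: "bounded_linear A" and sym: "\<And>x y. inner (A x) y = inner x (A y)"
    and g: "integrable (Leb t) g"
  shows "integrable (Leb t) (\<lambda>s. inner (A (LINT r|Leb s. g r)) (g s))" (is ?int)
    and "2 * (LINT s|Leb t. inner (A (LINT r|Leb s. g r)) (g s)) =
      inner (A (LINT s|Leb t. g s)) (LINT s|Leb t. g s)" (is ?eq)
proof -
  let ?M = "Leb t"
  interpret sigma_finite_measure ?M by (rule sigma_finite_Leb)
  interpret P: pair_sigma_finite ?M ?M ..
  interpret A: bounded_linear A by (rule A)
  have gm[measurable]: "g \<in> borel_measurable ?M" using g by auto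
  have Am[measurable]: "A \<in> borel_measurable borel"
    using A.continuous_on[OF continuous_on_id] by (simp add: borel_measurable_continuous_onI)
  have idm[measurable]: "(\<lambda>x. x) \<in> borel_measurable ?M"
    by (intro measurable_Leb_continuous[of UNIV] continuous_intros) simp
  have fstm[measurable]: "fst \<in> borel_measurable (?M \<Otimes>\<^sub>M ?M)"
    using measurable_compose[OF measurable_fst idm] by simp
  have sndm[measurable]: "snd \<in> borel_measurable (?M \<Otimes>\<^sub>M ?M)"
    using measurable_compose[OF measurable_snd idm] by simp
  define k where "k s r = inner (A (g r)) (g s)" for s r
  define h where "h s r = (if r < s then k s r else 0)" for s r
  have km: "(\<lambda>p. k (fst p) (snd p)) \<in> borel_measurable (?M \<Otimes>\<^sub>M ?M)"
    unfolding k_def by measurable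
  have h_eq: "h (fst p) (snd p) = (if snd p < fst p then k (fst p) (snd p) else 0)" for p
    by (simp add: h_def)
  have hm: "(\<lambda>p. h (fst p) (snd p)) \<in> borel_measurable (?M \<Otimes>\<^sub>M ?M)"
    unfolding h_eq using km by measurable
  obtain K where K: "K > 0" "\<And>x. norm (A x) \<le> norm x * K" using A.pos_bounded by blast
  have kb: "\<bar>k s r\<bar> \<le> norm (g s) * (norm (g r) * K)" for s r
  proof -
    have "\<bar>k s r\<bar> \<le> norm (A (g r)) * norm (g s)" unfolding k_def by (rule Cauchy_Schwarz_ineq2)
    also have "\<dots> \<le> (norm (g r) * K) * norm (g s)" by (intro mult_right_mono K) auto
    finally show ?thesis by (simp add: mult_ac)
  qed
  have gb: "integrable (?M \<Otimes>\<^sub>M ?M) (\<lambda>p. norm (g (fst p)) * (norm (g (snd p)) * K))"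
    by (rule P.Fubini_integrable) (use g K in \<open>auto simp: abs_mult\<close>)
  have ki: "integrable (?M \<Otimes>\<^sub>M ?M) (\<lambda>p. k (fst p) (snd p))"
    by (rule Bochner_Integration.integrable_bound[OF gb km]) (use kb in \<open>auto intro!: AE_I2 order_trans[OF kb]\<close>)
  have hi: "integrable (?M \<Otimes>\<^sub>M ?M) (\<lambda>p. h (fst p) (snd p))"
    by (rule Bochner_Integration.integrable_bound[OF gb hm])
       (use K in \<open>auto intro!: AE_I2 order_trans[OF kb] simp: h_eq\<close>)
  have hi': "integrable (?M \<Otimes>\<^sub>M ?M) (\<lambda>(s, r). h s r)" and ki': "integrable (?M \<Otimes>\<^sub>M ?M) (\<lambda>(s, r). k s r)"
    using hi ki by (simp_all add: case_prod_beta')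
  have ind_int: "integrable ?M (\<lambda>r. indicator {0<..<s} r *\<^sub>R g r)" if "s \<in> space ?M" for s
    using that by (intro integrable_mult_indicator g interval_in_sets_Leb) (auto simp: space_restrict_space)
  have inner_k: "(LINT r|?M. k s r) = inner (A (LINT r|?M. g r)) (g s)" for s
  proof -
    have "bounded_linear (\<lambda>x. inner (A x) (g s))"
      by (intro bounded_linear_compose[OF bounded_linear_inner_left A])
    from integral_bounded_linear[OF this g] show ?thesis by (simp add: k_def)
  qed
  have inner_h: "(LINT r|?M. h s r) = inner (A (LINT r|Leb s. g r)) (g s)" if "s \<in> space ?M" for s
  proof -
    have "bounded_linear (\<lambda>x. inner (A x) (g s))"
      by (intro bounded_linear_compose[OF bounded_linear_inner_left A])
    from integral_bounded_linear[OF this ind_int[OF that]]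
    have "(LINT r|?M. indicator {0<..<s} r * k s r) = inner (A (LINT r|?M. indicator {0<..<s} r *\<^sub>R g r)) (g s)"
      by (simp add: k_def A.scaleR)
    also have "(LINT r|?M. indicator {0<..<s} r * k s r) = (LINT r|?M. h s r)"
      by (rule Bochner_Integration.integral_cong) (auto simp: h_def space_restrict_space)
    also have "(LINT r|?M. indicator {0<..<s} r *\<^sub>R g r) = (LINT r|Leb s. g r)"
      using that by (subst integral_Leb_as_indicator) (auto simp: space_restrict_space)
    finally show ?thesis .
  qed
  have "integrable ?M (\<lambda>s. LINT r|?M. h s r)"
    using P.integrable_fst[OF hi'] by simp
  then show ?int
    by (rule Bochner_Integration.integrable_cong[THEN iffD1, rotated -1]) (auto simp: inner_h)
  \<comment> \<open>The diagonal is a null set, and the kernel is symmetric.\<close>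
  have hsum: "(LINT r|?M. k s r) = (LINT r|?M. h s r) + (LINT r|?M. h r s)"
    if "integrable ?M (\<lambda>r. h s r)" "integrable ?M (\<lambda>r. h r s)" for s
  proof -
    have "(LINT r|?M. k s r) = (LINT r|?M. h s r + h r s)"
    proof (rule integral_cong_AE)
      have "AE r in lebesgue. r \<noteq> s" by (rule AE_completion) (rule AE_lborel_singleton)
      then have "AE r in ?M. r \<noteq> s" by (subst AE_restrict_space_iff) (auto elim: eventually_mono)
      then show "AE r in ?M. k s r = h s r + h r s"
      proof eventually_elim
        case (elim r)
        have "k r s = k s r" unfolding k_def by (metis sym inner_commute)
        then show ?case using elim by (auto simp: h_def indicator_def)
      qed
      show "(\<lambda>r. k s r) \<in> borel_measurable ?M" unfolding k_def by measurable
      show "(\<lambda>r. h s r + h r s) \<in> borel_measurable ?M" using that by measurable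
    qed
    then show ?thesis using that by simp
  qed
  have hi_swap: "integrable (?M \<Otimes>\<^sub>M ?M) (\<lambda>(s, r). h r s)"
    using P.integrable_product_swap[OF hi'] by (simp add: case_prod_beta')
  have "inner (A (LINT s|?M. g s)) (LINT s|?M. g s) = (LINT s|?M. inner (A (LINT r|?M. g r)) (g s))"
    using g by simp
  also have "\<dots> = (LINT s|?M. (LINT r|?M. k s r))" by (simp add: inner_k)
  also have "\<dots> = (LINT s|?M. (LINT r|?M. h s r) + (LINT r|?M. h r s))"
  proof (rule integral_cong_AE)
    show "(\<lambda>s. LINT r|?M. k s r) \<in> borel_measurable ?M"
      using P.integrable_fst[OF ki'] by auto
    show "(\<lambda>s. (LINT r|?M. h s r) + (LINT r|?M. h r s)) \<in> borel_measurable ?M"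
      using P.integrable_fst[OF hi'] P.integrable_fst[OF hi_swap]
      by (intro borel_measurable_add) auto
    have "AE s in ?M. integrable ?M (\<lambda>r. h s r)" using P.AE_integrable_fst[OF hi'] by simp
    moreover have "AE s in ?M. integrable ?M (\<lambda>r. h r s)" using P.AE_integrable_fst[OF hi_swap] by simp
    ultimately show "AE s in ?M. (LINT r|?M. k s r) = (LINT r|?M. h s r) + (LINT r|?M. h r s)"
      by eventually_elim (rule hsum)
  qed
  also have "\<dots> = (LINT s|?M. (LINT r|?M. h s r)) + (LINT s|?M. (LINT r|?M. h r s))"
    using P.integrable_fst[OF hi'] P.integrable_fst[OF hi_swap] by simp
  also have "(LINT s|?M. (LINT r|?M. h r s)) = (LINT s|?M. (LINT r|?M. h s r))"
    using P.Fubini_integral[of h] hi' by simp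
  also have "(LINT s|?M. (LINT r|?M. h s r)) = (LINT s|?M. inner (A (LINT r|Leb s. g r)) (g s))"
    by (rule Bochner_Integration.integral_cong) (auto simp: inner_h)
  finally show ?eq by simp
qed

text \<open>
  With \<open>A\<close> the identity this is the energy balance of \<open>y' = g\<close>; with \<open>A\<close> the Yosida approximation of
  the operator it yields the bound on \<open>A y\<close>.
\<close>

lemma energy_identity:
  fixes g :: "real \<Rightarrow> 'h::{real_inner, banach, second_countable_topology}"
  assumes A: "bounded_linear A" and sym: "\<And>x y. inner (A x) y = inner x (A y)"
    and g: "integrable (Leb t) g" and t: "0 \<le> t"
    and y: "\<And>s. 0 \<le> s \<Longrightarrow> s \<le> t \<Longrightarrow> y s = y0 + (LINT r|Leb s. g r)"
  shows "integrable (Leb t) (\<lambda>s. inner (A (y s)) (g s))"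
    and "inner (A (y t)) (y t) = inner (A y0) y0 + 2 * (LINT s|Leb t. inner (A (y s)) (g s))"
proof -
  interpret A: bounded_linear A by (rule A)
  note tri = triangle_integral_eq_half_square[OF A sym g]
  have eq: "inner (A (y s)) (g s) = inner (A y0) (g s) + inner (A (LINT r|Leb s. g r)) (g s)"
    if "s \<in> space (Leb t)" for s
    using that by (simp add: y space_restrict_space A.add inner_add_left)
  have i1: "integrable (Leb t) (\<lambda>s. inner (A y0) (g s))" using g by simp
  show "integrable (Leb t) (\<lambda>s. inner (A (y s)) (g s))"
    using Bochner_Integration.integrable_add[OF i1 tri(1)]
    by (rule Bochner_Integration.integrable_cong[THEN iffD1, rotated -1]) (auto simp: eq)
  have "(LINT s|Leb t. inner (A (y s)) (g s)) =
      (LINT s|Leb t. inner (A y0) (g s) + inner (A (LINT r|Leb s. g r)) (g s))"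
    by (rule Bochner_Integration.integral_cong) (auto simp: eq)
  also have "\<dots> = inner (A y0) (LINT s|Leb t. g s) + (LINT s|Leb t. inner (A (LINT r|Leb s. g r)) (g s))"
    using i1 tri(1) g by simp
  finally have "2 * (LINT s|Leb t. inner (A (y s)) (g s)) =
      2 * inner (A y0) (LINT s|Leb t. g s) + inner (A (LINT s|Leb t. g s)) (LINT s|Leb t. g s)"
    using tri(2) by simp
  moreover have "inner (A (LINT s|Leb t. g s)) y0 = inner (A y0) (LINT s|Leb t. g s)"
    by (metis sym inner_commute)
  ultimately show "inner (A (y t)) (y t) = inner (A y0) y0 + 2 * (LINT s|Leb t. inner (A (y s)) (g s))"
    using t by (simp add: y[of t] A.add inner_add_left inner_add_right)
qed

section \<open>Linear differential equations with a bounded operator\<close>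

lemma integral_Leb_continuous:
  fixes g :: "real \<Rightarrow> 'b::{banach, second_countable_topology}"
  assumes g: "\<And>t. g \<in> borel_measurable (Leb t)"
    and bd: "\<And>t. \<exists>B\<ge>0. \<forall>s. 0 < s \<longrightarrow> s < t \<longrightarrow> norm (g s) \<le> B"
  shows "continuous_on UNIV (\<lambda>t. LINT s|Leb t. g s)"
proof -
  let ?I = "\<lambda>t. LINT s|Leb t. g s"
  have "isCont ?I x" for x
  proof -
    obtain B where B: "B \<ge> 0" "\<And>s. 0 < s \<Longrightarrow> s < x + 1 \<Longrightarrow> norm (g s) \<le> B" using bd by blast
    have neg: "?I t = ?I (max 0 t)" for t by (cases "t \<le> 0") (auto simp: max_def)
    have one: "norm (?I t - ?I s) \<le> B * (max 0 t - max 0 s)" if "s \<le> t" "t < x + 1" for s t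
    proof -
      have "norm (?I (max 0 t) - ?I (max 0 s)) \<le> B * (max 0 t - max 0 s)"
        by (rule integral_Leb_increment[OF g]) (use that B in auto)
      then show ?thesis by (simp flip: neg)
    qed
    have "norm (?I y - ?I x) \<le> B * \<bar>y - x\<bar>" if "y < x + 1" for y
    proof (cases "x \<le> y")
      case True
      have "norm (?I y - ?I x) \<le> B * (max 0 y - max 0 x)" using one[of x y] True that by auto
      also have "\<dots> \<le> B * \<bar>y - x\<bar>" using B True by (intro mult_left_mono) auto
      finally show ?thesis .
    next
      case False
      have "norm (?I y - ?I x) \<le> B * (max 0 x - max 0 y)" using one[of y x] False by (auto simp: norm_minus_commute)
      also have "\<dots> \<le> B * \<bar>y - x\<bar>" using B False by (intro mult_left_mono) auto
      finally show ?thesis .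
    qed
    moreover have "eventually (\<lambda>y. y < x + 1) (at x)"
      by (rule order_tendstoD(2)[OF tendsto_ident_at]) simp
    ultimately have ev: "eventually (\<lambda>y. norm (?I y - ?I x) \<le> B * \<bar>y - x\<bar>) (at x)"
      by (auto elim: eventually_mono)
    have "((\<lambda>y. B * \<bar>y - x\<bar>) \<longlongrightarrow> B * \<bar>x - x\<bar>) (at x)" by (intro tendsto_intros)
    then have "((\<lambda>y. ?I y - ?I x) \<longlongrightarrow> 0) (at x)"
      by (intro Lim_null_comparison[OF ev]) simp
    then show ?thesis by (simp add: isCont_def LIM_zero_iff)
  qed
  then show ?thesis by (simp add: continuous_at_imp_continuous_on)
qed

text \<open>
  This bounds the contraction constant of the Picard operator in the weighted supremum norm.
\<close>

lemma integral_Leb_exp_le: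
  assumes c: "0 < c" and t: "0 \<le> t"
  shows "(LINT s|Leb t. exp (c * s)) \<le> exp (c * t) / c"
proof -
  have "(LINT s|lborel. exp (c * s) * indicator {0..t} s) = exp (c * t) / c - exp (c * 0) / c"
    using c t by (intro integral_FTC_Icc_real) (auto intro!: derivative_eq_intros)
  then have le: "(LINT s|lborel. exp (c * s) * indicator {0..t} s) \<le> exp (c * t) / c"
    using c by simp
  have "(LINT s|Leb t. exp (c * s)) = (LINT s|lebesgue. indicator {0<..<t} s *\<^sub>R exp (c * s))"
    by (rule integral_restrict_space) simp
  also have "\<dots> = (LINT s|lborel. indicator {0<..<t} s *\<^sub>R exp (c * s))"
    by (rule integral_completion) measurable
  also have "\<dots> = (LINT s|lborel. exp (c * s) * indicator {0..t} s)"
  proof (rule integral_cong_AE)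
    show "AE s in lborel. indicator {0<..<t} s *\<^sub>R exp (c * s) = exp (c * s) * indicator {0..t} s"
      using AE_lborel_singleton[of 0] AE_lborel_singleton[of t]
      by eventually_elim (auto simp: indicator_def)
  qed measurable
  finally show ?thesis using le by simp
qed

text \<open>
  Picard iteration, global in time: for \<open>w t = exp (- c * t) * y t\<close> with \<open>c\<close> twice a bound \<open>K\<close> of \<open>A\<close>,
  the integral equation becomes a fixed point equation for a contraction with constant \<open>1/2\<close> on the
  bounded continuous functions on the whole line, where functions are continued as constants to
  negative times.
\<close>

lemma linear_ode_solution_exists:
  fixes f :: "real \<Rightarrow> 'h::{banach, second_countable_topology}"
  assumes A: "bounded_linear A" and f: "f \<in> borel_measurable lebesgue" and fM: "\<And>s. norm (f s) \<le> M"
  obtains y where "continuous_on UNIV y"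
    and "\<And>t. 0 \<le> t \<Longrightarrow> y t = y0 + (LINT s|Leb t. f s - A (y s))"
proof -
  interpret A: bounded_linear A by (rule A)
  obtain K where K: "K > 0" "\<And>x. norm (A x) \<le> norm x * K" using A.pos_bounded by blast
  have M0: "0 \<le> M" using fM[of 0] norm_ge_zero order_trans by blast
  \<comment> \<open>With this rate the Picard operator contracts by the factor \<open>K / c = 1/2\<close>.\<close>
  define c where "c = 2 * K"
  have c: "c > 0" using K by (simp add: c_def)
  have f_int: "integrable (Leb t) f" for t
    by (rule integrable_Leb_bounded[OF measurable_Leb_lebesgue[OF f]]) (rule fM)
  define F where "F t = (LINT s|Leb t. f s)" for t
  have F_cont: "continuous_on UNIV F" unfolding F_def
    by (rule integral_Leb_continuous[OF measurable_Leb_lebesgue[OF f]]) (use fM M0 in blast)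
  have F_bd: "norm (F t) \<le> M * max 0 t" for t
  proof (cases "0 \<le> t")
    case True then show ?thesis unfolding F_def using norm_integral_Leb_le[of t f M] fM M0 by simp
  qed (simp add: F_def)
  define G where "G w t = (LINT s|Leb t. exp (c * s) *\<^sub>R A (apply_bcontfun w s))" for w :: "real \<Rightarrow>\<^sub>C 'h" and t
  have Aw_cont: "continuous_on UNIV (\<lambda>s. exp (c * s) *\<^sub>R A (apply_bcontfun w s))" for w :: "real \<Rightarrow>\<^sub>C 'h"
    by (intro continuous_intros A.continuous_on) auto
  have Aw_bd: "norm (exp (c * s) *\<^sub>R A x) \<le> exp (c * s) * (K * b)" if "norm x \<le> b" for s x and b :: real
  proof -
    have "norm (A x) \<le> b * K" using K that by (intro order_trans[OF K(2)] mult_right_mono) auto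
    then show ?thesis by (simp add: mult.commute)
  qed
  have exp_int: "integrable (Leb t) (\<lambda>s. exp (c * s) * b)" for t b
    by (rule integrable_Leb_bounded[where B = "exp (c * t) * \<bar>b\<bar>"])
       (use c in \<open>auto intro!: measurable_Leb_continuous[of UNIV] continuous_intros mult_right_mono simp: abs_mult\<close>)
  have int_bd: "norm (LINT s|Leb t. exp (c * s) *\<^sub>R A (h s)) \<le> exp (c * max 0 t) * (K * b / c)"
    if h: "continuous_on UNIV h" "\<And>s. norm (h s) \<le> b" for h :: "real \<Rightarrow> 'h" and b t
  proof (cases "0 \<le> t")
    case True
    have b0: "0 \<le> b" using h(2)[of 0] norm_ge_zero order_trans by blast
    have m: "(\<lambda>s. exp (c * s) *\<^sub>R A (h s)) \<in> borel_measurable (Leb t)"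
      by (intro measurable_Leb_continuous[of UNIV] continuous_intros A.continuous_on h) auto
    have i: "integrable (Leb t) (\<lambda>s. exp (c * s) *\<^sub>R A (h s))"
      by (rule Bochner_Integration.integrable_bound[OF exp_int[of t "K * b"] m])
         (use Aw_bd[OF h(2)] b0 K in \<open>auto intro!: AE_I2 simp: abs_mult\<close>)
    have "norm (LINT s|Leb t. exp (c * s) *\<^sub>R A (h s)) \<le> (LINT s|Leb t. norm (exp (c * s) *\<^sub>R A (h s)))"
      by (rule integral_norm_bound)
    also have "\<dots> \<le> (LINT s|Leb t. exp (c * s) * (K * b))"
      using i exp_int Aw_bd[OF h(2)] by (intro integral_mono integrable_norm) auto
    also have "\<dots> = (LINT s|Leb t. exp (c * s)) * (K * b)" by simp
    also have "\<dots> \<le> (exp (c * t) / c) * (K * b)"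
      using integral_Leb_exp_le[OF c True] K b0 by (intro mult_right_mono) auto
    finally show ?thesis using True by (simp add: max_def)
  next
    case False
    have "0 \<le> b" using h(2)[of 0] norm_ge_zero order_trans by blast
    then show ?thesis using False K c by simp
  qed
  have G_cont: "continuous_on UNIV (G w)" for w
    unfolding G_def
  proof (rule integral_Leb_continuous)
    show "(\<lambda>s. exp (c * s) *\<^sub>R A (apply_bcontfun w s)) \<in> borel_measurable (Leb t)" for t
      by (rule measurable_Leb_continuous[OF Aw_cont]) simp
    fix t
    have "compact ((\<lambda>s. exp (c * s) *\<^sub>R A (apply_bcontfun w s)) ` {0..t})"
      by (intro compact_continuous_image continuous_on_subset[OF Aw_cont]) auto
    then obtain B where B: "\<And>s. s \<in> {0..t} \<Longrightarrow> norm (exp (c * s) *\<^sub>R A (apply_bcontfun w s)) \<le> B"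
      using compact_imp_bounded bounded_iff by (metis (no_types, lifting) imageI)
    show "\<exists>B\<ge>0. \<forall>s. 0 < s \<longrightarrow> s < t \<longrightarrow> norm (exp (c * s) *\<^sub>R A (apply_bcontfun w s)) \<le> B"
      by (rule exI[of _ "max 0 B"]) (use B in \<open>force simp: le_max_iff_disj\<close>)
  qed
  \<comment> \<open>The Picard operator for \<open>exp (- c * t) * y t\<close>; the continuation to negative times is the constant \<open>y0\<close>.\<close>
  define \<Phi> where "\<Phi> w t = exp (- c * max 0 t) *\<^sub>R (y0 + F t - G w t)" for w t
  have \<Phi>_bc: "\<Phi> w \<in> bcontfun" for w
  proof (rule bcontfun_normI)
    show "continuous_on UNIV (\<Phi> w)" unfolding \<Phi>_def by (intro continuous_intros F_cont G_cont)
    fix t :: real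
    let ?m = "max 0 t"
    have e1: "exp (- c * ?m) * ?m \<le> 1 / c"
    proof -
      have "c * ?m \<le> exp (c * ?m)" using exp_ge_add_one_self[of "c * ?m"] by linarith
      then have "exp (- (c * ?m)) * (c * ?m) \<le> exp (- (c * ?m)) * exp (c * ?m)"
        by (intro mult_left_mono) auto
      then show ?thesis using c by (simp add: field_simps flip: exp_add)
    qed
    have "norm (\<Phi> w t) \<le> exp (- c * ?m) * (norm y0 + M * ?m + exp (c * ?m) * (K * norm w / c))"
      unfolding \<Phi>_def norm_scaleR abs_exp_cancel
      using F_bd[of t] int_bd[of "apply_bcontfun w" "norm w" t]
      by (intro mult_left_mono order_trans[OF norm_triangle_ineq4] add_mono order_trans[OF norm_triangle_ineq])
         (auto simp: G_def norm_bounded)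
    also have "\<dots> = exp (- c * ?m) * norm y0 + M * (exp (- c * ?m) * ?m) + K * norm w / c"
      by (simp add: algebra_simps flip: exp_add)
    also have "\<dots> \<le> 1 * norm y0 + M * (1 / c) + K * norm w / c"
      using c M0 e1 by (intro add_mono mult_right_mono mult_left_mono) auto
    finally show "norm (\<Phi> w t) \<le> 1 * norm y0 + M * (1 / c) + K * norm w / c" .
  qed
  define P where "P w = Bcontfun (\<Phi> w)" for w
  have P: "apply_bcontfun (P w) t = \<Phi> w t" for w t
    unfolding P_def by (simp add: Bcontfun_inverse \<Phi>_bc)
  have "dist (P v) (P w) \<le> (1/2) * dist v w" for v w
  proof (rule dist_bound)
    fix t :: real
    let ?m = "max 0 t"
    have iv: "integrable (Leb t) (\<lambda>s. exp (c * s) *\<^sub>R A (apply_bcontfun u s))" for u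
      by (rule Bochner_Integration.integrable_bound[OF exp_int[of t "K * norm u"]
            measurable_Leb_continuous[OF Aw_cont]])
         (use Aw_bd[of _ "norm u"] K in \<open>auto intro!: AE_I2 simp: abs_mult norm_bounded\<close>)
    have "G w t - G v t = (LINT s|Leb t. exp (c * s) *\<^sub>R A (apply_bcontfun w s - apply_bcontfun v s))"
      unfolding G_def using iv by (simp add: A.diff scaleR_diff_right)
    also have "norm \<dots> \<le> exp (c * ?m) * (K * dist v w / c)"
      by (rule int_bd) (auto intro!: continuous_intros simp: dist_bounded dist_commute[of v w] simp flip: dist_norm)
    finally have G: "norm (G w t - G v t) \<le> exp (c * ?m) * (K * dist v w / c)" .
    have "dist (P v t) (P w t) = exp (- c * ?m) * norm (G w t - G v t)"
      by (simp add: P dist_norm \<Phi>_def flip: scaleR_diff_right)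
    also have "\<dots> \<le> exp (- c * ?m) * (exp (c * ?m) * (K * dist v w / c))"
      by (intro mult_left_mono G) auto
    also have "\<dots> = (1/2) * dist v w"
      using K by (simp add: c_def flip: exp_add mult.assoc)
    finally show "dist (P v t) (P w t) \<le> (1/2) * dist v w" .
  qed
  then obtain w where w: "P w = w"
    using banach_fix_type[of "1/2" P] by auto
  define y where "y t = exp (c * max 0 t) *\<^sub>R apply_bcontfun w t" for t
  show ?thesis
  proof (rule that[of y])
    show "continuous_on UNIV y" unfolding y_def by (intro continuous_intros) auto
    fix t :: real assume t: "0 \<le> t"
    have i: "integrable (Leb t) (\<lambda>s. A (y s))"
    proof (rule Bochner_Integration.integrable_bound[OF exp_int[of t "K * norm w"]])
      show "(\<lambda>s. A (y s)) \<in> borel_measurable (Leb t)"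
        unfolding y_def by (intro measurable_Leb_continuous[of UNIV] A.continuous_on continuous_intros) auto
      show "AE s in Leb t. norm (A (y s)) \<le> norm (exp (c * s) * (K * norm w))"
        using Aw_bd[of _ "norm w"] K
        by (auto intro!: AE_I2 simp: y_def abs_mult norm_bounded space_restrict_space A.scaleR)
    qed
    have "y t = exp (c * t) *\<^sub>R \<Phi> w t" using t P[of w t] by (simp add: y_def w)
    also have "\<dots> = y0 + F t - G w t" using t by (simp add: \<Phi>_def flip: exp_add)
    also have "G w t = (LINT s|Leb t. A (y s))"
      unfolding G_def y_def by (rule Bochner_Integration.integral_cong) (auto simp: space_restrict_space A.scaleR)
    finally show "y t = y0 + (LINT s|Leb t. f s - A (y s))"
      using i f_int by (simp add: F_def)
  qed
qed

section \<open>Closed forms, resolvents and Yosida approximations\<close>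

text \<open>
  The abstract setting: the form \<open>\<langle>D u, D v\<rangle>\<close> on the subspace \<open>V\<close> of a Hilbert space is closed, which
  is expressed by \<open>D\<close> having a closed graph. For the heat equation \<open>V\<close> is \<open>H\<^sup>1\<^sub>0(\<Omega>)\<close> and \<open>D\<close> the
  gradient. Since \<open>V\<close> is dense in \<open>L\<^sup>2(\<Omega>)\<close> but not in the ambient space, initial values are taken in
  the closure of \<open>V\<close>.
\<close>

locale closed_form =
  fixes V :: "'h::{real_inner, banach, second_countable_topology} set"
    and D :: "'h \<Rightarrow> 'g::{real_inner, banach, second_countable_topology}"
  assumes subspace_V: "subspace V"
    and D_add: "\<And>x y. x \<in> V \<Longrightarrow> y \<in> V \<Longrightarrow> D (x + y) = D x + D y"
    and D_scaleR: "\<And>c x. x \<in> V \<Longrightarrow> D (c *\<^sub>R x) = c *\<^sub>R D x"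
    and closed_graph: "\<And>x z g. (\<And>n. x n \<in> V) \<Longrightarrow> x \<longlonglongrightarrow> z \<Longrightarrow> (\<lambda>n. D (x n)) \<longlonglongrightarrow> g \<Longrightarrow> z \<in> V \<and> D z = g"
begin

lemma V_add: "x \<in> V \<Longrightarrow> y \<in> V \<Longrightarrow> x + y \<in> V" using subspace_V by (rule subspace_add)
lemma V_scaleR: "x \<in> V \<Longrightarrow> c *\<^sub>R x \<in> V" using subspace_V by (rule subspace_scale)
lemma V_zero: "0 \<in> V" using subspace_V by (rule subspace_0)
lemma V_diff: "x \<in> V \<Longrightarrow> y \<in> V \<Longrightarrow> x - y \<in> V" using subspace_V by (rule subspace_diff)

lemma D_zero: "D 0 = 0"
  using D_scaleR[OF V_zero, of 0] by simp

lemma D_diff: "x \<in> V \<Longrightarrow> y \<in> V \<Longrightarrow> D (x - y) = D x - D y"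
  using D_add[of x "- 1 *\<^sub>R y"] D_scaleR[of y "-1"] V_scaleR[of y "-1"] by simp

text \<open>
  The weak solution \<open>z\<close> of \<open>z + l D\<^sup>*D z = f\<close>. The map \<open>z \<mapsto> (z, sqrt l * D z)\<close> has closed range in the
  product space, and the equation says exactly that \<open>(f, 0) - (z, sqrt l * D z)\<close> is orthogonal to this
  range; so \<open>z\<close> is the first component of an orthogonal projection.
\<close>

lemma resolvent_exists:
  assumes l: "0 < l"
  shows "\<exists>z\<in>V. \<forall>\<phi>\<in>V. inner z \<phi> + l * inner (D z) (D \<phi>) = inner f \<phi>"
proof -
  define S where "S = (\<lambda>z. (z, sqrt l *\<^sub>R D z)) ` V"
  have sub: "subspace S"
    unfolding subspace_def
  proof (intro conjI ballI allI)
    show "0 \<in> S" unfolding S_def by (rule image_eqI[of _ _ 0]) (auto simp: D_zero V_zero zero_prod_def)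
    fix p q assume "p \<in> S" "q \<in> S"
    then obtain x y where xy: "x \<in> V" "y \<in> V" "p = (x, sqrt l *\<^sub>R D x)" "q = (y, sqrt l *\<^sub>R D y)"
      by (auto simp: S_def)
    then show "p + q \<in> S" unfolding S_def
      by (intro image_eqI[of _ _ "x + y"]) (auto simp: D_add V_add scaleR_add_right)
  next
    fix c p assume "p \<in> S"
    then obtain x where x: "x \<in> V" "p = (x, sqrt l *\<^sub>R D x)" by (auto simp: S_def)
    then show "c *\<^sub>R p \<in> S" unfolding S_def
      by (intro image_eqI[of _ _ "c *\<^sub>R x"]) (auto simp: D_scaleR V_scaleR)
  qed
  have cl: "closed S"
    unfolding closed_sequential_limits
  proof safe
    fix P z g assume P: "\<forall>n. P n \<in> S" and lim: "P \<longlonglongrightarrow> (z, g)"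
    obtain x where x: "\<And>n. x n \<in> V" "\<And>n. P n = (x n, sqrt l *\<^sub>R D (x n))"
      using P unfolding S_def image_iff by metis
    have "x \<longlonglongrightarrow> z" using tendsto_fst[OF lim] by (simp add: x)
    moreover have "(\<lambda>n. D (x n)) \<longlonglongrightarrow> (1 / sqrt l) *\<^sub>R g"
      using tendsto_scaleR[OF tendsto_const[of "1 / sqrt l"] tendsto_snd[OF lim]] l by (simp add: x)
    ultimately have "z \<in> V \<and> D z = (1 / sqrt l) *\<^sub>R g" by (rule closed_graph[OF x(1)])
    then show "(z, g) \<in> S" unfolding S_def using l by (intro image_eqI[of _ _ z]) auto
  qed
  obtain p where p: "p \<in> S" "\<And>w. w \<in> S \<Longrightarrow> inner ((f, 0) - p) w = 0"
    using orthogonal_projection_exists[OF sub cl] by metis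
  then obtain z where z: "z \<in> V" "p = (z, sqrt l *\<^sub>R D z)" by (auto simp: S_def)
  have "inner z \<phi> + l * inner (D z) (D \<phi>) = inner f \<phi>" if "\<phi> \<in> V" for \<phi>
    using p(2)[of "(\<phi>, sqrt l *\<^sub>R D \<phi>)"] that l
    by (simp add: S_def z inner_diff_left flip: mult.assoc)
  then show ?thesis using z by blast
qed

definition resolvent :: "real \<Rightarrow> 'h \<Rightarrow> 'h" where
  "resolvent l f = (SOME z. z \<in> V \<and> (\<forall>\<phi>\<in>V. inner z \<phi> + l * inner (D z) (D \<phi>) = inner f \<phi>))"

text \<open>
  The Yosida approximation of \<open>D\<^sup>*D\<close>, that is, \<open>D\<^sup>*D\<close> applied to \<open>resolvent l f\<close>: a bounded symmetric
  operator.
\<close>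

definition yosida :: "real \<Rightarrow> 'h \<Rightarrow> 'h" where
  "yosida l f = (1 / l) *\<^sub>R (f - resolvent l f)"

context
  fixes l :: real
  assumes l: "0 < l"
begin

lemma resolvent_in_V: "resolvent l f \<in> V"
  and resolvent_eq: "\<phi> \<in> V \<Longrightarrow> inner (resolvent l f) \<phi> + l * inner (D (resolvent l f)) (D \<phi>) = inner f \<phi>"
proof -
  have "resolvent l f \<in> V \<and> (\<forall>\<phi>\<in>V. inner (resolvent l f) \<phi> + l * inner (D (resolvent l f)) (D \<phi>) = inner f \<phi>)"
    unfolding resolvent_def by (rule someI_ex) (use resolvent_exists[OF l] in blast)
  then show "resolvent l f \<in> V"
    "\<phi> \<in> V \<Longrightarrow> inner (resolvent l f) \<phi> + l * inner (D (resolvent l f)) (D \<phi>) = inner f \<phi>" by auto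
qed

lemma resolvent_unique:
  assumes z: "z \<in> V" and eq: "\<And>\<phi>. \<phi> \<in> V \<Longrightarrow> inner z \<phi> + l * inner (D z) (D \<phi>) = inner f \<phi>"
  shows "resolvent l f = z"
proof -
  let ?d = "resolvent l f - z"
  have d: "?d \<in> V" using z resolvent_in_V V_diff by blast
  have "inner ?d ?d + l * inner (D ?d) (D ?d) = 0"
    using resolvent_eq[OF d, of f] eq[OF d] z resolvent_in_V
    by (simp add: D_diff inner_diff_left algebra_simps)
  moreover have "0 \<le> l * inner (D ?d) (D ?d)" using l by simp
  moreover have "0 \<le> inner ?d ?d" by simp
  ultimately have "inner ?d ?d = 0" by linarith
  then show ?thesis by simp
qed

lemma resolvent_add: "resolvent l (x + y) = resolvent l x + resolvent l y"
proof (rule resolvent_unique)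
  fix \<phi> assume p: "\<phi> \<in> V"
  show "inner (resolvent l x + resolvent l y) \<phi> + l * inner (D (resolvent l x + resolvent l y)) (D \<phi>) = inner (x + y) \<phi>"
    using resolvent_eq[OF p, of x] resolvent_eq[OF p, of y] resolvent_in_V
    by (simp add: D_add inner_add_left algebra_simps)
qed (use resolvent_in_V V_add in blast)

lemma resolvent_scaleR: "resolvent l (c *\<^sub>R x) = c *\<^sub>R resolvent l x"
proof (rule resolvent_unique)
  fix \<phi> assume p: "\<phi> \<in> V"
  have "c * (inner (resolvent l x) \<phi> + l * inner (D (resolvent l x)) (D \<phi>)) = c * inner x \<phi>"
    using resolvent_eq[OF p, of x] by simp
  then show "inner (c *\<^sub>R resolvent l x) \<phi> + l * inner (D (c *\<^sub>R resolvent l x)) (D \<phi>) = inner (c *\<^sub>R x) \<phi>"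
    using resolvent_in_V by (simp add: D_scaleR algebra_simps)
qed (use resolvent_in_V V_scaleR in blast)

lemma resolvent_energy: "(norm (resolvent l f))\<^sup>2 + l * (norm (D (resolvent l f)))\<^sup>2 = inner f (resolvent l f)"
  using resolvent_eq[OF resolvent_in_V, of f f] by (simp add: power2_norm_eq_inner)

lemma norm_resolvent_le: "norm (resolvent l f) \<le> norm f"
proof (cases "resolvent l f = 0")
  case False
  have "0 \<le> l * (norm (D (resolvent l f)))\<^sup>2" using l by simp
  then have "(norm (resolvent l f))\<^sup>2 \<le> norm f * norm (resolvent l f)"
    using resolvent_energy[of f] norm_cauchy_schwarz[of f "resolvent l f"] by linarith
  then show ?thesis using False by (simp add: power2_eq_square)
qed simp

lemma norm_D_resolvent_le: "norm (D (resolvent l f)) \<le> norm f * (1 / sqrt l)"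
proof -
  have "l * (norm (D (resolvent l f)))\<^sup>2 \<le> inner f (resolvent l f)"
    using resolvent_energy[of f] zero_le_power2[of "norm (resolvent l f)"] by linarith
  also have "\<dots> \<le> norm f * norm (resolvent l f)" by (rule norm_cauchy_schwarz)
  also have "\<dots> \<le> norm f * norm f" by (intro mult_left_mono norm_resolvent_le) simp
  finally have "(sqrt l * norm (D (resolvent l f)))\<^sup>2 \<le> (norm f)\<^sup>2"
    using l by (simp add: power_mult_distrib flip: power2_eq_square)
  then have "sqrt l * norm (D (resolvent l f)) \<le> norm f" by (rule power2_le_imp_le) simp
  then show ?thesis using l by (simp add: field_simps)
qed

lemma bounded_linear_resolvent: "bounded_linear (resolvent l)"
  by (rule bounded_linear_intro[of _ 1]) (auto simp: resolvent_add resolvent_scaleR norm_resolvent_le)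

lemma bounded_linear_D_resolvent: "bounded_linear (\<lambda>x. D (resolvent l x))"
  by (rule bounded_linear_intro[of _ "1 / sqrt l"])
     (auto simp: resolvent_add resolvent_scaleR D_add D_scaleR resolvent_in_V norm_D_resolvent_le[simplified])

lemma resolvent_symmetric: "inner (resolvent l x) y = inner x (resolvent l y)"
  using resolvent_eq[OF resolvent_in_V, of x y] resolvent_eq[OF resolvent_in_V, of y x]
  by (simp add: inner_commute)

lemma bounded_linear_yosida: "bounded_linear (yosida l)"
proof -
  have "bounded_linear (\<lambda>f. (1 / l) *\<^sub>R (f - resolvent l f))"
    by (intro bounded_linear_scaleR_right[THEN bounded_linear_compose] bounded_linear_sub
        bounded_linear_ident bounded_linear_resolvent)
  then show ?thesis by (simp add: yosida_def[abs_def])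
qed

lemma yosida_symmetric: "inner (yosida l x) y = inner x (yosida l y)"
  by (simp add: yosida_def inner_diff_left inner_diff_right resolvent_symmetric)

lemma resolvent_plus_yosida: "f = resolvent l f + l *\<^sub>R yosida l f"
  using l by (simp add: yosida_def)

lemma inner_yosida: "\<phi> \<in> V \<Longrightarrow> inner (yosida l f) \<phi> = inner (D (resolvent l f)) (D \<phi>)"
  using resolvent_eq[of \<phi> f] l by (simp add: yosida_def inner_diff_left field_simps)

lemma inner_yosida_self: "inner (yosida l f) f = (norm (D (resolvent l f)))\<^sup>2 + l * (norm (yosida l f))\<^sup>2"
proof -
  have "inner (yosida l f) f = inner (yosida l f) (resolvent l f + l *\<^sub>R yosida l f)"
    using resolvent_plus_yosida[of f] by simp
  then show ?thesis
    by (simp add: inner_add_right inner_yosida resolvent_in_V power2_norm_eq_inner)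
qed

text \<open>
  Initial values in \<open>V\<close> have approximate energies bounded independently of \<open>l\<close>; this is the reason
  for treating them first.
\<close>

lemma inner_yosida_le:
  assumes y: "y \<in> V"
  shows "inner (yosida l y) y \<le> (norm (D y))\<^sup>2"
proof -
  let ?d = "norm (D (resolvent l y))"
  have "?d\<^sup>2 \<le> inner (yosida l y) y" using inner_yosida_self[of y] l by simp
  also have eq: "inner (yosida l y) y = inner (D (resolvent l y)) (D y)" by (rule inner_yosida[OF y])
  also have "\<dots> \<le> ?d * norm (D y)" by (rule norm_cauchy_schwarz)
  finally have "?d \<le> norm (D y)"
    by (metis norm_ge_zero mult_le_cancel_left_pos order_le_less power2_eq_square)
  then have "?d * norm (D y) \<le> (norm (D y))\<^sup>2" by (simp add: power2_eq_square mult_right_mono)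
  then show ?thesis unfolding eq using norm_cauchy_schwarz order_trans by blast
qed

end

text \<open>
  The regularized evolution \<open>y' = f - A\<^sub>l y\<close> with a bounded operator \<open>A\<^sub>l\<close>, in integrated form because
  \<open>f\<close> is only measurable.
\<close>

definition yosida_sol :: "real \<Rightarrow> 'h \<Rightarrow> (real \<Rightarrow> 'h) \<Rightarrow> (real \<Rightarrow> 'h) \<Rightarrow> bool" where
  "yosida_sol l y0 f y \<longleftrightarrow> continuous_on UNIV y \<and>
     (\<forall>t\<ge>0. y t = y0 + (LINT s|Leb t. f s - yosida l (y s)))"

context
  fixes f :: "real \<Rightarrow> 'h" and M :: real
  assumes f: "f \<in> borel_measurable lebesgue" and fM: "\<And>s. norm (f s) \<le> M"
begin

lemma yosida_sol_exists: "0 < l \<Longrightarrow> \<exists>y. yosida_sol l y0 f y"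
  unfolding yosida_sol_def
  using linear_ode_solution_exists[OF bounded_linear_yosida f fM] by metis

context
  fixes l :: real and y0 :: 'h and y :: "real \<Rightarrow> 'h"
  assumes l: "0 < l" and y: "yosida_sol l y0 f y"
begin

lemma yosida_sol_continuous: "continuous_on UNIV y" using y by (simp add: yosida_sol_def)

lemma yosida_sol_yosida_continuous: "continuous_on UNIV (\<lambda>s. yosida l (y s))"
  by (intro bounded_linear.continuous_on[OF bounded_linear_yosida[OF l]] yosida_sol_continuous)

lemma yosida_sol_D_continuous: "continuous_on UNIV (\<lambda>s. D (resolvent l (y s)))"
  by (intro bounded_linear.continuous_on[OF bounded_linear_D_resolvent[OF l]] yosida_sol_continuous)

lemma yosida_sol_rhs_integrable: "integrable (Leb t) (\<lambda>s. f s - yosida l (y s))"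
  using integrable_Leb_bounded_lebesgue[OF f fM] integrable_Leb_continuous[OF yosida_sol_yosida_continuous] by simp

lemma yosida_sol_eq: "0 \<le> t \<Longrightarrow> y t = y0 + (LINT s|Leb t. f s - yosida l (y s))"
  using y by (simp add: yosida_sol_def)

lemma yosida_sol_zero: "y 0 = y0"
  using yosida_sol_eq[of 0] by simp

lemma yosida_sol_weak:
  assumes t: "0 \<le> t" and p: "\<phi> \<in> V"
  shows "inner (y t) \<phi> = inner y0 \<phi> + (LINT s|Leb t. inner (f s) \<phi> - inner (D (resolvent l (y s))) (D \<phi>))"
proof -
  have "inner (y t) \<phi> = inner y0 \<phi> + (LINT s|Leb t. inner (f s - yosida l (y s)) \<phi>)"
    using yosida_sol_rhs_integrable[of t] by (simp add: yosida_sol_eq[OF t] inner_add_left)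
  then show ?thesis using p by (simp add: inner_diff_left inner_yosida[OF l])
qed

text \<open>
  Test the equation with \<open>2 A\<^sub>l y\<close> and absorb half of \<open>\<bar>A\<^sub>l y\<bar>\<^sup>2\<close> by Young's inequality. The bound does
  not depend on \<open>l\<close>.
\<close>

lemma yosida_sol_bound:
  assumes t: "0 \<le> t" and y0: "y0 \<in> V"
  shows "(LINT s|Leb t. (norm (yosida l (y s)))\<^sup>2) \<le> (norm (D y0))\<^sup>2 + M\<^sup>2 * t"
proof -
  note en = energy_identity[OF bounded_linear_yosida[OF l] yosida_symmetric[OF l] yosida_sol_rhs_integrable t, of y y0, OF yosida_sol_eq]
  have i2: "integrable (Leb t) (\<lambda>s. M\<^sup>2 - (norm (yosida l (y s)))\<^sup>2)"
    by (intro integrable_Leb_continuous continuous_intros yosida_sol_yosida_continuous)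
  have i3: "integrable (Leb t) (\<lambda>s. (norm (yosida l (y s)))\<^sup>2)"
    by (intro integrable_Leb_continuous continuous_intros yosida_sol_yosida_continuous)
  have ptw: "2 * inner (yosida l (y s)) (f s - yosida l (y s)) \<le> M\<^sup>2 - (norm (yosida l (y s)))\<^sup>2" for s
  proof -
    let ?p = "yosida l (y s)"
    have "0 \<le> (norm (f s - ?p))\<^sup>2" by simp
    then have "2 * inner ?p (f s) \<le> (norm (f s))\<^sup>2 + (norm ?p)\<^sup>2"
      by (simp add: power2_norm_eq_inner inner_diff_left inner_diff_right inner_commute)
    also have "(norm (f s))\<^sup>2 \<le> M\<^sup>2" using fM by (intro power_mono) auto
    finally show ?thesis by (simp add: inner_diff_right power2_norm_eq_inner)
  qed
  have "0 \<le> inner (yosida l (y t)) (y t)" using inner_yosida_self[OF l, of "y t"] l by simp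
  also have "\<dots> = inner (yosida l y0) y0 + (LINT s|Leb t. 2 * inner (yosida l (y s)) (f s - yosida l (y s)))"
    using en(2) by simp
  also have "\<dots> \<le> (norm (D y0))\<^sup>2 + (LINT s|Leb t. M\<^sup>2 - (norm (yosida l (y s)))\<^sup>2)"
    using en(1) i2 ptw by (intro add_mono inner_yosida_le[OF l y0] integral_mono) auto
  also have "(LINT s|Leb t. M\<^sup>2 - (norm (yosida l (y s)))\<^sup>2) = M\<^sup>2 * t - (LINT s|Leb t. (norm (yosida l (y s)))\<^sup>2)"
  proof -
    have "integrable (Leb t) (\<lambda>s. M\<^sup>2)" by (intro integrable_Leb_continuous continuous_intros)
    then show ?thesis using i3 t by (simp add: measure_Leb space_restrict_space)
  qed
  finally show ?thesis by simp
qed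

lemma yosida_sol_energy:
  assumes t: "0 \<le> t"
  shows "(norm (y t))\<^sup>2 + 2 * (LINT s|Leb t. (norm (D (resolvent l (y s))))\<^sup>2)
    \<le> (norm y0)\<^sup>2 + 2 * (LINT s|Leb t. inner (y s) (f s))"
proof -
  note en = energy_identity[OF bounded_linear_ident refl yosida_sol_rhs_integrable t, of y y0, OF yosida_sol_eq]
  have i1: "integrable (Leb t) (\<lambda>s. inner (y s) (f s))"
  proof -
    have "integrable (Leb t) (\<lambda>s. inner (y s) (f s - yosida l (y s)) + inner (y s) (yosida l (y s)))"
      by (intro Bochner_Integration.integrable_add en(1) integrable_Leb_continuous continuous_intros yosida_sol_yosida_continuous yosida_sol_continuous)
    then show ?thesis by (simp add: inner_diff_right)
  qed
  have i2: "integrable (Leb t) (\<lambda>s. (norm (D (resolvent l (y s))))\<^sup>2)"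
    by (intro integrable_Leb_continuous continuous_intros yosida_sol_D_continuous)
  have "(norm (y t))\<^sup>2 = (norm y0)\<^sup>2 + 2 * (LINT s|Leb t. inner (y s) (f s - yosida l (y s)))"
    using en(2) by (simp add: power2_norm_eq_inner)
  also have "(LINT s|Leb t. inner (y s) (f s - yosida l (y s))) \<le>
      (LINT s|Leb t. inner (y s) (f s) - (norm (D (resolvent l (y s))))\<^sup>2)"
    using en(1) i1 i2 l
    by (intro integral_mono) (auto simp: inner_diff_right inner_commute[of "y _" "yosida l (y _)"] inner_yosida_self[OF l])
  finally show ?thesis using i1 i2 by simp
qed

end

text \<open>
  The source cancels in the difference of two approximations. With \<open>p\<close>, \<open>q\<close> the Yosida terms and
  \<open>J\<^sub>l y = y - l p\<close>, \<open>J\<^sub>m z = z - m q\<close> the resolvents, \<open>\<langle>y - z, p - q\<rangle>\<close> is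
  \<open>\<bar>D J\<^sub>l y - D J\<^sub>m z\<bar>\<^sup>2 + \<langle>l p - m q, p - q\<rangle>\<close>, and the last term is \<open>O(l)\<close> in the mean by the
  previous bound.
\<close>

lemma yosida_sol_difference:
  assumes l: "0 < l" and m: "0 < m" "m \<le> l" and y0: "y0 \<in> V"
    and y: "yosida_sol l y0 f y" and z: "yosida_sol m y0 f z" and t: "0 \<le> t"
  shows "(norm (y t - z t))\<^sup>2 + 2 * (LINT s|Leb t. (norm (D (resolvent l (y s)) - D (resolvent m (z s))))\<^sup>2)
    \<le> 8 * l * ((norm (D y0))\<^sup>2 + M\<^sup>2 * t)"
proof -
  let ?p = "\<lambda>s. yosida l (y s)" and ?q = "\<lambda>s. yosida m (z s)"
  let ?d = "\<lambda>s. D (resolvent l (y s)) - D (resolvent m (z s))"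
  note Yy = yosida_sol_yosida_continuous[OF l y] and Yz = yosida_sol_yosida_continuous[OF m(1) z]
  have gi: "integrable (Leb t) (\<lambda>s. ?q s - ?p s)"
    by (intro integrable_Leb_continuous continuous_intros Yy Yz)
  have w: "y s - z s = 0 + (LINT r|Leb s. ?q r - ?p r)" if "0 \<le> s" "s \<le> t" for s
  proof -
    have "y s - z s = (LINT r|Leb s. f r - ?p r) - (LINT r|Leb s. f r - ?q r)"
      using that by (simp add: yosida_sol_eq[OF l y] yosida_sol_eq[OF m(1) z])
    also have "\<dots> = (LINT r|Leb s. (f r - ?p r) - (f r - ?q r))"
      by (rule Bochner_Integration.integral_diff[OF yosida_sol_rhs_integrable[OF l y] yosida_sol_rhs_integrable[OF m(1) z], symmetric])
    finally show ?thesis by simp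
  qed
  note en = energy_identity[OF bounded_linear_ident refl gi t, of "\<lambda>s. y s - z s" 0, OF w]
  have ip: "integrable (Leb t) (\<lambda>s. (norm (?p s))\<^sup>2)" and iq: "integrable (Leb t) (\<lambda>s. (norm (?q s))\<^sup>2)"
    by (intro integrable_Leb_continuous continuous_intros Yy Yz)+
  have id: "integrable (Leb t) (\<lambda>s. (norm (?d s))\<^sup>2)"
    by (intro integrable_Leb_continuous continuous_intros yosida_sol_D_continuous[OF l y] yosida_sol_D_continuous[OF m(1) z])
  have ptw: "inner (y s - z s) (?q s - ?p s) \<le> 2 * l * ((norm (?p s))\<^sup>2 + (norm (?q s))\<^sup>2) - (norm (?d s))\<^sup>2" for s
  proof -
    let ?P = "?p s" and ?Q = "?q s"
    let ?u = "resolvent l (y s) - resolvent m (z s)"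
    have u: "?u \<in> V" using resolvent_in_V[OF l] resolvent_in_V[OF m(1)] V_diff by blast
    have Du: "D ?u = ?d s" using resolvent_in_V[OF l] resolvent_in_V[OF m(1)] D_diff by blast
    \<comment> \<open>Split into the part in \<open>V\<close>, on which the Yosida terms act through \<open>D\<close>, and a small remainder.\<close>
    have "y s - z s = ?u + (l *\<^sub>R ?P - m *\<^sub>R ?Q)"
      using resolvent_plus_yosida[OF l, of "y s"] resolvent_plus_yosida[OF m(1), of "z s"]
      by (simp add: algebra_simps)
    then have "inner (y s - z s) (?q s - ?p s) = inner ?u (?Q - ?P) + inner (l *\<^sub>R ?P - m *\<^sub>R ?Q) (?Q - ?P)"
      by (simp only: inner_add_left)
    also have "inner ?u (?Q - ?P) = - (norm (?d s))\<^sup>2"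
      using inner_yosida[OF l u, of "y s"] inner_yosida[OF m(1) u, of "z s"] Du
      by (simp add: inner_diff_left inner_diff_right inner_commute power2_norm_eq_inner)
    also have "inner (l *\<^sub>R ?P - m *\<^sub>R ?Q) (?Q - ?P) \<le> norm (l *\<^sub>R ?P - m *\<^sub>R ?Q) * norm (?Q - ?P)"
      by (rule norm_cauchy_schwarz)
    also have "\<dots> \<le> (l * (norm ?P + norm ?Q)) * (norm ?P + norm ?Q)"
    proof (intro mult_mono)
      have "norm (l *\<^sub>R ?P - m *\<^sub>R ?Q) \<le> l * norm ?P + m * norm ?Q"
        using norm_triangle_ineq4[of "l *\<^sub>R ?P" "m *\<^sub>R ?Q"] l m by simp
      also have "\<dots> \<le> l * (norm ?P + norm ?Q)"
        using m by (simp add: distrib_left mult_right_mono)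
      finally show "norm (l *\<^sub>R ?P - m *\<^sub>R ?Q) \<le> l * (norm ?P + norm ?Q)" .
      show "norm (?Q - ?P) \<le> norm ?P + norm ?Q" using norm_triangle_ineq4[of ?Q ?P] by simp
    qed (use l in auto)
    also have "\<dots> = l * (norm ?P + norm ?Q)\<^sup>2" by (simp add: power2_eq_square)
    also have "\<dots> \<le> l * (2 * ((norm ?P)\<^sup>2 + (norm ?Q)\<^sup>2))"
    proof (intro mult_left_mono)
      have "0 \<le> (norm ?P - norm ?Q)\<^sup>2" by simp
      then show "(norm ?P + norm ?Q)\<^sup>2 \<le> 2 * ((norm ?P)\<^sup>2 + (norm ?Q)\<^sup>2)"
        by (simp add: power2_eq_square algebra_simps)
    qed (use l in auto)
    finally show ?thesis by (simp add: algebra_simps)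
  qed
  have "(norm (y t - z t))\<^sup>2 = 2 * (LINT s|Leb t. inner (y s - z s) (?q s - ?p s))"
    using en(2) by (simp add: power2_norm_eq_inner)
  also have "(LINT s|Leb t. inner (y s - z s) (?q s - ?p s)) \<le>
      (LINT s|Leb t. 2 * l * ((norm (?p s))\<^sup>2 + (norm (?q s))\<^sup>2) - (norm (?d s))\<^sup>2)"
    using en(1) ip iq id ptw by (intro integral_mono) auto
  also have "\<dots> = 2 * l * ((LINT s|Leb t. (norm (?p s))\<^sup>2) + (LINT s|Leb t. (norm (?q s))\<^sup>2)) - (LINT s|Leb t. (norm (?d s))\<^sup>2)"
    using ip iq id by simp
  also have "2 * l * ((LINT s|Leb t. (norm (?p s))\<^sup>2) + (LINT s|Leb t. (norm (?q s))\<^sup>2)) \<le>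
      2 * l * (((norm (D y0))\<^sup>2 + M\<^sup>2 * t) + ((norm (D y0))\<^sup>2 + M\<^sup>2 * t))"
    using yosida_sol_bound[OF l y t y0] yosida_sol_bound[OF m(1) z t y0] l by (intro mult_left_mono add_mono) auto
  finally show ?thesis by (simp add: algebra_simps)
qed

end

end

section \<open>Weak solutions of the abstract evolution equation\<close>

lemma measurable_lebesgue_on_cong_AE:
  fixes f g :: "'a::euclidean_space \<Rightarrow> 'b::topological_space"
  assumes S: "S \<in> sets lebesgue" and g: "g \<in> borel_measurable (lebesgue_on S)"
    and ae: "AE x in lebesgue_on S. f x = g x"
  shows "f \<in> borel_measurable (lebesgue_on S)"
proof (rule borel_measurableI)
  fix U :: "'b set" assume U: "open U"
  have "g -` U \<inter> space (lebesgue_on S) \<in> sets (lebesgue_on S)"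
    using measurable_sets[OF g] U by simp
  then have gU: "g -` U \<inter> S \<in> sets lebesgue"
    using S by (simp add: sets_restrict_space_iff space_restrict_space)
  have "AE x in lebesgue. x \<in> S \<longrightarrow> f x = g x" using ae S by (simp add: AE_restrict_space_iff)
  then have "AE x in lebesgue. x \<in> g -` U \<inter> S \<longleftrightarrow> x \<in> f -` U \<inter> S" by eventually_elim auto
  from completion.in_sets_AE[OF this gU] have "f -` U \<inter> S \<in> sets lebesgue" by simp
  then show "f -` U \<inter> space (lebesgue_on S) \<in> sets (lebesgue_on S)"
    using S by (simp add: sets_restrict_space_iff space_restrict_space)
qed

text \<open>
  The intervals \<open>{0..T}\<close> and \<open>{0..}\<close> are treated at once.
\<close>

definition time_domain :: "real set \<Rightarrow> bool" where
  "time_domain J \<longleftrightarrow> J \<in> sets lebesgue \<and> (\<forall>t\<in>J. 0 \<le> t \<and> {0..t} \<subseteq> J)"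

lemma time_domain_halfline: "time_domain {0..}" and time_domain_interval: "time_domain {0..T}"
  by (auto simp: time_domain_def)

lemma time_domain_subset: "time_domain J \<Longrightarrow> t \<in> J \<Longrightarrow> {0<..<t} \<subseteq> J"
proof -
  assume "time_domain J" "t \<in> J"
  then have "{0..t} \<subseteq> J" by (simp add: time_domain_def)
  moreover have "{0<..<t} \<subseteq> {0..t}" by auto
  ultimately show "{0<..<t} \<subseteq> J" by (rule subset_trans[rotated])
qed

lemma AE_Leb_time_domain:
  assumes J: "time_domain J" and t: "t \<in> J" and ae: "AE s in lebesgue_on J. P s"
  shows "AE s in Leb t. P s"
proof -
  have "AE s in lebesgue. s \<in> J \<longrightarrow> P s"
    using ae J by (simp add: AE_restrict_space_iff time_domain_def)
  then have "AE s in lebesgue. s \<in> {0<..<t} \<longrightarrow> P s"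
    by eventually_elim (simp add: subsetD[OF time_domain_subset[OF J t]])
  then show ?thesis by (simp add: AE_restrict_space_iff)
qed

lemma AE_halfline_if_AE_Leb:
  assumes "\<And>n::nat. AE s in Leb (real n). P s"
  shows "AE s in lebesgue_on {0..}. P s"
proof -
  have *: "AE s in lebesgue. s \<in> {0<..<real n} \<longrightarrow> P s" for n :: nat
    using assms[of n] by (simp add: AE_restrict_space_iff)
  have "AE s in lebesgue. \<forall>n::nat. s \<in> {0<..<real n} \<longrightarrow> P s"
    by (rule AE_all_countable[THEN iffD2], rule allI, rule *)
  moreover have "AE s::real in lebesgue. s \<noteq> 0" by (rule AE_completion) (rule AE_lborel_singleton)
  ultimately have "AE s in lebesgue. s \<in> {0..} \<longrightarrow> P s"
  proof eventually_elim
    case (elim s)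
    obtain n where "s < real n" using reals_Archimedean2 by blast
    then show ?case using elim by auto
  qed
  then show ?thesis by (simp add: AE_restrict_space_iff)
qed

lemma integrable_if_square_integrable_Leb:
  fixes g :: "real \<Rightarrow> 'b::{banach, second_countable_topology}"
  assumes g: "g \<in> borel_measurable (Leb t)" and sq: "integrable (Leb t) (\<lambda>s. (norm (g s))\<^sup>2)"
  shows "integrable (Leb t) g"
proof (rule Bochner_Integration.integrable_bound[OF _ g])
  show "integrable (Leb t) (\<lambda>s. 1 + (norm (g s))\<^sup>2)"
    using sq finite_measure.integrable_const[OF finite_measure_Leb] by (intro Bochner_Integration.integrable_add) auto
  have "x \<le> 1 + x\<^sup>2" if "0 \<le> x" for x :: real
  proof -
    have "0 \<le> (x - 1)\<^sup>2" "0 \<le> x\<^sup>2" by simp_all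
    then show ?thesis using that by (simp add: power2_eq_square algebra_simps)
  qed
  then show "AE s in Leb t. norm (g s) \<le> norm (1 + (norm (g s))\<^sup>2)"
    by (intro AE_I2) (simp add: add_nonneg_nonneg)
qed

text \<open>
  A nonempty open set of times cannot be a null set, so the property holds on all of \<open>{0<..<T}\<close> and
  passes to the endpoint by continuity.
\<close>

lemma continuous_AE_in_closed:
  fixes y :: "real \<Rightarrow> 'b::metric_space"
  assumes T: "0 < T" and y: "continuous_on {0..T} y" and C: "closed C" and ae: "AE s in Leb T. y s \<in> C"
  shows "y T \<in> C"
proof -
  define W where "W = {s \<in> {0<..<T}. y s \<notin> C}"
  have "AE s in lebesgue. s \<in> {0<..<T} \<longrightarrow> y s \<in> C" using ae by (simp add: AE_restrict_space_iff)
  then have "AE s in lebesgue. s \<notin> W" by (auto simp: W_def elim: eventually_mono)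
  then have "W \<in> null_sets lebesgue" using completion.null_sets_iff_AE[of W lborel] by simp
  then have "negligible W" by (simp add: negligible_iff_null_sets)
  moreover have "open W"
  proof -
    have "continuous_on {0<..<T} y" by (rule continuous_on_subset[OF y]) auto
    then have "open ({0<..<T} \<inter> y -` (- C))" using C by (intro continuous_open_preimage) auto
    moreover have "W = {0<..<T} \<inter> y -` (- C)" by (auto simp: W_def)
    ultimately show ?thesis by simp
  qed
  ultimately have "W = {}" using open_not_negligible by blast
  then have "y ` {0<..<T} \<subseteq> C" by (auto simp: W_def)
  moreover have cl: "closure {0<..<T} = {0..T}" using T by simp
  ultimately have "y ` closure {0<..<T} \<subseteq> C"
    using y C by (intro image_closure_subset) auto
  then show ?thesis using T cl by (auto simp: image_subset_iff)
qed

context closed_form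
begin

definition weak_sol :: "real set \<Rightarrow> 'h \<Rightarrow> (real \<Rightarrow> 'h) \<Rightarrow> (real \<Rightarrow> 'h) \<Rightarrow> bool" where
  "weak_sol J y0 f y \<longleftrightarrow> continuous_on J y \<and> y 0 = y0 \<and>
     (AE t in lebesgue_on J. y t \<in> V) \<and>
     (\<lambda>t. D (y t)) \<in> borel_measurable (lebesgue_on J) \<and>
     (\<forall>t\<in>J. integrable (Leb t) (\<lambda>s. (norm (D (y s)))\<^sup>2)) \<and>
     (\<forall>\<phi>\<in>V. \<forall>t\<in>J. inner (y t) \<phi> = inner y0 \<phi> +
        (LINT s|Leb t. inner (f s) \<phi> - inner (D (y s)) (D \<phi>)))"

lemma weak_solD:
  assumes "weak_sol J y0 f y"
  shows "continuous_on J y" "y 0 = y0" "AE t in lebesgue_on J. y t \<in> V"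
    "(\<lambda>t. D (y t)) \<in> borel_measurable (lebesgue_on J)"
    "t \<in> J \<Longrightarrow> integrable (Leb t) (\<lambda>s. (norm (D (y s)))\<^sup>2)"
    "\<phi> \<in> V \<Longrightarrow> t \<in> J \<Longrightarrow> inner (y t) \<phi> = inner y0 \<phi> +
        (LINT s|Leb t. inner (f s) \<phi> - inner (D (y s)) (D \<phi>))"
proof -
  note w = assms[unfolded weak_sol_def]
  show "continuous_on J y" "y 0 = y0" "AE t in lebesgue_on J. y t \<in> V"
    "(\<lambda>t. D (y t)) \<in> borel_measurable (lebesgue_on J)"
    using w by - (elim conjE, assumption)+
  show "t \<in> J \<Longrightarrow> integrable (Leb t) (\<lambda>s. (norm (D (y s)))\<^sup>2)"
    using w by (elim conjE) (rule bspec)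
  show "\<phi> \<in> V \<Longrightarrow> t \<in> J \<Longrightarrow> inner (y t) \<phi> = inner y0 \<phi> +
        (LINT s|Leb t. inner (f s) \<phi> - inner (D (y s)) (D \<phi>))"
    using w by (elim conjE) (rule bspec, rule bspec)
qed

lemma weak_sol_D_integrable:
  assumes J: "time_domain J" and t: "t \<in> J" and y: "weak_sol J y0 f y"
  shows "integrable (Leb t) (\<lambda>s. D (y s))"
  by (rule integrable_if_square_integrable_Leb[OF measurable_Leb_restrict[OF weak_solD(4)[OF y]
        time_domain_subset[OF J t]] weak_solD(5)[OF y t]])

lemma weak_sol_mono:
  assumes J: "time_domain J" "J' \<subseteq> J" "time_domain J'" and y: "weak_sol J y0 f y"
  shows "weak_sol J' y0 f y"
  unfolding weak_sol_def
proof (intro conjI ballI)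
  show "continuous_on J' y" using continuous_on_subset[OF weak_solD(1)[OF y] J(2)] .
  show "y 0 = y0" by (rule weak_solD(2)[OF y])
  have "AE t in lebesgue. t \<in> J \<longrightarrow> y t \<in> V"
    using weak_solD(3)[OF y] J by (simp add: AE_restrict_space_iff time_domain_def)
  then have "AE t in lebesgue. t \<in> J' \<longrightarrow> y t \<in> V" by eventually_elim (use J in blast)
  then show "AE t in lebesgue_on J'. y t \<in> V" using J by (simp add: AE_restrict_space_iff time_domain_def)
  show "(\<lambda>t. D (y t)) \<in> borel_measurable (lebesgue_on J')"
    by (rule measurable_restrict_mono[OF weak_solD(4)[OF y] J(2)])
next
  fix t assume "t \<in> J'"
  then have t: "t \<in> J" using J by blast
  show "integrable (Leb t) (\<lambda>s. (norm (D (y s)))\<^sup>2)" by (rule weak_solD(5)[OF y t])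
  fix \<phi> assume p: "\<phi> \<in> V"
  show "inner (y t) \<phi> = inner y0 \<phi> + (LINT s|Leb t. inner (f s) \<phi> - inner (D (y s)) (D \<phi>))"
    by (rule weak_solD(6)[OF y p t])
qed

lemma weak_sol_cong_AE:
  assumes J: "time_domain J" and y: "weak_sol J y0 f y"
    and f: "\<And>t. t \<in> J \<Longrightarrow> f \<in> borel_measurable (Leb t)" and g: "\<And>t. t \<in> J \<Longrightarrow> g \<in> borel_measurable (Leb t)"
    and ae: "\<And>t. t \<in> J \<Longrightarrow> AE s in Leb t. f s = g s"
  shows "weak_sol J y0 g y"
proof -
  have "(LINT s|Leb t. inner (f s) \<phi> - inner (D (y s)) (D \<phi>)) = (LINT s|Leb t. inner (g s) \<phi> - inner (D (y s)) (D \<phi>))"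
    if t: "t \<in> J" for t \<phi>
  proof (rule integral_cong_AE)
    have [measurable]: "f \<in> borel_measurable (Leb t)" "g \<in> borel_measurable (Leb t)"
      "(\<lambda>s. D (y s)) \<in> borel_measurable (Leb t)"
      using f[OF t] g[OF t] weak_sol_D_integrable[OF J t y] by auto
    show "(\<lambda>s. inner (f s) \<phi> - inner (D (y s)) (D \<phi>)) \<in> borel_measurable (Leb t)"
      "(\<lambda>s. inner (g s) \<phi> - inner (D (y s)) (D \<phi>)) \<in> borel_measurable (Leb t)" by measurable
    show "AE s in Leb t. inner (f s) \<phi> - inner (D (y s)) (D \<phi>) = inner (g s) \<phi> - inner (D (y s)) (D \<phi>)"
      using ae[OF t] by eventually_elim simp
  qed
  then show ?thesis
    unfolding weak_sol_def using weak_solD[OF y] by (intro conjI ballI) auto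
qed

text \<open>
  Linearity of \<open>D\<close> is available only at the almost all times where both solutions lie in \<open>V\<close>;
  elsewhere \<open>D\<close> has arbitrary values, so measurability has to be transferred through a null set.
\<close>

lemma weak_sol_linear_combination:
  assumes J: "time_domain J" and y: "weak_sol J y0 f y" and z: "weak_sol J z0 g z"
    and f: "\<And>t. t \<in> J \<Longrightarrow> integrable (Leb t) f" and g: "\<And>t. t \<in> J \<Longrightarrow> integrable (Leb t) g"
  shows "weak_sol J (a *\<^sub>R y0 + b *\<^sub>R z0) (\<lambda>s. a *\<^sub>R f s + b *\<^sub>R g s) (\<lambda>s. a *\<^sub>R y s + b *\<^sub>R z s)"
    and "AE s in lebesgue_on J. D (a *\<^sub>R y s + b *\<^sub>R z s) = a *\<^sub>R D (y s) + b *\<^sub>R D (z s)"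
proof -
  have JL: "J \<in> sets lebesgue" using J by (simp add: time_domain_def)
  show D_eq: "AE s in lebesgue_on J. D (a *\<^sub>R y s + b *\<^sub>R z s) = a *\<^sub>R D (y s) + b *\<^sub>R D (z s)"
    using weak_solD(3)[OF y] weak_solD(3)[OF z]
    by eventually_elim (simp add: D_add D_scaleR V_scaleR)
  have m: "(\<lambda>t. D (a *\<^sub>R y t + b *\<^sub>R z t)) \<in> borel_measurable (lebesgue_on J)"
    by (rule measurable_lebesgue_on_cong_AE[OF JL _ D_eq])
       (intro borel_measurable_add borel_measurable_scaleR borel_measurable_const weak_solD(4)[OF y] weak_solD(4)[OF z])
  show "weak_sol J (a *\<^sub>R y0 + b *\<^sub>R z0) (\<lambda>s. a *\<^sub>R f s + b *\<^sub>R g s) (\<lambda>s. a *\<^sub>R y s + b *\<^sub>R z s)"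
    unfolding weak_sol_def
  proof (intro conjI ballI)
    show "continuous_on J (\<lambda>s. a *\<^sub>R y s + b *\<^sub>R z s)"
      by (intro continuous_intros weak_solD(1)[OF y] weak_solD(1)[OF z])
    show "a *\<^sub>R y 0 + b *\<^sub>R z 0 = a *\<^sub>R y0 + b *\<^sub>R z0" by (simp add: weak_solD(2)[OF y] weak_solD(2)[OF z])
    show "AE t in lebesgue_on J. a *\<^sub>R y t + b *\<^sub>R z t \<in> V"
      using weak_solD(3)[OF y] weak_solD(3)[OF z] by eventually_elim (intro V_add V_scaleR)
    show "(\<lambda>t. D (a *\<^sub>R y t + b *\<^sub>R z t)) \<in> borel_measurable (lebesgue_on J)" by (rule m)
  next
    fix t assume t: "t \<in> J"
    have mt: "(\<lambda>t. D (a *\<^sub>R y t + b *\<^sub>R z t)) \<in> borel_measurable (Leb t)"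
      by (rule measurable_Leb_restrict[OF m time_domain_subset[OF J t]])
    have ae: "AE s in Leb t. D (a *\<^sub>R y s + b *\<^sub>R z s) = a *\<^sub>R D (y s) + b *\<^sub>R D (z s)"
      by (rule AE_Leb_time_domain[OF J t D_eq])
    show "integrable (Leb t) (\<lambda>s. (norm (D (a *\<^sub>R y s + b *\<^sub>R z s)))\<^sup>2)"
    proof (rule Bochner_Integration.integrable_bound)
      show "integrable (Leb t) (\<lambda>s. 2 * a\<^sup>2 * (norm (D (y s)))\<^sup>2 + 2 * b\<^sup>2 * (norm (D (z s)))\<^sup>2)"
        by (intro Bochner_Integration.integrable_add integrable_mult_right weak_solD(5)[OF y t] weak_solD(5)[OF z t])
      show "(\<lambda>s. (norm (D (a *\<^sub>R y s + b *\<^sub>R z s)))\<^sup>2) \<in> borel_measurable (Leb t)" using mt by measurable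
      show "AE s in Leb t. norm ((norm (D (a *\<^sub>R y s + b *\<^sub>R z s)))\<^sup>2) \<le>
          norm (2 * a\<^sup>2 * (norm (D (y s)))\<^sup>2 + 2 * b\<^sup>2 * (norm (D (z s)))\<^sup>2)"
        using ae
      proof eventually_elim
        case (elim s)
        have "(norm (a *\<^sub>R D (y s) + b *\<^sub>R D (z s)))\<^sup>2 \<le> (\<bar>a\<bar> * norm (D (y s)) + \<bar>b\<bar> * norm (D (z s)))\<^sup>2"
          using norm_triangle_ineq[of "a *\<^sub>R D (y s)" "b *\<^sub>R D (z s)"] by (intro power_mono) auto
        also have "\<dots> \<le> 2 * (\<bar>a\<bar> * norm (D (y s)))\<^sup>2 + 2 * (\<bar>b\<bar> * norm (D (z s)))\<^sup>2"
        proof -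
          have "0 \<le> (\<bar>a\<bar> * norm (D (y s)) - \<bar>b\<bar> * norm (D (z s)))\<^sup>2" by simp
          then show ?thesis by (simp add: power2_sum power2_diff)
        qed
        finally show ?case by (simp add: elim power_mult_distrib)
      qed
    qed
    fix \<phi> assume p: "\<phi> \<in> V"
    have iy: "integrable (Leb t) (\<lambda>s. inner (f s) \<phi> - inner (D (y s)) (D \<phi>))"
      and iz: "integrable (Leb t) (\<lambda>s. inner (g s) \<phi> - inner (D (z s)) (D \<phi>))"
      using f[OF t] g[OF t] weak_sol_D_integrable[OF J t y] weak_sol_D_integrable[OF J t z] by auto
    have mf: "f \<in> borel_measurable (Leb t)" "g \<in> borel_measurable (Leb t)" using f[OF t] g[OF t] by auto
    have "(LINT s|Leb t. inner (a *\<^sub>R f s + b *\<^sub>R g s) \<phi> - inner (D (a *\<^sub>R y s + b *\<^sub>R z s)) (D \<phi>)) =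
      (LINT s|Leb t. a * (inner (f s) \<phi> - inner (D (y s)) (D \<phi>)) + b * (inner (g s) \<phi> - inner (D (z s)) (D \<phi>)))"
    proof (rule integral_cong_AE)
      show "(\<lambda>s. inner (a *\<^sub>R f s + b *\<^sub>R g s) \<phi> - inner (D (a *\<^sub>R y s + b *\<^sub>R z s)) (D \<phi>)) \<in> borel_measurable (Leb t)"
        using mt mf by measurable
      show "(\<lambda>s. a * (inner (f s) \<phi> - inner (D (y s)) (D \<phi>)) + b * (inner (g s) \<phi> - inner (D (z s)) (D \<phi>))) \<in> borel_measurable (Leb t)"
        using iy iz by (intro borel_measurable_add borel_measurable_times borel_measurable_const) auto
      show "AE s in Leb t. inner (a *\<^sub>R f s + b *\<^sub>R g s) \<phi> - inner (D (a *\<^sub>R y s + b *\<^sub>R z s)) (D \<phi>) =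
        a * (inner (f s) \<phi> - inner (D (y s)) (D \<phi>)) + b * (inner (g s) \<phi> - inner (D (z s)) (D \<phi>))"
        using ae by eventually_elim (simp add: inner_add_left algebra_simps)
    qed
    also have "\<dots> = a * (LINT s|Leb t. inner (f s) \<phi> - inner (D (y s)) (D \<phi>)) + b * (LINT s|Leb t. inner (g s) \<phi> - inner (D (z s)) (D \<phi>))"
      using iy iz by (subst Bochner_Integration.integral_add) (auto intro!: integrable_mult_right)
    finally show "inner (a *\<^sub>R y t + b *\<^sub>R z t) \<phi> = inner (a *\<^sub>R y0 + b *\<^sub>R z0) \<phi> +
        (LINT s|Leb t. inner (a *\<^sub>R f s + b *\<^sub>R g s) \<phi> - inner (D (a *\<^sub>R y s + b *\<^sub>R z s)) (D \<phi>))"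
      by (simp add: inner_add_left weak_solD(6)[OF y p t] weak_solD(6)[OF z p t] distrib_left)
  qed
qed

lemma weak_sol_in_closure:
  assumes J: "time_domain J" and y: "weak_sol J y0 f y" and y0: "y0 \<in> closure V" and t: "t \<in> J"
  shows "y t \<in> closure V"
proof (cases "t = 0")
  case True
  then show ?thesis using weak_solD(2)[OF y] y0 by simp
next
  case False
  then have t0: "0 < t" using J t by (simp add: time_domain_def less_le)
  have sub: "{0..t} \<subseteq> J" using J t by (simp add: time_domain_def)
  have "AE s in Leb t. y s \<in> closure V"
    using AE_Leb_time_domain[OF J t weak_solD(3)[OF y]]
    by eventually_elim (rule subsetD[OF closure_subset])
  then show ?thesis
    by (rule continuous_AE_in_closed[OF t0 continuous_on_subset[OF weak_solD(1)[OF y] sub] closed_closure])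
qed

text \<open>
  Uniqueness without an energy equality for weak solutions: at almost every time \<open>t\<close> the equation may
  be tested with \<open>w t\<close> itself, and then says that \<open>\<bar>w t\<bar>\<^sup>2\<close> is minus the integral of
  \<open>\<langle>D (w s), D (w t)\<rangle>\<close> over \<open>s < t\<close>. Integrated over \<open>t\<close>, the right-hand side is minus half a square.
\<close>

lemma weak_sol_zero:
  assumes J: "time_domain J" and w: "weak_sol J 0 (\<lambda>_. 0) w" and T: "T \<in> J"
  shows "w T = 0"
proof (cases "T = 0")
  case True
  then show ?thesis using weak_solD(2)[OF w] by simp
next
  case False
  then have T0: "0 < T" using J T by (simp add: time_domain_def less_le)
  have sub: "{0..T} \<subseteq> J" using J T by (auto simp: time_domain_def)
  have wc: "continuous_on {0..T} w" using continuous_on_subset[OF weak_solD(1)[OF w] sub] .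
  have Di: "integrable (Leb t) (\<lambda>s. D (w s))" if "t \<in> J" for t by (rule weak_sol_D_integrable[OF J that w])
  note tri = triangle_integral_eq_half_square[OF bounded_linear_ident refl Di[OF T]]
  have mw: "w \<in> borel_measurable (Leb T)"
    by (rule measurable_Leb_continuous[OF wc]) auto
  have mI: "(\<lambda>t. - inner (LINT s|Leb t. D (w s)) (D (w t))) \<in> borel_measurable (Leb T)"
    using tri(1) by (intro borel_measurable_uminus) auto
  have "AE t in Leb T. w t \<in> V" by (rule AE_Leb_time_domain[OF J T weak_solD(3)[OF w]])
  moreover have "AE t in Leb T. t \<in> {0<..<T}" by (rule AE_I2) (simp add: space_restrict_space)
  ultimately have eq: "AE t in Leb T. (norm (w t))\<^sup>2 = - inner (LINT s|Leb t. D (w s)) (D (w t))"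
  proof eventually_elim
    case (elim t)
    have tJ: "t \<in> J" using sub elim by auto
    show ?case using weak_solD(6)[OF w elim(1) tJ] Di[OF tJ]
      by (simp add: power2_norm_eq_inner)
  qed
  have int: "integrable (Leb T) (\<lambda>t. (norm (w t))\<^sup>2)"
    using integrable_cong_AE[OF _ mI eq] mw tri(1) by simp
  have "(LINT t|Leb T. (norm (w t))\<^sup>2) = (LINT t|Leb T. - inner (LINT s|Leb t. D (w s)) (D (w t)))"
    by (rule integral_cong_AE[OF _ mI eq]) (use mw in simp)
  also have "\<dots> \<le> 0"
  proof -
    have "0 \<le> 2 * (LINT s|Leb T. inner (LINT r|Leb s. D (w r)) (D (w s)))"
      unfolding tri(2) by (rule inner_ge_zero)
    then show ?thesis by simp
  qed
  finally have "(LINT t|Leb T. (norm (w t))\<^sup>2) \<le> 0" .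
  then have "(LINT t|Leb T. (norm (w t))\<^sup>2) = 0" by (intro antisym integral_nonneg) auto
  then have "AE t in Leb T. (norm (w t))\<^sup>2 = 0" by (subst (asm) integral_nonneg_eq_0_iff_AE[OF int]) auto
  then have "AE t in Leb T. w t \<in> {0}" by eventually_elim simp
  from continuous_AE_in_closed[OF T0 wc closed_singleton this] show ?thesis by simp
qed

lemma weak_sol_unique:
  assumes J: "time_domain J" and y: "weak_sol J y0 f y" and z: "weak_sol J y0 f z"
    and f: "\<And>t. t \<in> J \<Longrightarrow> integrable (Leb t) f" and t: "t \<in> J"
  shows "y t = z t"
proof -
  have "weak_sol J 0 (\<lambda>_. 0) (\<lambda>s. y s - z s)"
    using weak_sol_linear_combination(1)[OF J y z f f, of 1 "-1"] by simp
  from weak_sol_zero[OF J this t] show ?thesis by simp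
qed

end

section \<open>Existence and stability of weak solutions\<close>

lemma continuous_on_halfline_if_compact:
  fixes y :: "real \<Rightarrow> 'b::metric_space"
  assumes "\<And>T. 0 \<le> T \<Longrightarrow> continuous_on {0..T} y"
  shows "continuous_on {0..} y"
  unfolding continuous_on_eq_continuous_within
proof
  fix x :: real assume x: "x \<in> {0..}"
  have "continuous (at x within {0..x+1}) y"
    using assms[of "x + 1"] x by (auto simp: continuous_on_eq_continuous_within)
  moreover have "at x within {0..} = at x within {0..x+1}"
    by (rule at_within_nhd[of _ "{..<x+1}"]) auto
  ultimately show "continuous (at x within {0..}) y" by simp
qed

text \<open>
  The argument \<open>d\<close> stands for \<open>D\<close> along the solution; for Yosida approximations it is \<open>D\<close> along the
  resolvent instead.
\<close>

definition energy_ineq :: "(real \<Rightarrow> 'h::real_inner) \<Rightarrow> 'h \<Rightarrow> (real \<Rightarrow> 'h) \<Rightarrow> (real \<Rightarrow> 'g::real_normed_vector) \<Rightarrow> bool" where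
  "energy_ineq f y0 y d \<longleftrightarrow> (\<forall>t\<ge>0. (norm (y t))\<^sup>2 + 2 * (LINT s|Leb t. (norm (d s))\<^sup>2)
    \<le> (norm y0)\<^sup>2 + 2 * (LINT s|Leb t. inner (y s) (f s)))"

context closed_form
begin

context
  fixes f :: "real \<Rightarrow> 'h" and M :: real
  assumes f: "f \<in> borel_measurable lebesgue" and fM: "\<And>s. norm (f s) \<le> M"
begin

text \<open>
  The passage to the limit, used twice: for Yosida approximations, where \<open>z n\<close> is the resolvent of
  \<open>y n\<close>, and for weak solutions with converging initial values, where \<open>z n = y n\<close>. Geometric rates make
  \<open>D (z n)\<close> converge almost everywhere and in the mean square without a choice of subsequences, and
  closedness of the graph identifies the limit as \<open>D\<close> of the limit solution.
\<close>

lemma weak_sol_limit: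
  fixes y z :: "nat \<Rightarrow> real \<Rightarrow> 'h" and init :: "nat \<Rightarrow> 'h"
  assumes yc: "\<And>n. continuous_on {0..} (y n)" and y_0: "\<And>n. y n 0 = init n" and init: "init \<longlonglongrightarrow> y0"
    and zV: "\<And>n. AE t in lebesgue_on {0..}. z n t \<in> V"
    and zm: "\<And>n. z n \<in> borel_measurable (lebesgue_on {0..})"
    and Dm: "\<And>n. (\<lambda>t. D (z n t)) \<in> borel_measurable (lebesgue_on {0..})"
    and Di: "\<And>n t. 0 \<le> t \<Longrightarrow> integrable (Leb t) (\<lambda>s. (norm (D (z n s)))\<^sup>2)"
    and weak: "\<And>n t \<phi>. 0 \<le> t \<Longrightarrow> \<phi> \<in> V \<Longrightarrow> inner (y n t) \<phi> = inner (init n) \<phi> +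
        (LINT s|Leb t. inner (f s) \<phi> - inner (D (z n s)) (D \<phi>))"
    and energy: "\<And>n. energy_ineq f (init n) (y n) (\<lambda>s. D (z n s))"
    and rate: "\<And>T. 0 \<le> T \<Longrightarrow> \<exists>C\<ge>0. \<forall>m n. m \<le> n \<longrightarrow>
        (\<forall>s\<in>{0..T}. (norm (y m s - y n s))\<^sup>2 \<le> C * (1/4) ^ m) \<and>
        (\<integral>\<^sup>+s. ennreal ((norm (D (z m s) - D (z n s)))\<^sup>2) \<partial>Leb T) \<le> ennreal (C * (1/4) ^ m) \<and>
        (\<integral>\<^sup>+s. ennreal ((norm (y m s - z m s))\<^sup>2) \<partial>Leb T) \<le> ennreal (C * (1/4) ^ m)"
  shows "\<exists>y. weak_sol {0..} y0 f y \<and> energy_ineq f y0 y (\<lambda>s. D (y s))"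
proof -
  have sq: "((1/2) ^ m)\<^sup>2 = (1/4 :: real) ^ m" for m :: nat
    by (simp add: power2_eq_square flip: power_mult_distrib)
  have half: "(\<lambda>m. (1/2 :: real) ^ m) \<longlonglongrightarrow> 0" by (rule LIMSEQ_power_zero) simp
  define Y where "Y t = lim (\<lambda>n. y n t)" for t
  have Cbound: "norm (y m s - y n s) \<le> sqrt C * (1/2) ^ m"
    if "(norm (y m s - y n s))\<^sup>2 \<le> C * (1/4) ^ m" "0 \<le> C" for C m n s
  proof -
    have "(norm (y m s - y n s))\<^sup>2 \<le> (sqrt C * (1/2) ^ m)\<^sup>2" using that by (simp add: power_mult_distrib sq)
    then show ?thesis by (rule power2_le_imp_le) (use that in simp)
  qed
  have lim: "(\<lambda>n. y n s) \<longlonglongrightarrow> Y s" if s: "0 \<le> s" for s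
  proof -
    obtain C where C: "C \<ge> 0" "\<And>m n. m \<le> n \<Longrightarrow> (norm (y m s - y n s))\<^sup>2 \<le> C * (1/4) ^ m"
      using rate[OF s] s by force
    have "Cauchy (\<lambda>n. y n s)"
      unfolding Cauchy_altdef2
    proof safe
      fix e :: real assume e: "e > 0"
      have "(\<lambda>m. sqrt C * (1/2) ^ m) \<longlonglongrightarrow> sqrt C * 0" by (intro tendsto_mult tendsto_const half)
      then have "eventually (\<lambda>m. sqrt C * (1/2) ^ m < e) sequentially" using e by (intro order_tendstoD(2)[of _ 0]) auto
      then obtain m where "sqrt C * (1/2) ^ m < e" by (auto simp: eventually_sequentially)
      then have "dist (y n s) (y m s) < e" if "n \<ge> m" for n
        using Cbound[OF C(2)[OF that] C(1)] by (simp add: dist_norm norm_minus_commute)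
      then show "\<exists>N. \<forall>n\<ge>N. dist (y n s) (y N s) < e" by blast
    qed
    then show ?thesis unfolding Y_def by (simp add: Cauchy_convergent convergent_LIMSEQ_iff[symmetric])
  qed
  have unif: "norm (y m s - Y s) \<le> sqrt C * (1/2) ^ m"
    if C: "C \<ge> 0" "\<And>n. m \<le> n \<Longrightarrow> (norm (y m s - y n s))\<^sup>2 \<le> C * (1/4) ^ m" and s: "0 \<le> s" for C m s
  proof (rule LIMSEQ_le_const2)
    show "(\<lambda>n. norm (y m s - y n s)) \<longlonglongrightarrow> norm (y m s - Y s)" by (intro tendsto_intros lim[OF s])
    show "\<exists>N. \<forall>n\<ge>N. norm (y m s - y n s) \<le> sqrt C * (1/2) ^ m" using Cbound C by blast
  qed
  have Yc: "continuous_on {0..} Y"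
  proof (rule continuous_on_halfline_if_compact)
    fix T :: real assume T: "0 \<le> T"
    obtain C where C: "C \<ge> 0" "\<And>m n s. m \<le> n \<Longrightarrow> s \<in> {0..T} \<Longrightarrow> (norm (y m s - y n s))\<^sup>2 \<le> C * (1/4) ^ m"
      using rate[OF T] by force
    have "uniform_limit {0..T} y Y sequentially"
    proof (rule uniform_limitI)
      fix e :: real assume e: "e > 0"
      have "(\<lambda>m. sqrt C * (1/2) ^ m) \<longlonglongrightarrow> sqrt C * 0" by (intro tendsto_mult tendsto_const half)
      then have "eventually (\<lambda>m. sqrt C * (1/2) ^ m < e) sequentially" using e by (intro order_tendstoD(2)[of _ 0]) auto
      then show "\<forall>\<^sub>F n in sequentially. \<forall>s\<in>{0..T}. dist (y n s) (Y s) < e"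
      proof eventually_elim
        case (elim n)
        then show ?case using unif[OF C(1) C(2), of n] by (fastforce simp: dist_norm)
      qed
    qed
    then show "continuous_on {0..T} Y"
      by (rule uniform_limit_theorem[rotated])
         (auto intro!: always_eventually continuous_on_subset[OF yc])
  qed
  have Y_0: "Y 0 = y0" using lim[of 0] init LIMSEQ_unique by (simp add: y_0)
  have zmL: "z n \<in> borel_measurable (Leb T)" and DmL: "(\<lambda>t. D (z n t)) \<in> borel_measurable (Leb T)"
    and ymL: "y n \<in> borel_measurable (Leb T)" for n T
    by (rule measurable_Leb_restrict[OF zm] measurable_Leb_restrict[OF Dm] measurable_Leb_continuous[OF yc]; force)+
  have AEV: "AE s in Leb T. \<forall>n. z n s \<in> V" if "0 \<le> T" for T
    by (rule AE_all_countable[THEN iffD2], rule allI,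
        rule AE_Leb_time_domain[OF time_domain_halfline _ zV]) (use that in simp)
  have key: "(AE s in Leb T. Y s \<in> V \<and> (\<lambda>n. D (z n s)) \<longlonglongrightarrow> D (Y s)) \<and>
     (\<exists>C\<ge>0. \<forall>m. (\<integral>\<^sup>+s. ennreal ((norm (D (z m s) - D (Y s)))\<^sup>2) \<partial>Leb T) \<le> ennreal (C * (1/4) ^ m))"
    if T: "0 \<le> T" for T
  proof -
    obtain C where C: "C \<ge> 0"
      "\<And>m n. m \<le> n \<Longrightarrow> (\<integral>\<^sup>+s. ennreal ((norm (D (z m s) - D (z n s)))\<^sup>2) \<partial>Leb T) \<le> ennreal (C * (1/4) ^ m)"
      "\<And>m. (\<integral>\<^sup>+s. ennreal ((norm (y m s - z m s))\<^sup>2) \<partial>Leb T) \<le> ennreal (C * (1/4) ^ m)"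
      using rate[OF T] by blast
    obtain g where g: "AE s in Leb T. (\<lambda>n. D (z n s)) \<longlonglongrightarrow> g s"
      and gb: "\<And>m. (\<integral>\<^sup>+s. ennreal ((norm (D (z m s) - g s))\<^sup>2) \<partial>Leb T) \<le> ennreal (C * (1/4) ^ m)"
    proof (rule AE_limit_of_fast_L2_Cauchy[OF DmL C(2)])
      fix g assume "AE s in Leb T. (\<lambda>n. D (z n s)) \<longlonglongrightarrow> g s"
        "\<And>m. (\<integral>\<^sup>+s. ennreal ((norm (D (z m s) - g s))\<^sup>2) \<partial>Leb T) \<le> ennreal (C * (1/4) ^ m)"
      then show ?thesis by (rule that)
    qed
    have "AE s in Leb T. (\<lambda>n. y n s - z n s) \<longlonglongrightarrow> 0"
      by (rule AE_tendsto_zero_if_fast[OF _ C(3)]) (intro borel_measurable_diff ymL zmL)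
    moreover have "AE s in Leb T. s \<in> {0<..<T}" by (rule AE_I2) (simp add: space_restrict_space)
    ultimately have ae: "AE s in Leb T. Y s \<in> V \<and> D (Y s) = g s \<and> (\<lambda>n. D (z n s)) \<longlonglongrightarrow> g s"
      using g AEV[OF T]
    proof eventually_elim
      case (elim s)
      have "(\<lambda>n. y n s - (y n s - z n s)) \<longlonglongrightarrow> Y s - 0"
        by (intro tendsto_diff lim elim(1)) (use elim in auto)
      then have "(\<lambda>n. z n s) \<longlonglongrightarrow> Y s" by simp
      then have "Y s \<in> V \<and> D (Y s) = g s" using elim by (intro closed_graph) auto
      then show ?case using elim by simp
    qed
    have "(\<integral>\<^sup>+s. ennreal ((norm (D (z m s) - D (Y s)))\<^sup>2) \<partial>Leb T) = (\<integral>\<^sup>+s. ennreal ((norm (D (z m s) - g s))\<^sup>2) \<partial>Leb T)" for m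
      by (rule nn_integral_cong_AE) (use ae in eventually_elim, simp)
    moreover have "AE s in Leb T. Y s \<in> V \<and> (\<lambda>n. D (z n s)) \<longlonglongrightarrow> D (Y s)"
      using ae by eventually_elim auto
    ultimately show ?thesis using gb C(1) by auto
  qed
  have aeJ: "AE s in lebesgue_on {0..}. Y s \<in> V \<and> (\<lambda>n. D (z n s)) \<longlonglongrightarrow> D (Y s)"
    by (rule AE_halfline_if_AE_Leb) (use key in auto)
  have DYm: "(\<lambda>t. D (Y t)) \<in> borel_measurable (lebesgue_on {0..})"
  proof (rule measurable_lebesgue_on_cong_AE)
    show "(\<lambda>t. lim (\<lambda>n. D (z n t))) \<in> borel_measurable (lebesgue_on {0..})"
      by (rule borel_measurable_lim_metric[OF Dm])
    show "AE t in lebesgue_on {0..}. D (Y t) = lim (\<lambda>n. D (z n t))"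
      using aeJ by eventually_elim (auto simp: limI)
  qed simp
  have DYmL: "(\<lambda>t. D (Y t)) \<in> borel_measurable (Leb T)" for T
    by (rule measurable_Leb_restrict[OF DYm]) auto
  have fmL: "f \<in> borel_measurable (Leb T)" for T by (rule measurable_Leb_lebesgue[OF f])
  have hi: "\<exists>C\<ge>0. \<forall>m. integrable (Leb T) (\<lambda>s. (norm (D (z m s) - D (Y s)))\<^sup>2) \<and>
      (LINT s|Leb T. (norm (D (z m s) - D (Y s)))\<^sup>2) \<le> C * (1/4) ^ m" if T: "0 \<le> T" for T
  proof -
    obtain C where C: "C \<ge> 0"
      "\<And>m. (\<integral>\<^sup>+s. ennreal ((norm (D (z m s) - D (Y s)))\<^sup>2) \<partial>Leb T) \<le> ennreal (C * (1/4) ^ m)"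
      using key[OF T] by blast
    have m: "(\<lambda>s. (norm (D (z m s) - D (Y s)))\<^sup>2) \<in> borel_measurable (Leb T)" for m
      using DmL[of m T] DYmL[of T] by measurable
    have i: "integrable (Leb T) (\<lambda>s. (norm (D (z m s) - D (Y s)))\<^sup>2)" for m
      by (rule integrableI_nonneg[OF m]) (use C(2)[of m] in \<open>auto simp: less_top[symmetric] top_unique\<close>)
    have "(LINT s|Leb T. (norm (D (z m s) - D (Y s)))\<^sup>2) \<le> C * (1/4) ^ m" for m
      using C(2)[of m] C(1) by (subst (asm) nn_integral_eq_integral[OF i]) auto
    then show ?thesis using i C(1) by blast
  qed
  have DYi: "integrable (Leb T) (\<lambda>s. (norm (D (Y s)))\<^sup>2)" if T: "0 \<le> T" for T
  proof (rule Bochner_Integration.integrable_bound)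
    show "integrable (Leb T) (\<lambda>s. 2 * (norm (D (z 0 s)))\<^sup>2 + 2 * (norm (D (z 0 s) - D (Y s)))\<^sup>2)"
      using Di[OF T, of 0] hi[OF T] by (intro Bochner_Integration.integrable_add integrable_mult_right) auto
    show "(\<lambda>s. (norm (D (Y s)))\<^sup>2) \<in> borel_measurable (Leb T)" using DYmL[of T] by measurable
    have "(norm b)\<^sup>2 \<le> 2 * (norm a)\<^sup>2 + 2 * (norm (a - b))\<^sup>2" for a b :: 'g
    proof -
      have "norm b \<le> norm a + norm (a - b)" using norm_triangle_ineq4[of a "a - b"] by simp
      then have "(norm b)\<^sup>2 \<le> (norm a + norm (a - b))\<^sup>2" by (intro power_mono) auto
      moreover have "0 \<le> (norm a - norm (a - b))\<^sup>2" by simp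
      ultimately show ?thesis by (simp add: power2_sum power2_diff)
    qed
    then show "AE s in Leb T. norm ((norm (D (Y s)))\<^sup>2) \<le> norm (2 * (norm (D (z 0 s)))\<^sup>2 + 2 * (norm (D (z 0 s) - D (Y s)))\<^sup>2)"
      by (intro AE_I2) simp
  qed
  have DYi1: "integrable (Leb T) (\<lambda>s. D (Y s))" if "0 \<le> T" for T
    by (rule integrable_if_square_integrable_Leb[OF DYmL DYi[OF that]])
  have Dzi1: "integrable (Leb T) (\<lambda>s. D (z n s))" if "0 \<le> T" for T n
    by (rule integrable_if_square_integrable_Leb[OF DmL Di[OF that]])
  have fi: "integrable (Leb T) f" for T by (rule integrable_Leb_bounded_lebesgue[OF f fM])
  have sol: "weak_sol {0..} y0 f Y"
    unfolding weak_sol_def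
  proof (intro conjI ballI Yc Y_0 DYm)
    show "AE t in lebesgue_on {0..}. Y t \<in> V" using aeJ by eventually_elim simp
    show "integrable (Leb t) (\<lambda>s. (norm (D (Y s)))\<^sup>2)" if "t \<in> {0..}" for t using DYi that by simp
    fix \<phi> and t :: real assume p: "\<phi> \<in> V" and "t \<in> {0..}"
    then have t: "0 \<le> t" by simp
    \<comment> \<open>Young's inequality with weights \<open>(1/2) ^ n\<close> and \<open>2 ^ n\<close> bounds the error by a null sequence, since the
      mean square of \<open>D (z n) - D Y\<close> is of order \<open>(1/4) ^ n\<close>.\<close>
    let ?e = "\<lambda>n. LINT s|Leb t. inner (D (z n s) - D (Y s)) (D \<phi>)"
    obtain C where C: "C \<ge> 0" "\<And>m. integrable (Leb t) (\<lambda>s. (norm (D (z m s) - D (Y s)))\<^sup>2)"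
      "\<And>m. (LINT s|Leb t. (norm (D (z m s) - D (Y s)))\<^sup>2) \<le> C * (1/4) ^ m" using hi[OF t] by blast
    have e_bound: "\<bar>?e n\<bar> \<le> ((norm (D \<phi>))\<^sup>2 * t + C) * (1/2) ^ n" for n
    proof -
      have ptw: "\<bar>inner a b\<bar> \<le> (1/2) ^ n * (norm b)\<^sup>2 + 2 ^ n * (norm a)\<^sup>2" for a b :: 'g
      proof -
        have "0 \<le> ((1/2) ^ n * norm b - norm a)\<^sup>2" by simp
        then have "2 * (1/2) ^ n * (norm a * norm b) \<le> (1/2) ^ n * (1/2) ^ n * (norm b)\<^sup>2 + (norm a)\<^sup>2"
          by (simp add: power2_eq_square algebra_simps)
        then have "2 ^ n * (2 * (1/2) ^ n * (norm a * norm b)) \<le> 2 ^ n * ((1/2) ^ n * (1/2) ^ n * (norm b)\<^sup>2 + (norm a)\<^sup>2)"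
          by (intro mult_left_mono) auto
        moreover have "(2::real) ^ n * (1/2) ^ n = 1" by (simp flip: power_mult_distrib)
        ultimately have "2 * (norm a * norm b) \<le> (1/2) ^ n * (norm b)\<^sup>2 + 2 ^ n * (norm a)\<^sup>2"
          by (simp add: algebra_simps) (simp add: power_divide)
        moreover have "\<bar>inner a b\<bar> \<le> norm a * norm b" by (rule Cauchy_Schwarz_ineq2)
        moreover have "0 \<le> norm a * norm b" by simp
        ultimately show ?thesis by linarith
      qed
      have ci: "integrable (Leb t) (\<lambda>s. (1/2) ^ n * (norm (D \<phi>))\<^sup>2)"
        by (rule finite_measure.integrable_const[OF finite_measure_Leb])
      have "\<bar>?e n\<bar> \<le> (LINT s|Leb t. \<bar>inner (D (z n s) - D (Y s)) (D \<phi>)\<bar>)"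
        using integral_norm_bound[of "Leb t" "\<lambda>s. inner (D (z n s) - D (Y s)) (D \<phi>)"] by simp
      also have "\<dots> \<le> (LINT s|Leb t. (1/2) ^ n * (norm (D \<phi>))\<^sup>2 + 2 ^ n * (norm (D (z n s) - D (Y s)))\<^sup>2)"
      proof (rule integral_mono[OF _ Bochner_Integration.integrable_add[OF ci integrable_mult_right[OF C(2)]] ptw])
        show "integrable (Leb t) (\<lambda>s. \<bar>inner (D (z n s) - D (Y s)) (D \<phi>)\<bar>)"
          using Dzi1[OF t] DYi1[OF t] by auto
      qed
      also have "\<dots> = (1/2) ^ n * (norm (D \<phi>))\<^sup>2 * t + 2 ^ n * (LINT s|Leb t. (norm (D (z n s) - D (Y s)))\<^sup>2)"
        using ci C(2)[of n] t by (simp add: measure_Leb space_restrict_space)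
      also have "\<dots> \<le> (1/2) ^ n * (norm (D \<phi>))\<^sup>2 * t + 2 ^ n * (C * (1/4) ^ n)"
        by (intro add_left_mono mult_left_mono C) auto
      also have "(2::real) ^ n * (C * (1/4) ^ n) = C * (1/2) ^ n"
      proof -
        have "(2::real) ^ n * (1/4) ^ n = (1/2) ^ n" by (simp flip: power_mult_distrib)
        then show ?thesis by simp
      qed
      finally show ?thesis by (simp add: algebra_simps)
    qed
    have "(\<lambda>n. ((norm (D \<phi>))\<^sup>2 * t + C) * (1/2) ^ n) \<longlonglongrightarrow> ((norm (D \<phi>))\<^sup>2 * t + C) * 0"
      by (intro tendsto_mult tendsto_const half)
    then have e0: "?e \<longlonglongrightarrow> 0"
      by (intro Lim_null_comparison[OF always_eventually, of ?e]) (use e_bound in auto)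
    have eq: "inner (y n t) \<phi> = inner (init n) \<phi> + (LINT s|Leb t. inner (f s) \<phi> - inner (D (Y s)) (D \<phi>)) - ?e n" for n
    proof -
      have "(LINT s|Leb t. inner (f s) \<phi> - inner (D (z n s)) (D \<phi>)) =
        (LINT s|Leb t. (inner (f s) \<phi> - inner (D (Y s)) (D \<phi>)) - inner (D (z n s) - D (Y s)) (D \<phi>))"
        by (simp add: inner_diff_left)
      also have "\<dots> = (LINT s|Leb t. inner (f s) \<phi> - inner (D (Y s)) (D \<phi>)) - ?e n"
        using fi[of t] DYi1[OF t] Dzi1[OF t, of n]
        by (intro Bochner_Integration.integral_diff Bochner_Integration.integrable_diff integrable_inner_left) auto
      finally show ?thesis using weak[OF t p, of n] by simp
    qed
    have "(\<lambda>n. inner (y n t) \<phi>) \<longlonglongrightarrow> inner y0 \<phi> + (LINT s|Leb t. inner (f s) \<phi> - inner (D (Y s)) (D \<phi>)) - 0"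
      unfolding eq by (intro tendsto_intros init e0)
    moreover have "(\<lambda>n. inner (y n t) \<phi>) \<longlonglongrightarrow> inner (Y t) \<phi>" by (intro tendsto_intros lim[OF t])
    ultimately show "inner (Y t) \<phi> = inner y0 \<phi> + (LINT s|Leb t. inner (f s) \<phi> - inner (D (Y s)) (D \<phi>))"
      using LIMSEQ_unique by fastforce
  qed
  have "energy_ineq f y0 Y (\<lambda>s. D (Y s))"
    unfolding energy_ineq_def
  proof (intro allI impI)
    fix t :: real assume t: "0 \<le> t"
    obtain C where C: "C \<ge> 0" "\<And>m. integrable (Leb t) (\<lambda>s. (norm (D (z m s) - D (Y s)))\<^sup>2)"
      "\<And>m. (LINT s|Leb t. (norm (D (z m s) - D (Y s)))\<^sup>2) \<le> C * (1/4) ^ m" using hi[OF t] by blast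
    let ?N = "\<lambda>n. LINT s|Leb t. (norm (D (z n s)))\<^sup>2"
    define E where "E n = ((norm (init n))\<^sup>2 + 2 * (LINT s|Leb t. inner (y n s) (f s)) - (norm (y n t))\<^sup>2) / 2" for n
    have NE: "?N n \<le> E n" for n using energy[of n] t unfolding energy_ineq_def E_def by (simp add: field_simps)
    \<comment> \<open>The same weights: the factor tends to \<open>1\<close>, and the error term still tends to \<open>0\<close>.\<close>
    have le: "(LINT s|Leb t. (norm (D (Y s)))\<^sup>2) \<le> (1 + (1/2) ^ n) * E n + (1 + 2 ^ n) * (C * (1/4) ^ n)" for n
    proof -
      have ptw: "(norm b)\<^sup>2 \<le> (1 + (1/2) ^ n) * (norm a)\<^sup>2 + (1 + 2 ^ n) * (norm (a - b))\<^sup>2" for a b :: 'g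
      proof -
        have "norm b \<le> norm a + norm (a - b)" using norm_triangle_ineq4[of a "a - b"] by simp
        then have 1: "(norm b)\<^sup>2 \<le> (norm a + norm (a - b))\<^sup>2" by (intro power_mono) auto
        have "0 \<le> 2 ^ n * ((1/2) ^ n * norm a - norm (a - b))\<^sup>2" by simp
        also have "\<dots> = (2 ^ n * (1/2) ^ n) * ((1/2) ^ n * (norm a)\<^sup>2) - 2 * (2 ^ n * (1/2) ^ n) * (norm a * norm (a - b)) + 2 ^ n * (norm (a - b))\<^sup>2"
          by (simp add: power2_eq_square algebra_simps)
        also have "(2::real) ^ n * (1/2) ^ n = 1" by (simp flip: power_mult_distrib)
        finally show ?thesis using 1 by (simp add: power2_sum algebra_simps)
      qed
      have "(LINT s|Leb t. (norm (D (Y s)))\<^sup>2) \<le> (LINT s|Leb t. (1 + (1/2) ^ n) * (norm (D (z n s)))\<^sup>2 + (1 + 2 ^ n) * (norm (D (z n s) - D (Y s)))\<^sup>2)"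
        using DYi[OF t] Di[OF t, of n] C(2)[of n] ptw by (intro integral_mono) auto
      also have "\<dots> = (1 + (1/2) ^ n) * ?N n + (1 + 2 ^ n) * (LINT s|Leb t. (norm (D (z n s) - D (Y s)))\<^sup>2)"
        using Di[OF t, of n] C(2)[of n] by simp
      also have "\<dots> \<le> (1 + (1/2) ^ n) * E n + (1 + 2 ^ n) * (C * (1/4) ^ n)"
        by (intro add_mono mult_left_mono NE C) (auto intro!: add_nonneg_nonneg)
      finally show ?thesis .
    qed
    have "(\<lambda>n. LINT s|Leb t. inner (y n s) (f s)) \<longlonglongrightarrow> (LINT s|Leb t. inner (Y s) (f s))"
    proof -
      obtain C' where C': "C' \<ge> 0" "\<And>n s. s \<in> {0..t} \<Longrightarrow> (norm (y 0 s - y n s))\<^sup>2 \<le> C' * (1/4) ^ 0"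
        using rate[OF t] by (metis le0)
      have "compact (y 0 ` {0..t})"
        by (intro compact_continuous_image continuous_on_subset[OF yc]) auto
      then obtain B where B: "\<And>s. s \<in> {0..t} \<Longrightarrow> norm (y 0 s) \<le> B"
        using compact_imp_bounded bounded_iff by (metis (no_types, lifting) imageI)
      have yb: "norm (y n s) \<le> B + sqrt C'" if "s \<in> {0..t}" for n s
      proof -
        have "norm (y 0 s - y n s) \<le> sqrt C'" using Cbound[OF C'(2)[OF that] C'(1)] by simp
        then show ?thesis using B[OF that] norm_triangle_ineq4[of "y 0 s" "y 0 s - y n s"] by simp
      qed
      show ?thesis
      proof (rule integral_dominated_convergence)
        show "(\<lambda>s. inner (Y s) (f s)) \<in> borel_measurable (Leb t)"
          by (intro borel_measurable_inner fmL measurable_Leb_continuous[OF Yc]) auto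
        show "(\<lambda>s. inner (y n s) (f s)) \<in> borel_measurable (Leb t)" for n
          using fmL[of t] ymL[of n t] by (intro borel_measurable_inner) auto
        show "integrable (Leb t) (\<lambda>s. (B + sqrt C') * M)"
          by (rule finite_measure.integrable_const[OF finite_measure_Leb])
        show "AE s in Leb t. (\<lambda>n. inner (y n s) (f s)) \<longlonglongrightarrow> inner (Y s) (f s)"
          by (rule AE_I2, intro tendsto_intros lim) (auto simp: space_restrict_space)
        show "AE s in Leb t. norm (inner (y n s) (f s)) \<le> (B + sqrt C') * M" for n
        proof (rule AE_I2)
          fix s assume "s \<in> space (Leb t)"
          then have s: "s \<in> {0..t}" by (auto simp: space_restrict_space)
          have "norm (inner (y n s) (f s)) \<le> norm (y n s) * norm (f s)" using Cauchy_Schwarz_ineq2 by auto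
          also have "\<dots> \<le> (B + sqrt C') * M"
            using yb[OF s, of n] fM[of s] norm_ge_zero[of "y n s"] by (intro mult_mono) (linarith | simp)+
          finally show "norm (inner (y n s) (f s)) \<le> (B + sqrt C') * M" .
        qed
      qed
    qed
    then have E_lim: "E \<longlonglongrightarrow> ((norm y0)\<^sup>2 + 2 * (LINT s|Leb t. inner (Y s) (f s)) - (norm (Y t))\<^sup>2) / 2"
      unfolding E_def by (intro tendsto_intros init lim t) auto
    have quart: "(\<lambda>n. C * (1/4 :: real) ^ n + C * (1/2) ^ n) \<longlonglongrightarrow> C * 0 + C * 0"
      by (intro tendsto_intros half LIMSEQ_power_zero) simp
    have "(\<lambda>n. (1 + (1/2) ^ n) * E n + (C * (1/4) ^ n + C * (1/2) ^ n)) \<longlonglongrightarrow>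
        (1 + 0) * (((norm y0)\<^sup>2 + 2 * (LINT s|Leb t. inner (Y s) (f s)) - (norm (Y t))\<^sup>2) / 2) + (C * 0 + C * 0)"
      by (intro tendsto_add tendsto_mult tendsto_const half E_lim quart)
    moreover have "(1 + 2 ^ n) * (C * (1/4 :: real) ^ n) = C * (1/4) ^ n + C * (1/2) ^ n" for n
    proof -
      have "(2::real) ^ n * (1/4) ^ n = (1/2) ^ n" by (simp flip: power_mult_distrib)
      then show ?thesis by (simp add: distrib_right)
    qed
    ultimately have "(\<lambda>n. (1 + (1/2) ^ n) * E n + (1 + 2 ^ n) * (C * (1/4) ^ n)) \<longlonglongrightarrow>
        ((norm y0)\<^sup>2 + 2 * (LINT s|Leb t. inner (Y s) (f s)) - (norm (Y t))\<^sup>2) / 2" by simp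
    then have "(LINT s|Leb t. (norm (D (Y s)))\<^sup>2) \<le> ((norm y0)\<^sup>2 + 2 * (LINT s|Leb t. inner (Y s) (f s)) - (norm (Y t))\<^sup>2) / 2"
      by (rule LIMSEQ_le_const) (use le in blast)
    then show "(norm (Y t))\<^sup>2 + 2 * (LINT s|Leb t. (norm (D (Y s)))\<^sup>2) \<le> (norm y0)\<^sup>2 + 2 * (LINT s|Leb t. inner (Y s) (f s))"
      by simp
  qed
  with sol show ?thesis by blast
qed

text \<open>
  Yosida approximations with parameters \<open>(1/4) ^ n\<close>, the rate that the limit lemma asks for.
\<close>

lemma weak_sol_exists_regular:
  assumes y0: "y0 \<in> V"
  shows "\<exists>y. weak_sol {0..} y0 f y \<and> energy_ineq f y0 y (\<lambda>s. D (y s))"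
proof -
  define l where "l n = (1/4 :: real) ^ n" for n :: nat
  have l: "0 < l n" "l n \<le> 1" for n by (auto simp: l_def power_le_one)
  have l_mono: "l n \<le> l m" if "m \<le> n" for m n
    unfolding l_def using that by (intro power_decreasing) auto
  have "\<exists>y. yosida_sol (l n) y0 f y" for n by (rule yosida_sol_exists[OF f fM l(1)])
  then obtain y where y: "\<And>n. yosida_sol (l n) y0 f (y n)" by metis
  define z where "z n s = resolvent (l n) (y n s)" for n s
  have yc: "continuous_on UNIV (y n)" for n by (rule yosida_sol_continuous[OF f fM l(1) y])
  have zc: "continuous_on UNIV (z n)" for n
    unfolding z_def by (intro bounded_linear.continuous_on[OF bounded_linear_resolvent[OF l(1)]] yc)
  have Dc: "continuous_on UNIV (\<lambda>s. D (z n s))" for n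
    unfolding z_def by (rule yosida_sol_D_continuous[OF f fM l(1) y])
  have meas: "g \<in> borel_measurable (lebesgue_on {0..})"
    if "continuous_on UNIV g" for g :: "real \<Rightarrow> 'b::{metric_space, second_countable_topology}"
  proof -
    have "g \<in> borel_measurable borel" using that by (rule borel_measurable_continuous_onI)
    then have "g \<in> borel_measurable lebesgue" by (simp add: measurable_completion)
    then show ?thesis by (rule measurable_restrict_space1)
  qed
  show ?thesis
  proof (rule weak_sol_limit[where y = y and z = z and init = "\<lambda>_. y0"])
    show "continuous_on {0..} (y n)" for n using continuous_on_subset[OF yc] by auto
    show "y n 0 = y0" for n by (rule yosida_sol_zero[OF f fM l(1) y])
    show "(\<lambda>_. y0) \<longlonglongrightarrow> y0" by simp
    show "AE t in lebesgue_on {0..}. z n t \<in> V" for n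
      by (rule AE_I2) (simp add: z_def resolvent_in_V l)
    show "z n \<in> borel_measurable (lebesgue_on {0..})" for n by (rule meas[OF zc])
    show "(\<lambda>t. D (z n t)) \<in> borel_measurable (lebesgue_on {0..})" for n by (rule meas[OF Dc])
    show "integrable (Leb t) (\<lambda>s. (norm (D (z n s)))\<^sup>2)" for n t
      by (intro integrable_Leb_continuous continuous_intros Dc)
    show "inner (y n t) \<phi> = inner y0 \<phi> + (LINT s|Leb t. inner (f s) \<phi> - inner (D (z n s)) (D \<phi>))"
      if "0 \<le> t" "\<phi> \<in> V" for n t \<phi>
      unfolding z_def by (rule yosida_sol_weak[OF f fM l(1) y that])
    show "energy_ineq f y0 (y n) (\<lambda>s. D (z n s))" for n
      unfolding energy_ineq_def z_def using yosida_sol_energy[OF f fM l(1) y] by blast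
    fix T :: real assume T: "0 \<le> T"
    define K where "K = (norm (D y0))\<^sup>2 + M\<^sup>2 * T"
    have K: "0 \<le> K" using T by (simp add: K_def)
    have diff: "(norm (y m s - y n s))\<^sup>2 + 2 * (LINT r|Leb s. (norm (D (z m r) - D (z n r)))\<^sup>2) \<le> 8 * K * (1/4) ^ m"
      if "m \<le> n" "0 \<le> s" "s \<le> T" for m n s
    proof -
      have "(norm (y m s - y n s))\<^sup>2 + 2 * (LINT r|Leb s. (norm (D (z m r) - D (z n r)))\<^sup>2)
          \<le> 8 * l m * ((norm (D y0))\<^sup>2 + M\<^sup>2 * s)"
        unfolding z_def by (rule yosida_sol_difference[OF f fM l(1) l(1) l_mono[OF that(1)] y0 y y that(2)])
      also have "\<dots> \<le> 8 * l m * K"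
        unfolding K_def using that l(1)[of m] by (intro mult_left_mono add_left_mono) auto
      finally show ?thesis by (simp add: l_def mult_ac)
    qed
    show "\<exists>C\<ge>0. \<forall>m n. m \<le> n \<longrightarrow>
        (\<forall>s\<in>{0..T}. (norm (y m s - y n s))\<^sup>2 \<le> C * (1/4) ^ m) \<and>
        (\<integral>\<^sup>+s. ennreal ((norm (D (z m s) - D (z n s)))\<^sup>2) \<partial>Leb T) \<le> ennreal (C * (1/4) ^ m) \<and>
        (\<integral>\<^sup>+s. ennreal ((norm (y m s - z m s))\<^sup>2) \<partial>Leb T) \<le> ennreal (C * (1/4) ^ m)"
    proof (intro exI[of _ "8 * K"] conjI allI impI ballI)
      show "0 \<le> 8 * K" using K by simp
      fix m n :: nat assume mn: "m \<le> n"
      show "(norm (y m s - y n s))\<^sup>2 \<le> 8 * K * (1/4) ^ m" if "s \<in> {0..T}" for s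
      proof -
        have "0 \<le> (LINT r|Leb s. (norm (D (z m r) - D (z n r)))\<^sup>2)" by simp
        moreover have "0 \<le> s" "s \<le> T" using that by auto
        ultimately show ?thesis using diff[OF mn, of s] by linarith
      qed
      have "integrable (Leb T) (\<lambda>s. (norm (D (z m s) - D (z n s)))\<^sup>2)"
        by (intro integrable_Leb_continuous continuous_intros Dc)
      then have "(\<integral>\<^sup>+s. ennreal ((norm (D (z m s) - D (z n s)))\<^sup>2) \<partial>Leb T) = ennreal (LINT s|Leb T. (norm (D (z m s) - D (z n s)))\<^sup>2)"
        by (rule nn_integral_eq_integral) simp
      also have "\<dots> \<le> ennreal (8 * K * (1/4) ^ m)"
      proof (rule ennreal_leI)
        have "0 \<le> (LINT s|Leb T. (norm (D (z m s) - D (z n s)))\<^sup>2)" by simp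
        then show "(LINT s|Leb T. (norm (D (z m s) - D (z n s)))\<^sup>2) \<le> 8 * K * (1/4) ^ m"
          using diff[OF mn T order_refl] zero_le_power2[of "norm (y m T - y n T)"] by linarith
      qed
      finally show "(\<integral>\<^sup>+s. ennreal ((norm (D (z m s) - D (z n s)))\<^sup>2) \<partial>Leb T) \<le> ennreal (8 * K * (1/4) ^ m)" .
      have "(norm (y m s - z m s))\<^sup>2 = (l m)\<^sup>2 * (norm (yosida (l m) (y m s)))\<^sup>2" for s
      proof -
        have "y m s - z m s = l m *\<^sub>R yosida (l m) (y m s)"
          using resolvent_plus_yosida[OF l(1)[of m], of "y m s"] unfolding z_def by (simp add: algebra_simps)
        then show ?thesis by (simp add: power_mult_distrib)
      qed
      moreover have i: "integrable (Leb T) (\<lambda>s. (l m)\<^sup>2 * (norm (yosida (l m) (y m s)))\<^sup>2)"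
        by (intro integrable_Leb_continuous continuous_intros yosida_sol_yosida_continuous[OF f fM l(1) y])
      ultimately have "(\<integral>\<^sup>+s. ennreal ((norm (y m s - z m s))\<^sup>2) \<partial>Leb T) = ennreal (LINT s|Leb T. (l m)\<^sup>2 * (norm (yosida (l m) (y m s)))\<^sup>2)"
        by (simp add: nn_integral_eq_integral[OF i])
      also have "\<dots> \<le> ennreal (8 * K * (1/4) ^ m)"
      proof (rule ennreal_leI)
        have "(LINT s|Leb T. (l m)\<^sup>2 * (norm (yosida (l m) (y m s)))\<^sup>2) = (l m)\<^sup>2 * (LINT s|Leb T. (norm (yosida (l m) (y m s)))\<^sup>2)"
          by simp
        also have "\<dots> \<le> (l m)\<^sup>2 * K"
          unfolding K_def by (intro mult_left_mono yosida_sol_bound[OF f fM l(1) y T y0]) simp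
        also have "\<dots> \<le> l m * K"
          using l[of m] K by (intro mult_right_mono) (auto simp: power2_eq_square mult_left_le)
        also have "\<dots> \<le> 8 * K * (1/4) ^ m" using K by (simp add: l_def)
        finally show "(LINT s|Leb T. (l m)\<^sup>2 * (norm (yosida (l m) (y m s)))\<^sup>2) \<le> 8 * K * (1/4) ^ m" .
      qed
      finally show "(\<integral>\<^sup>+s. ennreal ((norm (y m s - z m s))\<^sup>2) \<partial>Leb T) \<le> ennreal (8 * K * (1/4) ^ m)" .
    qed
  qed
qed

end

text \<open>
  Approximation of the initial value needs that \<open>D\<close> of a difference of solutions is controlled by the
  difference of their initial values.
\<close>

lemma weak_sol_dissipative:
  assumes y0: "y0 \<in> V" and y: "weak_sol {0..} y0 (\<lambda>_. 0) y" and t: "0 \<le> t"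
  shows "(norm (y t))\<^sup>2 + 2 * (LINT s|Leb t. (norm (D (y s)))\<^sup>2) \<le> (norm y0)\<^sup>2"
proof -
  have m: "(\<lambda>_. 0 :: 'h) \<in> borel_measurable lebesgue" and b: "\<And>s::real. norm (0 :: 'h) \<le> 0" by simp_all
  obtain z where z: "weak_sol {0..} y0 (\<lambda>_. 0) z" and e: "energy_ineq (\<lambda>_. 0) y0 z (\<lambda>s. D (z s))"
    using weak_sol_exists_regular[OF m b y0] by auto
  have eq: "y s = z s" if "0 \<le> s" for s
    using weak_sol_unique[OF time_domain_halfline y z] that by simp
  have "(LINT s|Leb t. (norm (D (y s)))\<^sup>2) = (LINT s|Leb t. (norm (D (z s)))\<^sup>2)"
    by (rule Bochner_Integration.integral_cong) (auto simp: eq space_restrict_space)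
  then show ?thesis using e t by (simp add: energy_ineq_def eq)
qed

text \<open>
  Initial values in the closure of \<open>V\<close> are approximated by elements of \<open>V\<close>; the differences of the
  corresponding solutions solve the equation without source, and dissipativity gives the rate.
\<close>

lemma weak_sol_exists:
  assumes f: "f \<in> borel_measurable lebesgue" and fM: "\<And>s. norm (f s) \<le> M" and y0: "y0 \<in> closure V"
  obtains y where "weak_sol {0..} y0 f y" and "energy_ineq f y0 y (\<lambda>s. D (y s))"
proof -
  have fi: "integrable (Leb t) f" for t by (rule integrable_Leb_bounded_lebesgue[OF f fM])
  have "\<exists>v\<in>V. dist v y0 < (1/2) ^ Suc n" for n
    using y0[unfolded closure_approachable, rule_format, of "(1/2) ^ Suc n"] by simp
  then obtain Y0 where Y0: "\<And>n. Y0 n \<in> V" "\<And>n. dist (Y0 n) y0 < (1/2) ^ Suc n" by metis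
  have Y0_lim: "Y0 \<longlonglongrightarrow> y0"
  proof -
    have "(\<lambda>n. (1/2 :: real) ^ Suc n) \<longlonglongrightarrow> 0" by (rule LIMSEQ_Suc, rule LIMSEQ_power_zero) simp
    moreover have "norm (Y0 n - y0) \<le> (1/2) ^ Suc n" for n using Y0(2)[of n] by (simp add: dist_norm)
    ultimately have "(\<lambda>n. Y0 n - y0) \<longlonglongrightarrow> 0" by (rule Lim_null_comparison[OF always_eventually[OF allI], rotated])
    then show ?thesis by (simp add: LIM_zero_iff)
  qed
  obtain y where y: "\<And>n. weak_sol {0..} (Y0 n) f (y n)" and en: "\<And>n. energy_ineq f (Y0 n) (y n) (\<lambda>s. D (y n s))"
    using weak_sol_exists_regular[OF f fM Y0(1)] by metis
  have "\<exists>y. weak_sol {0..} y0 f y \<and> energy_ineq f y0 y (\<lambda>s. D (y s))"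
  proof (rule weak_sol_limit[OF f fM, where y = y and z = y and init = Y0])
    show "y n \<in> borel_measurable (lebesgue_on {0..})" for n
      by (rule measurable_mono[THEN subsetD, rotated -1, OF borel_measurable_continuous_on_restrict[OF weak_solD(1)[OF y]]])
         (auto simp: sets_restrict_space space_restrict_space)
    show "integrable (Leb t) (\<lambda>s. (norm (D (y n s)))\<^sup>2)" if "0 \<le> t" for n t
      by (rule weak_solD(5)[OF y]) (use that in simp)
    show "inner (y n t) \<phi> = inner (Y0 n) \<phi> + (LINT s|Leb t. inner (f s) \<phi> - inner (D (y n s)) (D \<phi>))"
      if "0 \<le> t" "\<phi> \<in> V" for n t \<phi>
      by (rule weak_solD(6)[OF y]) (use that in simp_all)
    fix T :: real assume T: "0 \<le> T"
    have diff: "(norm (y m s - y n s))\<^sup>2 + 2 * (LINT r|Leb s. (norm (D (y m r) - D (y n r)))\<^sup>2) \<le> 1 * (1/4) ^ m"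
      and int: "integrable (Leb s) (\<lambda>r. (norm (D (y m r) - D (y n r)))\<^sup>2)"
      if "m \<le> n" "0 \<le> s" for m n s
    proof -
      note lc = weak_sol_linear_combination[OF time_domain_halfline y y fi fi, of 1 m "-1" n]
      have w: "weak_sol {0..} (Y0 m - Y0 n) (\<lambda>_. 0) (\<lambda>r. y m r - y n r)"
        using lc(1) by simp
      have ae: "AE r in Leb s. D (y m r - y n r) = D (y m r) - D (y n r)"
        by (rule AE_Leb_time_domain[OF time_domain_halfline]) (use lc(2) that in simp_all)
      have mm: "(\<lambda>r. D (y n r)) \<in> borel_measurable (Leb s)" for n
        by (rule measurable_Leb_restrict[OF weak_solD(4)[OF y]]) auto
      have m1: "(\<lambda>r. (norm (D (y m r) - D (y n r)))\<^sup>2) \<in> borel_measurable (Leb s)" using mm[of m] mm[of n] by measurable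
      have i1: "integrable (Leb s) (\<lambda>r. (norm (D (y m r - y n r)))\<^sup>2)"
        using weak_solD(5)[OF w, of s] that by simp
      have ae': "AE r in Leb s. (norm (D (y m r) - D (y n r)))\<^sup>2 = (norm (D (y m r - y n r)))\<^sup>2"
        using ae by eventually_elim simp
      show "integrable (Leb s) (\<lambda>r. (norm (D (y m r) - D (y n r)))\<^sup>2)"
        using i1 integrable_cong_AE[OF m1 _ ae'] by auto
      have "(LINT r|Leb s. (norm (D (y m r) - D (y n r)))\<^sup>2) = (LINT r|Leb s. (norm (D (y m r - y n r)))\<^sup>2)"
        using i1 by (intro integral_cong_AE[OF m1 _ ae']) auto
      then have "(norm (y m s - y n s))\<^sup>2 + 2 * (LINT r|Leb s. (norm (D (y m r) - D (y n r)))\<^sup>2) \<le> (norm (Y0 m - Y0 n))\<^sup>2"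
        using weak_sol_dissipative[OF V_diff[OF Y0(1) Y0(1)] w that(2)] by simp
      also have "\<dots> \<le> ((1/2) ^ m)\<^sup>2"
      proof (rule power_mono)
        have "dist (Y0 m) (Y0 n) \<le> dist (Y0 m) y0 + dist (Y0 n) y0" by (rule dist_triangle2)
        also have "\<dots> \<le> (1/2) ^ Suc m + (1/2) ^ Suc n" using Y0(2)[of m] Y0(2)[of n] by simp
        also have "\<dots> \<le> (1/2) ^ Suc m + (1/2) ^ Suc m" using that(1) by (intro add_left_mono power_decreasing) auto
        finally show "norm (Y0 m - Y0 n) \<le> (1/2) ^ m" by (simp add: dist_norm)
      qed simp
      also have "\<dots> = 1 * (1/4) ^ m" by (simp add: power2_eq_square flip: power_mult_distrib)
      finally show "(norm (y m s - y n s))\<^sup>2 + 2 * (LINT r|Leb s. (norm (D (y m r) - D (y n r)))\<^sup>2) \<le> 1 * (1/4) ^ m" .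
    qed
    show "\<exists>C\<ge>0. \<forall>m n. m \<le> n \<longrightarrow>
        (\<forall>s\<in>{0..T}. (norm (y m s - y n s))\<^sup>2 \<le> C * (1/4) ^ m) \<and>
        (\<integral>\<^sup>+s. ennreal ((norm (D (y m s) - D (y n s)))\<^sup>2) \<partial>Leb T) \<le> ennreal (C * (1/4) ^ m) \<and>
        (\<integral>\<^sup>+s. ennreal ((norm (y m s - y m s))\<^sup>2) \<partial>Leb T) \<le> ennreal (C * (1/4) ^ m)"
    proof (intro exI[of _ 1] conjI allI impI ballI)
      fix m n :: nat assume mn: "m \<le> n"
      have nn: "0 \<le> (LINT r|Leb s. (norm (D (y m r) - D (y n r)))\<^sup>2)" for s by simp
      show "(norm (y m s - y n s))\<^sup>2 \<le> 1 * (1/4) ^ m" if "s \<in> {0..T}" for s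
      proof -
        have "0 \<le> s" using that by simp
        then show ?thesis using diff(1)[OF mn, of s] nn[of s] by linarith
      qed
      have "(\<integral>\<^sup>+s. ennreal ((norm (D (y m s) - D (y n s)))\<^sup>2) \<partial>Leb T) = ennreal (LINT s|Leb T. (norm (D (y m s) - D (y n s)))\<^sup>2)"
        by (rule nn_integral_eq_integral[OF int[OF mn T]]) simp
      also have "\<dots> \<le> ennreal (1 * (1/4) ^ m)"
        using diff(1)[OF mn T] zero_le_power2[of "norm (y m T - y n T)"] nn[of T] by (intro ennreal_leI) linarith
      finally show "(\<integral>\<^sup>+s. ennreal ((norm (D (y m s) - D (y n s)))\<^sup>2) \<partial>Leb T) \<le> ennreal (1 * (1/4) ^ m)" .
    qed simp_all
  qed (use weak_solD[OF y] Y0_lim en in blast)+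
  then show ?thesis using that by blast
qed

text \<open>
  Evaluate the energy inequality at a time \<open>r\<close> where \<open>\<bar>y\<bar>\<close> attains its maximum \<open>m\<close> over \<open>{0..t}\<close>: it
  gives \<open>m\<^sup>2 \<le> \<bar>y0\<bar>\<^sup>2 + 2 m \<integral>\<bar>f\<bar>\<close>. Only the \<open>L\<^sup>1\<close> norm of the source enters, so almost everywhere
  convergence of bounded controls implies convergence of the final states.
\<close>

lemma norm_weak_sol_le:
  assumes f: "f \<in> borel_measurable lebesgue" and fM: "\<And>s. norm (f s) \<le> M"
    and y: "weak_sol {0..} y0 f y" and en: "energy_ineq f y0 y (\<lambda>s. D (y s))" and t: "0 \<le> t"
  shows "norm (y t) \<le> norm y0 + 2 * (LINT s|Leb t. norm (f s))"
proof -
  define F where "F = (LINT s|Leb t. norm (f s))"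
  have F0: "0 \<le> F" unfolding F_def by simp
  have fi: "integrable (Leb s) f" for s by (rule integrable_Leb_bounded_lebesgue[OF f fM])
  have yc: "continuous_on {0..t} y" by (rule continuous_on_subset[OF weak_solD(1)[OF y]]) auto
  then have "continuous_on {0..t} (\<lambda>s. norm (y s))" by (intro continuous_intros)
  then obtain r where r: "r \<in> {0..t}" and rmax: "\<And>s. s \<in> {0..t} \<Longrightarrow> norm (y s) \<le> norm (y r)"
    using continuous_attains_sup[of "{0..t}" "\<lambda>s. norm (y s)"] t by auto
  define m where "m = norm (y r)"
  have "m \<le> norm y0 + 2 * F"
  proof (cases "m \<le> norm y0")
    case True then show ?thesis using F0 by simp
  next
    case False
    then have m0: "m > 0" using norm_ge_zero[of y0] by linarith
    have my: "y \<in> borel_measurable (Leb r)"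
      by (rule measurable_Leb_continuous[OF weak_solD(1)[OF y]]) auto
    have ii: "integrable (Leb r) (\<lambda>s. inner (y s) (f s))"
    proof (rule Bochner_Integration.integrable_bound[OF integrable_mult_right[OF integrable_norm[OF fi[of r]], of m]])
      show "(\<lambda>s. inner (y s) (f s)) \<in> borel_measurable (Leb r)"
        using my measurable_Leb_lebesgue[OF f] by (intro borel_measurable_inner)
      show "AE s in Leb r. norm (inner (y s) (f s)) \<le> norm (m * norm (f s))"
      proof (rule AE_I2)
        fix s assume "s \<in> space (Leb r)"
        then have "s \<in> {0..t}" using r by (auto simp: space_restrict_space)
        then have "norm (y s) * norm (f s) \<le> m * norm (f s)" unfolding m_def by (intro mult_right_mono rmax) auto
        then show "norm (inner (y s) (f s)) \<le> norm (m * norm (f s))"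
          using Cauchy_Schwarz_ineq2[of "y s" "f s"] m0 by simp
      qed
    qed
    have fr: "(LINT s|Leb r. norm (f s)) \<le> F"
    proof -
      have "(LINT s|Leb r. norm (f s)) = (LINT s|Leb t. indicator {0<..<r} s *\<^sub>R norm (f s))"
        using r by (intro integral_Leb_as_indicator) auto
      also have "\<dots> \<le> F" unfolding F_def
        using fi[of t] r by (intro integral_mono integrable_mult_indicator interval_in_sets_Leb integrable_norm)
          (auto simp: indicator_def)
      finally show ?thesis .
    qed
    have "0 \<le> (LINT s|Leb r. (norm (D (y s)))\<^sup>2)" by simp
    moreover have "m\<^sup>2 + 2 * (LINT s|Leb r. (norm (D (y s)))\<^sup>2) \<le> (norm y0)\<^sup>2 + 2 * (LINT s|Leb r. inner (y s) (f s))"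
      using en r unfolding energy_ineq_def m_def by simp
    ultimately have "m\<^sup>2 \<le> (norm y0)\<^sup>2 + 2 * (LINT s|Leb r. inner (y s) (f s))" by linarith
    also have "(LINT s|Leb r. inner (y s) (f s)) \<le> (LINT s|Leb r. m * norm (f s))"
    proof (rule integral_mono[OF ii])
      show "integrable (Leb r) (\<lambda>s. m * norm (f s))" using fi by auto
      fix s assume "s \<in> space (Leb r)"
      then have "s \<in> {0..t}" using r by (auto simp: space_restrict_space)
      then have "norm (y s) * norm (f s) \<le> m * norm (f s)" unfolding m_def by (intro mult_right_mono rmax) auto
      then show "inner (y s) (f s) \<le> m * norm (f s)" using norm_cauchy_schwarz[of "y s" "f s"] by linarith
    qed
    also have "\<dots> = m * (LINT s|Leb r. norm (f s))" by simp
    also have "\<dots> \<le> m * F" using fr m0 by (intro mult_left_mono) auto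
    also have "(norm y0)\<^sup>2 \<le> m * norm y0" unfolding power2_eq_square using False by (intro mult_right_mono) auto
    finally have "m * m \<le> m * (norm y0 + 2 * F)" by (simp add: power2_eq_square distrib_left)
    then show ?thesis using m0 by simp
  qed
  moreover have "norm (y t) \<le> m" unfolding m_def using rmax[of t] t by simp
  ultimately show ?thesis by (simp add: F_def)
qed

lemma weak_sol_stability:
  assumes f: "f \<in> borel_measurable lebesgue" and fM: "\<And>s. norm (f s) \<le> M"
    and g: "g \<in> borel_measurable lebesgue" and gM: "\<And>s. norm (g s) \<le> M"
    and y: "weak_sol {0..} y0 f y" and z: "weak_sol {0..} y0 g z" and t: "0 \<le> t"
  shows "norm (y t - z t) \<le> 2 * (LINT s|Leb t. norm (f s - g s))"
proof -
  have m: "(\<lambda>s. f s - g s) \<in> borel_measurable lebesgue" using f g by (rule borel_measurable_diff)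
  have b: "norm (f s - g s) \<le> M + M" for s
    using norm_triangle_ineq4[of "f s" "g s"] fM[of s] gM[of s] by linarith
  have "0 \<in> closure V" using V_zero closure_subset by blast
  then obtain w where w: "weak_sol {0..} 0 (\<lambda>s. f s - g s) w" and en: "energy_ineq (\<lambda>s. f s - g s) 0 w (\<lambda>s. D (w s))"
    using weak_sol_exists[OF m b] by blast
  have "weak_sol {0..} 0 (\<lambda>s. f s - g s) (\<lambda>s. y s - z s)"
    using weak_sol_linear_combination(1)[OF time_domain_halfline y z integrable_Leb_bounded_lebesgue[OF f fM] integrable_Leb_bounded_lebesgue[OF g gM], of 1 "-1"]
    by simp
  from weak_sol_unique[OF time_domain_halfline this w integrable_Leb_bounded_lebesgue[OF m b], of t]
  have "y t - z t = w t" using t by simp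
  then show ?thesis using norm_weak_sol_le[OF m b w en t] by simp
qed

end

section \<open>Smooth bump functions\<close>

lemma Ck_Suc_imp: "Ck (Suc k) f \<Longrightarrow> Ck k f"
proof (induction k arbitrary: f)
  case 0
  then have "\<And>x. f differentiable (at x)" by simp
  then show ?case by (auto intro!: continuous_at_imp_continuous_on differentiable_imp_continuous_within)
next
  case (Suc k)
  then show ?case by simp
qed

lemma Ck_continuous: "Ck k f \<Longrightarrow> continuous_on UNIV f"
proof (induction k)
  case (Suc k)
  then show ?case using Ck_Suc_imp[OF Suc.prems] by simp
qed simp

lemma partial_eqI: "(f has_derivative D) (at x) \<Longrightarrow> partial e f x = D e"
  unfolding partial_def by (simp add: frechet_derivative_at[symmetric])

lemma has_derivative_frechet: "f differentiable (at x) \<Longrightarrow> (f has_derivative frechet_derivative f (at x)) (at x)"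
  by (simp add: frechet_derivative_works)

lemma partial_add:
  "(\<And>x. f differentiable (at x)) \<Longrightarrow> (\<And>x. g differentiable (at x)) \<Longrightarrow>
    partial e (\<lambda>x. f x + g x) = (\<lambda>x. partial e f x + partial e g x)"
  by (rule ext, subst partial_eqI[OF has_derivative_add[OF has_derivative_frechet has_derivative_frechet]])
     (auto simp: partial_def)

lemma partial_scale:
  "(\<And>x. f differentiable (at x)) \<Longrightarrow> partial e (\<lambda>x. c * f x) = (\<lambda>x. c * partial e f x)"
  by (rule ext, subst partial_eqI[OF has_derivative_mult_right[OF has_derivative_frechet]])
     (auto simp: partial_def)

lemma partial_mult:
  "(\<And>x. f differentiable (at x)) \<Longrightarrow> (\<And>x. g differentiable (at x)) \<Longrightarrow>
    partial e (\<lambda>x. f x * g x) = (\<lambda>x. f x * partial e g x + partial e f x * g x)"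
  by (rule ext, subst partial_eqI[OF has_derivative_mult[OF has_derivative_frechet has_derivative_frechet]])
     (auto simp: partial_def)

lemma partial_const: "partial e (\<lambda>x. c) = (\<lambda>x. 0)"
  by (rule ext, subst partial_eqI[OF has_derivative_const]) auto

lemma Ck_const: "Ck k (\<lambda>x. c)"
  by (induction k arbitrary: c) (auto simp: partial_const)

lemma Ck_add: "Ck k f \<Longrightarrow> Ck k g \<Longrightarrow> Ck k (\<lambda>x. f x + g x)"
  by (induction k arbitrary: f g) (auto simp: partial_add intro: continuous_on_add)

lemma Ck_scale: "Ck k f \<Longrightarrow> Ck k (\<lambda>x. c * f x)"
  by (induction k arbitrary: f) (auto simp: partial_scale intro: continuous_on_mult_left)

lemma Ck_mult: "Ck k f \<Longrightarrow> Ck k g \<Longrightarrow> Ck k (\<lambda>x. f x * g x)"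
proof (induction k arbitrary: f g)
  case 0
  then show ?case by (auto intro: continuous_on_mult)
next
  case (Suc k)
  have "Ck k f" "Ck k g" using Suc.prems Ck_Suc_imp by blast+
  then show ?case
    using Suc by (auto simp: partial_mult intro!: Ck_add differentiable_mult)
qed

lemma Ck_prod: "finite I \<Longrightarrow> (\<And>i. i \<in> I \<Longrightarrow> Ck k (f i)) \<Longrightarrow> Ck k (\<lambda>x. \<Prod>i\<in>I. f i x)"
  by (induction I rule: finite_induct) (auto intro: Ck_const Ck_mult)

text \<open>
  The function \<open>exp (- 1 / t)\<close>, continued by zero, together with its quotients by powers of \<open>t\<close>: the
  span of this family is closed under differentiation, which gives smoothness by induction.
\<close>

definition exp_flat :: "nat \<Rightarrow> real \<Rightarrow> real" where
  "exp_flat n t = (if 0 < t then exp (- (1 / t)) / t ^ n else 0)"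

lemma power_over_fact_le_exp:
  fixes x :: real
  assumes "0 \<le> x"
  shows "x ^ m / fact m \<le> exp x"
proof -
  have "(\<Sum>n\<in>{m}. x ^ n /\<^sub>R fact n) \<le> (\<Sum>n. x ^ n /\<^sub>R fact n)"
    by (rule sum_le_suminf[OF summable_exp_generic]) (use assms in auto)
  then show ?thesis by (simp add: exp_def divide_inverse mult.commute)
qed

text \<open>
  Quadratic decay at \<open>0\<close> is enough to see that the derivative there vanishes.
\<close>

lemma exp_flat_bound: "\<bar>exp_flat n t\<bar> \<le> fact (n + 2) * t\<^sup>2"
proof (cases "0 < t")
  case True
  have "(1 / t) ^ (n + 2) / fact (n + 2) \<le> exp (1 / t)"
    using True by (intro power_over_fact_le_exp) simp
  then have "1 \<le> exp (1 / t) * (fact (n + 2) * t ^ (n + 2))"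
    using True by (simp add: field_simps del: fact_Suc)
  then have "exp (- (1 / t)) * 1 \<le> exp (- (1 / t)) * (exp (1 / t) * (fact (n + 2) * t ^ (n + 2)))"
    by (intro mult_left_mono) auto
  also have "\<dots> = fact (n + 2) * t ^ (n + 2)"
    by (simp add: mult.assoc[symmetric] exp_minus_inverse exp_add[symmetric] del: fact_Suc)
  finally have "exp (- (1 / t)) \<le> fact (n + 2) * t ^ (n + 2)" by (simp only: mult_1_right)
  then have "exp (- (1 / t)) / t ^ n \<le> fact (n + 2) * t ^ (n + 2) / t ^ n"
    by (rule divide_right_mono) (use True in simp)
  also have "\<dots> = fact (n + 2) * t\<^sup>2" using True by (simp add: power_add power2_eq_square del: fact_Suc)
  finally show ?thesis using True by (simp add: exp_flat_def del: fact_Suc)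
qed (simp add: exp_flat_def)

lemma exp_flat_has_derivative:
  "(exp_flat n has_real_derivative (- real n * exp_flat (Suc n) t + exp_flat (n + 2) t)) (at t)"
proof -
  consider "0 < t" | "t < 0" | "t = 0" by linarith
  then show ?thesis
  proof cases
    case 1
    have "((\<lambda>t. exp (- (1 / t)) / t ^ n) has_real_derivative (- real n * exp_flat (Suc n) t + exp_flat (n + 2) t)) (at t)"
      using 1
      by (auto intro!: derivative_eq_intros simp: exp_flat_def divide_simps power2_eq_square)
         (cases n; simp add: algebra_simps)
    moreover have "eventually (\<lambda>x. exp (- (1 / x)) / x ^ n = exp_flat n x) (nhds t)"
    proof -
      have "eventually (\<lambda>x. x \<in> {0<..}) (nhds t)" using 1 by (intro eventually_nhds_in_open) auto
      then show ?thesis by eventually_elim (simp add: exp_flat_def)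
    qed
    ultimately show ?thesis
      by (subst DERIV_cong_ev[OF refl _ refl, symmetric]) auto
  next
    case 2
    have "((\<lambda>t. 0) has_real_derivative (- real n * exp_flat (Suc n) t + exp_flat (n + 2) t)) (at t)"
      using 2 by (simp add: exp_flat_def)
    moreover have "eventually (\<lambda>x. 0 = exp_flat n x) (nhds t)"
    proof -
      have "eventually (\<lambda>x. x \<in> {..<0}) (nhds t)" using 2 by (intro eventually_nhds_in_open) auto
      then show ?thesis by eventually_elim (simp add: exp_flat_def)
    qed
    ultimately show ?thesis
      by (subst DERIV_cong_ev[OF refl _ refl, symmetric]) auto
  next
    case 3
    have "((\<lambda>h. exp_flat n h / h) \<longlongrightarrow> 0) (at 0)"
    proof (rule Lim_null_comparison)
      show "eventually (\<lambda>h. norm (exp_flat n h / h) \<le> fact (n + 2) * \<bar>h\<bar>) (at 0)"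
      proof (rule eventually_at_filter[THEN iffD2], rule always_eventually, safe)
        fix h :: real assume "h \<noteq> 0"
        then show "norm (exp_flat n h / h) \<le> fact (n + 2) * \<bar>h\<bar>"
          using exp_flat_bound[of n h]
          by (simp add: abs_divide pos_divide_le_eq power2_eq_square mult.assoc del: fact_Suc)
      qed
      have "((\<lambda>h. fact (n + 2) * \<bar>h\<bar>) \<longlongrightarrow> fact (n + 2) * \<bar>0 :: real\<bar>) (at 0)" by (intro tendsto_intros)
      then show "((\<lambda>h. fact (n + 2) * \<bar>h :: real\<bar>) \<longlongrightarrow> 0) (at 0)" by simp
    qed
    then show ?thesis using 3 by (simp add: DERIV_def exp_flat_def)
  qed
qed

lemma Ck_exp_flat_affine:
  fixes i :: "'a::euclidean_space"
  shows "Ck k (\<lambda>x. exp_flat n (b + c * (x \<bullet> i)))"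
proof (induction k arbitrary: n)
  have der: "((\<lambda>x. exp_flat n (b + c * (x \<bullet> i))) has_derivative
      (\<lambda>h. (- real n * exp_flat (Suc n) (b + c * (x \<bullet> i)) + exp_flat (n + 2) (b + c * (x \<bullet> i))) * (c * (h \<bullet> i)))) (at x)"
    for n and x :: 'a
  proof -
    have "((\<lambda>x. b + c * (x \<bullet> i)) has_derivative (\<lambda>h. c * (h \<bullet> i))) (at x)"
      by (auto intro!: derivative_eq_intros)
    from has_derivative_compose[OF this exp_flat_has_derivative[unfolded has_field_derivative_def]]
    show ?thesis by simp
  qed
  {
    case 0
    have "(\<lambda>x. exp_flat n (b + c * (x \<bullet> i))) differentiable (at x)" for x
      using der unfolding differentiable_def by blast
    then show ?case by (auto intro!: continuous_at_imp_continuous_on differentiable_imp_continuous_within)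
  next
    case (Suc k)
    have eq: "partial e (\<lambda>x. exp_flat n (b + c * (x \<bullet> i))) =
      (\<lambda>x. (c * (e \<bullet> i)) * (- real n * exp_flat (Suc n) (b + c * (x \<bullet> i)) + exp_flat (n + 2) (b + c * (x \<bullet> i))))" for e
      by (rule ext, subst partial_eqI[OF der]) (simp add: mult.commute)
    have dif: "(\<lambda>x. exp_flat n (b + c * (x \<bullet> i))) differentiable (at x)" for x
      using der unfolding differentiable_def by blast
    show ?case
      unfolding Ck.simps eq by (intro conjI allI ballI dif Ck_scale Ck_add Suc)
  }
qed

text \<open>
  A smooth function that is positive exactly on \<open>box a b\<close> and tends to its indicator as \<open>m\<close> grows.
\<close>

definition box_bump :: "nat \<Rightarrow> 'a::euclidean_space \<Rightarrow> 'a \<Rightarrow> 'a \<Rightarrow> real" where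
  "box_bump m a b x = (\<Prod>i\<in>Basis.
     exp_flat 0 (- (Suc m * (a \<bullet> i)) + Suc m * (x \<bullet> i)) * exp_flat 0 (Suc m * (b \<bullet> i) + - real (Suc m) * (x \<bullet> i)))"

lemma exp_flat_0_bounds: "0 \<le> exp_flat 0 t" "exp_flat 0 t \<le> 1"
  by (auto simp: exp_flat_def)

lemma box_bump_nonzero_iff: "box_bump m a b x \<noteq> 0 \<longleftrightarrow> x \<in> box a b"
proof -
  have "0 < - (Suc m * u) + Suc m * v \<longleftrightarrow> u < v" "0 < Suc m * v + - real (Suc m) * u \<longleftrightarrow> u < v" for u v :: real
  proof -
    have "- (Suc m * u) + Suc m * v = real (Suc m) * (v - u)" "Suc m * v + - real (Suc m) * u = real (Suc m) * (v - u)"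
      by (simp_all add: algebra_simps)
    then show "0 < - (Suc m * u) + Suc m * v \<longleftrightarrow> u < v" "0 < Suc m * v + - real (Suc m) * u \<longleftrightarrow> u < v"
      by (simp_all add: zero_less_mult_iff)
  qed
  then show ?thesis
    by (auto simp: box_bump_def prod_zero_iff exp_flat_def mem_box simp del: of_nat_Suc)
qed

lemma box_bump_bounds: "0 \<le> box_bump m a b x" "box_bump m a b x \<le> 1"
  unfolding box_bump_def
  by (intro prod_nonneg ballI mult_nonneg_nonneg exp_flat_0_bounds)
     (intro prod_le_1 conjI mult_nonneg_nonneg mult_le_one exp_flat_0_bounds)

lemma box_bump_tendsto: "(\<lambda>m. box_bump m a b x) \<longlonglongrightarrow> indicator (box a b) x"
proof (cases "x \<in> box a b")
  case False
  then have "box_bump m a b x = 0" for m using box_bump_nonzero_iff by blast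
  then show ?thesis using False by simp
next
  case True
  have one: "(\<lambda>m. exp_flat 0 (real (Suc m) * s)) \<longlonglongrightarrow> 1" if "0 < s" for s
  proof -
    have "(\<lambda>m. exp (- (inverse (real (Suc m)) * (1 / s)))) \<longlonglongrightarrow> exp (- (0 * (1 / s)))"
      by (intro tendsto_intros LIMSEQ_inverse_real_of_nat)
    moreover have "exp_flat 0 (real (Suc m) * s) = exp (- (inverse (real (Suc m)) * (1 / s)))" for m
      using that by (simp add: exp_flat_def divide_simps del: of_nat_Suc)
    ultimately show ?thesis by simp
  qed
  have "(\<lambda>m. \<Prod>i\<in>Basis. exp_flat 0 (real (Suc m) * (x \<bullet> i - a \<bullet> i)) * exp_flat 0 (real (Suc m) * (b \<bullet> i - x \<bullet> i)))
      \<longlonglongrightarrow> (\<Prod>i\<in>(Basis :: 'a set). 1 * 1)"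
    using True by (intro tendsto_prod tendsto_mult one) (auto simp: mem_box)
  moreover have "box_bump m a b x =
      (\<Prod>i\<in>Basis. exp_flat 0 (real (Suc m) * (x \<bullet> i - a \<bullet> i)) * exp_flat 0 (real (Suc m) * (b \<bullet> i - x \<bullet> i)))" for m
    unfolding box_bump_def by (intro prod.cong refl arg_cong2[of _ _ _ _ "(*)"] arg_cong[of _ _ "exp_flat 0"])
      (simp_all add: algebra_simps)
  ultimately show ?thesis using True by simp
qed

lemma test_function_box_bump:
  assumes "cbox a b \<subseteq> \<Omega>"
  shows "test_function \<Omega> (box_bump m a b)"
  unfolding test_function_def
proof (intro conjI allI)
  show "Ck k (box_bump m a b)" for k
    unfolding box_bump_def by (intro Ck_prod Ck_mult Ck_exp_flat_affine finite_Basis)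
  have "{x. box_bump m a b x \<noteq> 0} = box a b" using box_bump_nonzero_iff by blast
  moreover have "closure (box a b) \<subseteq> cbox a b" by (rule closure_minimal[OF box_subset_cbox closed_cbox])
  ultimately show "compact (closure {x. box_bump m a b x \<noteq> 0})" "closure {x. box_bump m a b x \<noteq> 0} \<subseteq> \<Omega>"
    using assms by (auto simp: compact_closure bounded_box)
qed

section \<open>Test functions\<close>

lemma test_functionI:
  assumes "\<And>k. Ck k \<phi>" and "compact K" and "K \<subseteq> \<Omega>" and "\<And>x. x \<notin> K \<Longrightarrow> \<phi> x = 0"
  shows "test_function \<Omega> \<phi>"
proof -
  have "closure {x. \<phi> x \<noteq> 0} \<subseteq> K"
    using assms by (intro closure_minimal compact_imp_closed) auto
  moreover have "bounded {x. \<phi> x \<noteq> 0}"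
    using assms by (intro bounded_subset[OF compact_imp_bounded[of K]]) auto
  ultimately show ?thesis
    unfolding test_function_def compact_closure using assms(1,3) by (intro conjI allI) auto
qed

lemma test_functionE:
  assumes "test_function \<Omega> \<phi>"
  obtains K where "compact K" "K \<subseteq> \<Omega>" "\<And>x. x \<notin> K \<Longrightarrow> \<phi> x = 0"
proof
  show "compact (closure {x. \<phi> x \<noteq> 0})" "closure {x. \<phi> x \<noteq> 0} \<subseteq> \<Omega>"
    using assms unfolding test_function_def by - (elim conjE, assumption)+
  show "\<phi> x = 0" if "x \<notin> closure {x. \<phi> x \<noteq> 0}" for x
  proof (rule ccontr)
    assume "\<phi> x \<noteq> 0"
    then have "x \<in> closure {x. \<phi> x \<noteq> 0}" by (intro subsetD[OF closure_subset]) simp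
    then show False using that by contradiction
  qed
qed

lemma test_function_Ck: "test_function \<Omega> \<phi> \<Longrightarrow> Ck k \<phi>"
  by (simp add: test_function_def)

lemma test_function_differentiable: "test_function \<Omega> \<phi> \<Longrightarrow> \<phi> differentiable (at x)"
  using test_function_Ck[of \<Omega> \<phi> "Suc 0"] by simp

lemma test_function_continuous: "test_function \<Omega> \<phi> \<Longrightarrow> continuous_on S \<phi>"
  by (rule continuous_on_subset[OF Ck_continuous[OF test_function_Ck] subset_UNIV])

lemma test_function_add:
  assumes "test_function \<Omega> \<phi>" "test_function \<Omega> \<psi>"
  shows "test_function \<Omega> (\<lambda>x. \<phi> x + \<psi> x)"
proof -
  obtain K where K: "compact K" "K \<subseteq> \<Omega>" "\<And>x. x \<notin> K \<Longrightarrow> \<phi> x = 0" using test_functionE[OF assms(1)] by blast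
  obtain L where L: "compact L" "L \<subseteq> \<Omega>" "\<And>x. x \<notin> L \<Longrightarrow> \<psi> x = 0" using test_functionE[OF assms(2)] by blast
  show ?thesis
  proof (rule test_functionI)
    show "Ck k (\<lambda>x. \<phi> x + \<psi> x)" for k by (intro Ck_add test_function_Ck[OF assms(1)] test_function_Ck[OF assms(2)])
    show "compact (K \<union> L)" "K \<union> L \<subseteq> \<Omega>" using K(1,2) L(1,2) by auto
    show "\<phi> x + \<psi> x = 0" if "x \<notin> K \<union> L" for x using K(3) L(3) that by simp
  qed
qed

lemma test_function_scale:
  assumes "test_function \<Omega> \<phi>"
  shows "test_function \<Omega> (\<lambda>x. c * \<phi> x)"
proof -
  obtain K where K: "compact K" "K \<subseteq> \<Omega>" "\<And>x. x \<notin> K \<Longrightarrow> \<phi> x = 0" using test_functionE[OF assms(1)] by blast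
  show ?thesis
  proof (rule test_functionI[OF _ K(1,2)])
    show "Ck k (\<lambda>x. c * \<phi> x)" for k by (intro Ck_scale test_function_Ck[OF assms])
  qed (simp add: K(3))
qed

lemma test_function_mult:
  assumes "test_function \<Omega> \<phi>" "test_function \<Omega> \<psi>"
  shows "test_function \<Omega> (\<lambda>x. \<phi> x * \<psi> x)"
proof -
  obtain K where K: "compact K" "K \<subseteq> \<Omega>" "\<And>x. x \<notin> K \<Longrightarrow> \<phi> x = 0" using test_functionE[OF assms(1)] by blast
  show ?thesis
  proof (rule test_functionI[OF _ K(1,2)])
    show "Ck k (\<lambda>x. \<phi> x * \<psi> x)" for k by (intro Ck_mult test_function_Ck[OF assms(1)] test_function_Ck[OF assms(2)])
  qed (simp add: K(3))
qed

lemma test_function_partial: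
  assumes t: "test_function \<Omega> \<phi>" and e: "e \<in> Basis"
  shows "test_function \<Omega> (partial e \<phi>)"
proof -
  obtain K where K: "compact K" "K \<subseteq> \<Omega>" "\<And>x. x \<notin> K \<Longrightarrow> \<phi> x = 0" using test_functionE[OF t] by blast
  show ?thesis
  proof (rule test_functionI[of _ K])
    show "Ck k (partial e \<phi>)" for k using test_function_Ck[OF t, of "Suc k"] e by simp
    fix x assume x: "x \<notin> K"
    have "(\<phi> has_derivative (\<lambda>h. 0)) (at x)"
    proof (rule has_derivative_transform_within_open[OF has_derivative_const])
      show "open (- K)" using K(1) by (simp add: compact_imp_closed open_Compl)
      show "x \<in> - K" using x by simp
      show "0 = \<phi> z" if "z \<in> - K" for z using K(3) that by simp
    qed
    then show "partial e \<phi> x = 0" by (simp add: partial_eqI)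
  qed (use K in auto)
qed

lemma test_function_bounded:
  assumes "test_function \<Omega> \<phi>"
  obtains B where "0 \<le> B" "\<And>x. \<bar>\<phi> x\<bar> \<le> B"
proof -
  obtain K where "compact K" "K \<subseteq> \<Omega>" "\<And>x. x \<notin> K \<Longrightarrow> \<phi> x = 0" using test_functionE[OF assms] by blast
  note K = this(1,3)
  have "compact (\<phi> ` K)" by (intro compact_continuous_image test_function_continuous[OF assms] K)
  then obtain B where B: "\<And>x. x \<in> K \<Longrightarrow> norm (\<phi> x) \<le> B"
    using compact_imp_bounded bounded_iff by (metis (no_types, lifting) imageI)
  show ?thesis
  proof (rule that[of "max 0 B"])
    show "\<bar>\<phi> x\<bar> \<le> max 0 B" for x using B[of x] K(2)[of x] by (cases "x \<in> K") auto
  qed simp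
qed

lemma integrable_if_bounded_on_compact:
  fixes \<phi> :: "'a::euclidean_space \<Rightarrow> real"
  assumes "\<phi> \<in> borel_measurable borel" and "compact K" and "\<And>x. x \<notin> K \<Longrightarrow> \<phi> x = 0" and "\<And>x. \<bar>\<phi> x\<bar> \<le> B"
  shows "integrable lborel \<phi>"
proof (rule Bochner_Integration.integrable_bound)
  show "integrable lborel (\<lambda>x. indicator K x * B)"
    using assms(2) emeasure_compact_finite[OF assms(2)]
    by (intro integrable_mult_left integrable_real_indicator) (auto simp: borel_compact less_top)
  show "AE x in lborel. norm (\<phi> x) \<le> norm (indicator K x * B)"
  proof (rule AE_I2)
    fix x
    show "norm (\<phi> x) \<le> norm (indicator K x * B)"
      using assms(3)[of x] assms(4)[of x] by (cases "x \<in> K") auto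
  qed
qed (use assms(1) in simp)

lemma test_function_integrable:
  assumes "test_function \<Omega> \<phi>"
  shows "integrable lborel \<phi>"
proof -
  obtain K where "compact K" "K \<subseteq> \<Omega>" "\<And>x. x \<notin> K \<Longrightarrow> \<phi> x = 0" using test_functionE[OF assms] by blast
  note K = this(1,3)
  obtain B where B: "\<And>x. \<bar>\<phi> x\<bar> \<le> B" using test_function_bounded[OF assms] by blast
  show ?thesis
    by (rule integrable_if_bounded_on_compact[OF borel_measurable_continuous_onI[OF test_function_continuous[OF assms]] K B])
qed

lemma test_function_square_integrable:
  assumes "test_function \<Omega> \<phi>"
  shows "square_integrable \<phi>"
proof -
  have m: "\<phi> \<in> borel_measurable borel"
    by (rule borel_measurable_continuous_onI[OF test_function_continuous[OF assms]])
  have "integrable lborel (\<lambda>x. \<phi> x * \<phi> x)" by (rule test_function_integrable[OF test_function_mult[OF assms assms]])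
  then show ?thesis
    using m unfolding square_integrable_def
    by (auto simp: measurable_completion power2_eq_square integrable_completion)
qed

lemma to_L2_in_L2_on_iff:
  "square_integrable f \<Longrightarrow> to_L2 f \<in> L2_on \<Omega> \<longleftrightarrow> (AE x in lebesgue. x \<notin> \<Omega> \<longrightarrow> f x = 0)"
  unfolding L2_on_def mem_Collect_eq by transfer simp

lemma test_function_in_L2_on: "test_function \<Omega> \<phi> \<Longrightarrow> to_L2 \<phi> \<in> L2_on \<Omega>"
proof -
  assume t: "test_function \<Omega> \<phi>"
  obtain K where "compact K" "K \<subseteq> \<Omega>" "\<And>x. x \<notin> K \<Longrightarrow> \<phi> x = 0" using test_functionE[OF t] by blast
  then show ?thesis
    by (subst to_L2_in_L2_on_iff[OF test_function_square_integrable[OF t]]) (auto intro!: AE_I2)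
qed

text \<open>
  Translation invariance of the Lebesgue integral makes the integrals of all difference quotients
  vanish; they are dominated by a multiple of the indicator of a ball.
\<close>

lemma integral_partial_test_function:
  assumes t: "test_function \<Omega> F" and e: "e \<in> Basis"
  shows "(LINT x|lebesgue. partial e F x) = 0"
proof -
  obtain K where "compact K" "K \<subseteq> \<Omega>" "\<And>x. x \<notin> K \<Longrightarrow> F x = 0" using test_functionE[OF t] by blast
  note K = this(1,3)
  obtain R where R: "\<And>x. x \<in> K \<Longrightarrow> norm x \<le> R" using K(1) compact_imp_bounded bounded_iff by metis
  obtain B where B: "0 \<le> B" "\<And>x. \<bar>partial e F x\<bar> \<le> B" using test_function_bounded[OF test_function_partial[OF t e]] by blast
  have Fm[measurable]: "F \<in> borel_measurable borel"
    by (rule borel_measurable_continuous_onI[OF test_function_continuous[OF t]])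
  have Pm: "partial e F \<in> borel_measurable borel"
    by (rule borel_measurable_continuous_onI[OF test_function_continuous[OF test_function_partial[OF t e]]])
  have Fi: "integrable lborel F" by (rule test_function_integrable[OF t])
  \<comment> \<open>Difference quotients with step \<open>1 / (n + 1)\<close>.\<close>
  define q where "q n x = real (Suc n) * (F (x + (1 / real (Suc n)) *\<^sub>R e) - F x)" for n x
  have line: "((\<lambda>h. F (x + h *\<^sub>R e)) has_real_derivative partial e F (x + h *\<^sub>R e)) (at h)" for x h
  proof -
    have "((\<lambda>h. x + h *\<^sub>R e) has_derivative (\<lambda>h. h *\<^sub>R e)) (at h)" by (auto intro!: derivative_eq_intros)
    from has_derivative_compose[OF this has_derivative_frechet[OF test_function_differentiable[OF t]]]
    have d: "((\<lambda>h. F (x + h *\<^sub>R e)) has_derivative (\<lambda>k. frechet_derivative F (at (x + h *\<^sub>R e)) (k *\<^sub>R e))) (at h)" .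
    have "linear (frechet_derivative F (at (x + h *\<^sub>R e)))"
      using linear_frechet_derivative[OF test_function_differentiable[OF t]] .
    then show ?thesis
      using d by (simp add: has_field_derivative_def partial_def linear_scale mult_commute_abs)
  qed
  have q_lim: "(\<lambda>n. q n x) \<longlonglongrightarrow> partial e F x" for x
  proof -
    have "((\<lambda>h. (F (x + (0 + h) *\<^sub>R e) - F (x + 0 *\<^sub>R e)) / h) \<longlongrightarrow> partial e F (x + 0 *\<^sub>R e)) (at 0)"
      using line[of x 0] by (simp only: DERIV_def)
    moreover have "filterlim (\<lambda>n. 1 / real (Suc n)) (at 0) sequentially"
      unfolding filterlim_at using LIMSEQ_Suc[OF lim_1_over_n] by auto
    ultimately have "(\<lambda>n. (F (x + (0 + 1 / real (Suc n)) *\<^sub>R e) - F (x + 0 *\<^sub>R e)) / (1 / real (Suc n))) \<longlonglongrightarrow> partial e F (x + 0 *\<^sub>R e)"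
      by (rule filterlim_compose)
    then show ?thesis by (simp add: q_def mult.commute del: of_nat_Suc)
  qed
  have q_bound: "\<bar>q n x\<bar> \<le> B * indicator (cball 0 (R + 1)) x" for n x
  proof -
    let ?h = "1 / real (Suc n)"
    \<comment> \<open>By the mean value theorem the quotients are bounded by the bound \<open>B\<close> of the derivative.\<close>
    obtain z where "F (x + ?h *\<^sub>R e) - F (x + 0 *\<^sub>R e) = (?h - 0) * partial e F (x + z *\<^sub>R e)"
      using MVT2[of 0 ?h "\<lambda>h. F (x + h *\<^sub>R e)" "\<lambda>h. partial e F (x + h *\<^sub>R e)"] line by force
    then have qe: "q n x = partial e F (x + z *\<^sub>R e)" by (simp add: q_def del: of_nat_Suc)
    have "q n x = 0" if "x \<notin> cball 0 (R + 1)"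
    proof -
      have nx: "norm x > R + 1" using that by simp
      have "norm x \<le> norm (x + ?h *\<^sub>R e) + norm (?h *\<^sub>R e)" using norm_triangle_ineq4[of "x + ?h *\<^sub>R e" "?h *\<^sub>R e"] by simp
      moreover have "norm (?h *\<^sub>R e) \<le> 1" using e by simp
      ultimately have "norm (x + ?h *\<^sub>R e) > R" using nx by linarith
      then have "x + ?h *\<^sub>R e \<notin> K" "x \<notin> K" using R nx by fastforce+
      then show ?thesis using K(2) by (simp add: q_def)
    qed
    then show ?thesis using B(2)[of "x + z *\<^sub>R e"] by (auto simp: qe indicator_def)
  qed
  have q_int: "(LINT x|lborel. q n x) = 0" for n
  proof -
    let ?c = "(1 / real (Suc n)) *\<^sub>R e"
    have d: "distr lborel borel ((+) ?c) = (lborel :: 'a measure)" by (rule lborel_distr_plus)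
    have "integrable (distr lborel borel ((+) ?c)) F" using Fi by (simp only: d)
    then have i: "integrable lborel (\<lambda>x. F (?c + x))" by (subst (asm) integrable_distr_eq) auto
    have "(LINT x|lborel. F x) = (LINT x|distr lborel borel ((+) ?c). F x)" by (simp only: d)
    also have "\<dots> = (LINT x|lborel. F (?c + x))" by (rule integral_distr) auto
    finally show ?thesis using i Fi by (simp add: q_def add.commute)
  qed
  have "(\<lambda>n. LINT x|lborel. q n x) \<longlonglongrightarrow> (LINT x|lborel. partial e F x)"
  proof (rule integral_dominated_convergence)
    show "integrable lborel (\<lambda>x. B * indicator (cball 0 (R + 1)) x :: real)"
      using emeasure_compact_finite[OF compact_cball]
      by (intro integrable_mult_right integrable_real_indicator) (auto simp: less_top)
    show "q n \<in> borel_measurable lborel" for n unfolding q_def by measurable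
  qed (use Pm q_lim q_bound in auto)
  then have "(LINT x|lborel. partial e F x) = 0" by (simp add: q_int LIMSEQ_const_iff)
  then show ?thesis using Pm by (simp add: integral_completion)
qed

text \<open>
  Integration by parts: the product of two test functions is a test function.
\<close>

lemma has_weak_partial_test_function:
  assumes t: "test_function \<Omega> \<phi>" and e: "e \<in> Basis"
  shows "has_weak_partial \<Omega> e (to_L2 \<phi>) (to_L2 (partial e \<phi>))"
  unfolding has_weak_partial_def
proof (intro conjI allI impI)
  show "to_L2 (partial e \<phi>) \<in> L2_on \<Omega>"
    by (rule test_function_in_L2_on[OF test_function_partial[OF t e]])
  fix \<psi> assume s: "test_function \<Omega> \<psi>"
  note sq = test_function_square_integrable[OF t] test_function_square_integrable[OF s]
    test_function_square_integrable[OF test_function_partial[OF t e]]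
    test_function_square_integrable[OF test_function_partial[OF s e]]
  have "(LINT x|lebesgue. partial e (\<lambda>x. \<phi> x * \<psi> x) x) = 0"
    by (rule integral_partial_test_function[OF test_function_mult[OF t s] e])
  then have "(LINT x|lebesgue. \<phi> x * partial e \<psi> x + partial e \<phi> x * \<psi> x) = 0"
    using test_function_differentiable[OF t] test_function_differentiable[OF s] by (simp add: partial_mult)
  moreover have "integrable lebesgue (\<lambda>x. \<phi> x * partial e \<psi> x)" "integrable lebesgue (\<lambda>x. partial e \<phi> x * \<psi> x)"
    by (rule square_integrable_mult[OF sq(1) sq(4)], rule square_integrable_mult[OF sq(3) sq(2)])
  ultimately show "inner (to_L2 \<phi>) (to_L2 (partial e \<psi>)) = - inner (to_L2 (partial e \<phi>)) (to_L2 \<psi>)"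
    using sq by (simp add: inner_to_L2)
qed

text \<open>
  The fundamental lemma of the calculus of variations. It makes weak derivatives unique and
  \<open>H10 \<Omega>\<close> dense in \<open>L2_on \<Omega>\<close>.
\<close>

lemma L2_zero_if_orthogonal_to_test_functions:
  fixes g :: "'a::euclidean_space L2"
  assumes \<Omega>: "open \<Omega>" and g: "g \<in> L2_on \<Omega>" and orth: "\<And>\<phi>. test_function \<Omega> \<phi> \<Longrightarrow> inner g (to_L2 \<phi>) = 0"
  shows "g = 0"
proof -
  obtain f where f: "square_integrable f" and F: "to_L2 f = g" using L2_representative by blast
  have fm: "f \<in> borel_measurable lebesgue" using f by (simp add: square_integrable_def)
  have i: "integrable lebesgue (\<lambda>x. indicator (box a b) x * f x)" for a b
    by (intro square_integrable_mult square_integrable_indicator_box f)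
  have "AE x in lebesgue. x \<in> \<Omega> \<longrightarrow> f x = 0"
  proof (rule AE_zero_on_open_if_box_integrals_zero[OF fm \<Omega> i])
    fix a b :: 'a assume ab: "cbox a b \<subseteq> \<Omega>"
    note t = test_function_box_bump[OF ab]
    have bm: "box_bump m a b \<in> borel_measurable lebesgue" for m
      using test_function_square_integrable[OF t] by (simp add: square_integrable_def)
    have "(\<lambda>m. LINT x|lebesgue. box_bump m a b x * f x) \<longlonglongrightarrow> (LINT x|lebesgue. indicator (box a b) x * f x)"
    proof (rule integral_dominated_convergence)
      show "integrable lebesgue (\<lambda>x. \<bar>indicator (box a b) x * f x\<bar>)" using i by (rule integrable_abs)
      show "(\<lambda>x. indicator (box a b) x * f x) \<in> borel_measurable lebesgue" using i by auto
      show "(\<lambda>x. box_bump m a b x * f x) \<in> borel_measurable lebesgue" for m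
        using bm fm by (intro borel_measurable_times)
      show "AE x in lebesgue. (\<lambda>m. box_bump m a b x * f x) \<longlonglongrightarrow> indicator (box a b) x * f x"
        by (intro AE_I2 tendsto_intros box_bump_tendsto)
      show "AE x in lebesgue. norm (box_bump m a b x * f x) \<le> \<bar>indicator (box a b) x * f x\<bar>" for m
      proof (rule AE_I2)
        fix x
        show "norm (box_bump m a b x * f x) \<le> \<bar>indicator (box a b) x * f x\<bar>"
          using box_bump_bounds[of m a b x] box_bump_nonzero_iff[of m a b x]
          by (cases "x \<in> box a b") (auto simp: abs_mult intro: mult_left_le_one_le)
      qed
    qed
    moreover have "(LINT x|lebesgue. box_bump m a b x * f x) = 0" for m
      using orth[OF t] inner_to_L2[OF f test_function_square_integrable[OF t]] F by (simp add: mult.commute)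
    ultimately show "(LINT x|lebesgue. indicator (box a b) x * f x) = 0" by (simp add: LIMSEQ_const_iff)
  qed
  moreover have "AE x in lebesgue. x \<notin> \<Omega> \<longrightarrow> f x = 0" using g to_L2_in_L2_on_iff[OF f] F by simp
  ultimately have "AE x in lebesgue. f x = 0" by eventually_elim blast
  then show ?thesis using to_L2_eq_0_iff[OF f] F by simp
qed

section \<open>Cutoff and the spaces \<open>L\<^sup>2(\<Omega>)\<close>\<close>

lemma indicator_times_square_integrable:
  "A \<in> sets lebesgue \<Longrightarrow> square_integrable f \<Longrightarrow> square_integrable (\<lambda>x. indicator A x * f x)"
proof -
  assume A: "A \<in> sets lebesgue" and f: "square_integrable f"
  have "integrable lebesgue (\<lambda>x. indicator A x *\<^sub>R (f x)\<^sup>2)"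
    using A f by (intro integrable_mult_indicator) (auto simp: square_integrable_def)
  moreover have "(\<lambda>x. indicator A x *\<^sub>R (f x)\<^sup>2) = (\<lambda>x. (indicator A x * f x)\<^sup>2)"
    by (auto simp: indicator_def)
  ultimately show ?thesis using A f by (auto simp: square_integrable_def)
qed

lemma cutoff_to_L2:
  "A \<in> sets lebesgue \<Longrightarrow> square_integrable f \<Longrightarrow> cutoff A (to_L2 f) = to_L2 (\<lambda>x. indicator A x * f x)"
  by transfer (simp add: indicator_times_square_integrable)

lemma norm_cutoff_le:
  assumes A: "A \<in> sets lebesgue"
  shows "norm (cutoff A F) \<le> norm F"
proof -
  obtain f where f: "square_integrable f" "to_L2 f = F" using L2_representative by metis
  note fA = indicator_times_square_integrable[OF A f(1)]
  have "(norm (to_L2 (\<lambda>x. indicator A x * f x)))\<^sup>2 \<le> (norm (to_L2 f))\<^sup>2"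
    unfolding norm_to_L2[OF fA] norm_to_L2[OF f(1)]
    using f(1) fA by (intro integral_mono) (auto simp: square_integrable_def indicator_def)
  then have "norm (to_L2 (\<lambda>x. indicator A x * f x)) \<le> norm (to_L2 f)" by (rule power2_le_imp_le) simp
  then show ?thesis
    using cutoff_to_L2[OF A f(1)] by (simp add: f)
qed

lemma bounded_linear_cutoff:
  assumes A: "A \<in> sets lebesgue"
  shows "bounded_linear (cutoff A)"
proof (rule bounded_linear_intro[where K = 1])
  fix F G :: "'a L2" and c :: real
  obtain f g where f: "square_integrable f" "to_L2 f = F" and g: "square_integrable g" "to_L2 g = G"
    using L2_representative by metis
  note fA = indicator_times_square_integrable[OF A f(1)] and gA = indicator_times_square_integrable[OF A g(1)]
  have "cutoff A (to_L2 f + to_L2 g) = cutoff A (to_L2 f) + cutoff A (to_L2 g)"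
    using f(1) g(1) fA gA A
    by (simp add: to_L2_add cutoff_to_L2 square_integrable_add distrib_left)
  then show "cutoff A (F + G) = cutoff A F + cutoff A G" by (simp add: f g)
  have "cutoff A (c *\<^sub>R to_L2 f) = c *\<^sub>R cutoff A (to_L2 f)"
    using f(1) fA A by (simp add: to_L2_scaleR cutoff_to_L2 square_integrable_scale mult.left_commute)
  then show "cutoff A (c *\<^sub>R F) = c *\<^sub>R cutoff A F" by (simp add: f)
  show "norm (cutoff A F) \<le> norm F * 1" using norm_cutoff_le[OF A] by simp
qed

text \<open>
  As a set of fixed points of a bounded linear map, \<open>L2_on A\<close> is a closed subspace.
\<close>

lemma L2_on_eq_cutoff_fixed:
  assumes A: "A \<in> sets lebesgue"
  shows "L2_on A = {F. cutoff A F = F}"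
proof (intro set_eqI)
  fix F :: "'a L2"
  obtain f where f: "square_integrable f" "to_L2 f = F" using L2_representative by metis
  note fA = indicator_times_square_integrable[OF A f(1)]
  have "cutoff A F = F \<longleftrightarrow> to_L2 (\<lambda>x. indicator A x * f x) - to_L2 f = 0"
    using cutoff_to_L2[OF A f(1)] f(2) by simp
  also have "\<dots> \<longleftrightarrow> (AE x in lebesgue. indicator A x * f x - f x = 0)"
    by (simp add: to_L2_diff[OF fA f(1)] to_L2_eq_0_iff[OF square_integrable_diff[OF fA f(1)]] del: right_minus_eq)
  also have "\<dots> \<longleftrightarrow> (AE x in lebesgue. x \<notin> A \<longrightarrow> f x = 0)"
    by (intro eventually_cong[OF eventually_True]) (auto simp: indicator_def)
  also have "\<dots> \<longleftrightarrow> F \<in> L2_on A" using to_L2_in_L2_on_iff[OF f(1)] f(2) by simp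
  finally show "F \<in> L2_on A \<longleftrightarrow> F \<in> {F. cutoff A F = F}" by simp
qed

lemma closed_L2_on: "A \<in> sets lebesgue \<Longrightarrow> closed (L2_on A)"
  unfolding L2_on_eq_cutoff_fixed
  by (intro closed_Collect_eq continuous_on_id linear_continuous_on bounded_linear_cutoff)

lemma subspace_L2_on: "A \<in> sets lebesgue \<Longrightarrow> subspace (L2_on A)"
  unfolding L2_on_eq_cutoff_fixed subspace_def
  using bounded_linear_cutoff[of A]
  by (auto simp: linear_simps)

section \<open>The space \<open>H\<^sup>1\<^sub>0(\<Omega>)\<close>\<close>

lemma has_weak_partial_unique:
  assumes \<Omega>: "open \<Omega>" and g: "has_weak_partial \<Omega> e f g" and h: "has_weak_partial \<Omega> e f h"
  shows "g = h"
proof -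
  have "g - h = 0"
  proof (rule L2_zero_if_orthogonal_to_test_functions[OF \<Omega>])
    show "g - h \<in> L2_on \<Omega>"
      using g h subspace_L2_on[of \<Omega>] \<Omega> by (auto simp: has_weak_partial_def intro!: subspace_diff)
    fix \<phi> assume "test_function \<Omega> \<phi>"
    then have "f \<bullet> to_L2 (partial e \<phi>) = - (g \<bullet> to_L2 \<phi>)" "f \<bullet> to_L2 (partial e \<phi>) = - (h \<bullet> to_L2 \<phi>)"
      using g h unfolding has_weak_partial_def by blast+
    then show "(g - h) \<bullet> to_L2 \<phi> = 0" by (simp add: inner_diff_left)
  qed
  then show ?thesis by simp
qed

lemma weak_partial_eqI: "open \<Omega> \<Longrightarrow> has_weak_partial \<Omega> e f g \<Longrightarrow> weak_partial \<Omega> e f = g"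
  unfolding weak_partial_def by (rule the_equality) (blast intro: has_weak_partial_unique)+

lemma has_weak_partial_weak_partial:
  assumes "open \<Omega>" "f \<in> H1 \<Omega>" "e \<in> Basis"
  shows "has_weak_partial \<Omega> e f (weak_partial \<Omega> e f)"
proof -
  obtain g where "has_weak_partial \<Omega> e f g" using assms by (auto simp: H1_def)
  then show ?thesis using weak_partial_eqI[OF assms(1)] by simp
qed

lemma has_weak_partial_add:
  assumes "open \<Omega>" "has_weak_partial \<Omega> e f g" "has_weak_partial \<Omega> e f' g'"
  shows "has_weak_partial \<Omega> e (f + f') (g + g')"
  using assms subspace_L2_on[of \<Omega>] unfolding has_weak_partial_def
  by (auto simp: inner_add_left intro!: subspace_add)

lemma has_weak_partial_scaleR:
  assumes "open \<Omega>" "has_weak_partial \<Omega> e f g"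
  shows "has_weak_partial \<Omega> e (c *\<^sub>R f) (c *\<^sub>R g)"
  using assms subspace_L2_on[of \<Omega>] unfolding has_weak_partial_def
  by (auto intro!: subspace_scale)

lemma H10_imp_H1: "f \<in> H10 \<Omega> \<Longrightarrow> f \<in> H1 \<Omega>" and H1_imp_L2_on: "f \<in> H1 \<Omega> \<Longrightarrow> f \<in> L2_on \<Omega>"
  by (auto simp: H10_def H1_def)

lemma H10_add:
  assumes \<Omega>: "open \<Omega>" and f: "f \<in> H10 \<Omega>" and g: "g \<in> H10 \<Omega>"
  shows "f + g \<in> H10 \<Omega>" and "e \<in> Basis \<Longrightarrow> weak_partial \<Omega> e (f + g) = weak_partial \<Omega> e f + weak_partial \<Omega> e g"
proof -
  have w: "has_weak_partial \<Omega> e (f + g) (weak_partial \<Omega> e f + weak_partial \<Omega> e g)" if "e \<in> Basis" for e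
    by (intro has_weak_partial_add has_weak_partial_weak_partial \<Omega> that H10_imp_H1 f g)
  show eq: "weak_partial \<Omega> e (f + g) = weak_partial \<Omega> e f + weak_partial \<Omega> e g" if "e \<in> Basis" for e
    by (rule weak_partial_eqI[OF \<Omega> w[OF that]])
  have "f + g \<in> H1 \<Omega>"
    using w H1_imp_L2_on[OF H10_imp_H1[OF f]] H1_imp_L2_on[OF H10_imp_H1[OF g]] subspace_L2_on[of \<Omega>] \<Omega>
    by (auto simp: H1_def intro!: subspace_add)
  moreover obtain \<phi> where p: "\<And>k. test_function \<Omega> (\<phi> k)" "(\<lambda>k. to_L2 (\<phi> k)) \<longlonglongrightarrow> f"
    "\<And>e. e \<in> Basis \<Longrightarrow> (\<lambda>k. to_L2 (partial e (\<phi> k))) \<longlonglongrightarrow> weak_partial \<Omega> e f" using f unfolding H10_def by blast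
  moreover obtain \<psi> where q: "\<And>k. test_function \<Omega> (\<psi> k)" "(\<lambda>k. to_L2 (\<psi> k)) \<longlonglongrightarrow> g"
    "\<And>e. e \<in> Basis \<Longrightarrow> (\<lambda>k. to_L2 (partial e (\<psi> k))) \<longlonglongrightarrow> weak_partial \<Omega> e g" using g unfolding H10_def by blast
  have a: "to_L2 (\<lambda>x. \<phi> k x + \<psi> k x) = to_L2 (\<phi> k) + to_L2 (\<psi> k)" for k
    by (rule to_L2_add[symmetric]) (intro test_function_square_integrable[OF p(1)] test_function_square_integrable[OF q(1)])+
  have b: "to_L2 (partial e (\<lambda>x. \<phi> k x + \<psi> k x)) = to_L2 (partial e (\<phi> k)) + to_L2 (partial e (\<psi> k))" if "e \<in> Basis" for k e
    unfolding partial_add[OF test_function_differentiable[OF p(1)] test_function_differentiable[OF q(1)]]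
    by (rule to_L2_add[symmetric]) (intro test_function_square_integrable[OF test_function_partial[OF p(1) that]]
        test_function_square_integrable[OF test_function_partial[OF q(1) that]])+
  have "(\<lambda>k. to_L2 (\<lambda>x. \<phi> k x + \<psi> k x)) \<longlonglongrightarrow> f + g" unfolding a by (intro tendsto_add p q)
  moreover have "(\<lambda>k. to_L2 (partial e (\<lambda>x. \<phi> k x + \<psi> k x))) \<longlonglongrightarrow> weak_partial \<Omega> e (f + g)" if "e \<in> Basis" for e
    unfolding b[OF that] eq[OF that] by (intro tendsto_add p q that)
  ultimately show "f + g \<in> H10 \<Omega>"
    unfolding H10_def using test_function_add[OF p(1) q(1)]
    by (intro CollectI conjI exI[of _ "\<lambda>k x. \<phi> k x + \<psi> k x"]) auto
qed

lemma H10_scaleR: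
  assumes \<Omega>: "open \<Omega>" and f: "f \<in> H10 \<Omega>"
  shows "c *\<^sub>R f \<in> H10 \<Omega>" and "e \<in> Basis \<Longrightarrow> weak_partial \<Omega> e (c *\<^sub>R f) = c *\<^sub>R weak_partial \<Omega> e f"
proof -
  have w: "has_weak_partial \<Omega> e (c *\<^sub>R f) (c *\<^sub>R weak_partial \<Omega> e f)" if "e \<in> Basis" for e
    by (intro has_weak_partial_scaleR has_weak_partial_weak_partial \<Omega> that H10_imp_H1 f)
  show eq: "weak_partial \<Omega> e (c *\<^sub>R f) = c *\<^sub>R weak_partial \<Omega> e f" if "e \<in> Basis" for e
    by (rule weak_partial_eqI[OF \<Omega> w[OF that]])
  have "c *\<^sub>R f \<in> H1 \<Omega>"
    using w H1_imp_L2_on[OF H10_imp_H1[OF f]] subspace_L2_on[of \<Omega>] \<Omega>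
    by (auto simp: H1_def intro!: subspace_scale)
  moreover obtain \<phi> where p: "\<And>k. test_function \<Omega> (\<phi> k)" "(\<lambda>k. to_L2 (\<phi> k)) \<longlonglongrightarrow> f"
    "\<And>e. e \<in> Basis \<Longrightarrow> (\<lambda>k. to_L2 (partial e (\<phi> k))) \<longlonglongrightarrow> weak_partial \<Omega> e f" using f unfolding H10_def by blast
  have a: "to_L2 (\<lambda>x. c * \<phi> k x) = c *\<^sub>R to_L2 (\<phi> k)" for k
    by (rule to_L2_scaleR[symmetric]) (intro test_function_square_integrable[OF p(1)])
  have b: "to_L2 (partial e (\<lambda>x. c * \<phi> k x)) = c *\<^sub>R to_L2 (partial e (\<phi> k))" if "e \<in> Basis" for k e
    unfolding partial_scale[OF test_function_differentiable[OF p(1)]]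
    by (rule to_L2_scaleR[symmetric]) (intro test_function_square_integrable[OF test_function_partial[OF p(1) that]])
  have "(\<lambda>k. to_L2 (\<lambda>x. c * \<phi> k x)) \<longlonglongrightarrow> c *\<^sub>R f" unfolding a by (intro tendsto_intros p)
  moreover have "(\<lambda>k. to_L2 (partial e (\<lambda>x. c * \<phi> k x))) \<longlonglongrightarrow> weak_partial \<Omega> e (c *\<^sub>R f)" if "e \<in> Basis" for e
    unfolding b[OF that] eq[OF that] by (intro tendsto_intros p that)
  ultimately show "c *\<^sub>R f \<in> H10 \<Omega>"
    unfolding H10_def using test_function_scale[OF p(1)]
    by (intro CollectI conjI exI[of _ "\<lambda>k x. c * \<phi> k x"]) auto
qed

lemma test_function_in_H10:
  assumes \<Omega>: "open \<Omega>" and t: "test_function \<Omega> \<phi>"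
  shows "to_L2 \<phi> \<in> H10 \<Omega>"
proof -
  note w = has_weak_partial_test_function[OF t]
  have "to_L2 \<phi> \<in> H1 \<Omega>" unfolding H1_def using w test_function_in_L2_on[OF t] by auto
  moreover have "weak_partial \<Omega> e (to_L2 \<phi>) = to_L2 (partial e \<phi>)" if "e \<in> Basis" for e
    by (rule weak_partial_eqI[OF \<Omega> w[OF that]])
  ultimately show ?thesis
    unfolding H10_def using t by (intro CollectI conjI exI[of _ "\<lambda>_. \<phi>"]) auto
qed

text \<open>
  Limits of gradients are weak gradients of the limit since the defining identity is continuous; the
  approximating test functions of the limit come from a diagonal choice.
\<close>

lemma H10_closed_graph:
  assumes \<Omega>: "open \<Omega>" and x: "\<And>n. x n \<in> H10 \<Omega>" and lim: "x \<longlonglongrightarrow> z"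
    and glim: "\<And>e. e \<in> Basis \<Longrightarrow> (\<lambda>n. weak_partial \<Omega> e (x n)) \<longlonglongrightarrow> g e"
  shows "z \<in> H10 \<Omega>" and "e \<in> Basis \<Longrightarrow> weak_partial \<Omega> e z = g e"
proof -
  have cl: "closed (L2_on \<Omega>)" using \<Omega> by (intro closed_L2_on) auto
  have w: "has_weak_partial \<Omega> e z (g e)" if e: "e \<in> Basis" for e
    unfolding has_weak_partial_def
  proof (intro conjI allI impI)
    have wx: "has_weak_partial \<Omega> e (x n) (weak_partial \<Omega> e (x n))" for n
      by (intro has_weak_partial_weak_partial \<Omega> H10_imp_H1 x e)
    show "g e \<in> L2_on \<Omega>"
      by (rule closed_sequentially[OF cl _ glim[OF e]]) (use wx in \<open>simp add: has_weak_partial_def\<close>)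
    fix \<phi> assume t: "test_function \<Omega> \<phi>"
    have "(\<lambda>n. x n \<bullet> to_L2 (partial e \<phi>)) \<longlonglongrightarrow> z \<bullet> to_L2 (partial e \<phi>)" by (intro tendsto_intros lim)
    moreover have "x n \<bullet> to_L2 (partial e \<phi>) = - (weak_partial \<Omega> e (x n) \<bullet> to_L2 \<phi>)" for n
      using wx t by (simp add: has_weak_partial_def)
    moreover have "(\<lambda>n. - (weak_partial \<Omega> e (x n) \<bullet> to_L2 \<phi>)) \<longlonglongrightarrow> - (g e \<bullet> to_L2 \<phi>)"
      by (intro tendsto_intros glim e)
    ultimately show "z \<bullet> to_L2 (partial e \<phi>) = - (g e \<bullet> to_L2 \<phi>)" using LIMSEQ_unique by simp
  qed
  show eq: "weak_partial \<Omega> e z = g e" if "e \<in> Basis" for e by (rule weak_partial_eqI[OF \<Omega> w[OF that]])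
  have "z \<in> L2_on \<Omega>" by (rule closed_sequentially[OF cl _ lim]) (use x H10_imp_H1 H1_imp_L2_on in blast)
  then have zH1: "z \<in> H1 \<Omega>" using w by (auto simp: H1_def)
  have "\<exists>\<phi>. test_function \<Omega> \<phi> \<and> dist (to_L2 \<phi>) (x n) < 1 / real (Suc n) \<and>
      (\<forall>e\<in>Basis. dist (to_L2 (partial e \<phi>)) (weak_partial \<Omega> e (x n)) < 1 / real (Suc n))" for n
  proof -
    obtain \<phi> where p: "\<And>k. test_function \<Omega> (\<phi> k)" "(\<lambda>k. to_L2 (\<phi> k)) \<longlonglongrightarrow> x n"
      "\<And>e. e \<in> Basis \<Longrightarrow> (\<lambda>k. to_L2 (partial e (\<phi> k))) \<longlonglongrightarrow> weak_partial \<Omega> e (x n)" using x[of n] unfolding H10_def by blast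
    have pos: "0 < 1 / real (Suc n)" by simp
    have "eventually (\<lambda>k. dist (to_L2 (\<phi> k)) (x n) < 1 / real (Suc n)) sequentially"
      by (rule tendstoD[OF p(2) pos])
    moreover have "eventually (\<lambda>k. \<forall>e\<in>Basis. dist (to_L2 (partial e (\<phi> k))) (weak_partial \<Omega> e (x n)) < 1 / real (Suc n)) sequentially"
      by (intro eventually_ball_finite finite_Basis ballI tendstoD[OF p(3) pos])
    ultimately have "eventually (\<lambda>k. dist (to_L2 (\<phi> k)) (x n) < 1 / real (Suc n) \<and>
       (\<forall>e\<in>Basis. dist (to_L2 (partial e (\<phi> k))) (weak_partial \<Omega> e (x n)) < 1 / real (Suc n))) sequentially"
      by (rule eventually_conj)
    then obtain k where "dist (to_L2 (\<phi> k)) (x n) < 1 / real (Suc n) \<and>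
       (\<forall>e\<in>Basis. dist (to_L2 (partial e (\<phi> k))) (weak_partial \<Omega> e (x n)) < 1 / real (Suc n))"
      using eventually_happens'[OF sequentially_bot] by blast
    then show ?thesis using p(1) by blast
  qed
  then obtain \<phi> where p: "\<And>n. test_function \<Omega> (\<phi> n)" "\<And>n. dist (to_L2 (\<phi> n)) (x n) < 1 / real (Suc n)"
    "\<And>n e. e \<in> Basis \<Longrightarrow> dist (to_L2 (partial e (\<phi> n))) (weak_partial \<Omega> e (x n)) < 1 / real (Suc n)"
    by metis
  have approx: "u \<longlonglongrightarrow> l" if "\<And>n. dist (u n) (v n) < 1 / real (Suc n)" "v \<longlonglongrightarrow> l" for u v :: "nat \<Rightarrow> 'a L2" and l
  proof -
    have "(\<lambda>n. dist (u n) (v n)) \<longlonglongrightarrow> 0"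
    proof (rule Lim_null_comparison)
      show "(\<lambda>n. 1 / real (Suc n)) \<longlonglongrightarrow> 0" by (rule LIMSEQ_Suc[OF lim_1_over_n])
      show "eventually (\<lambda>n. norm (dist (u n) (v n)) \<le> 1 / real (Suc n)) sequentially"
        using that(1) by (intro always_eventually allI) (simp add: less_imp_le)
    qed
    then have "(\<lambda>n. u n - v n) \<longlonglongrightarrow> 0" by (simp add: dist_norm tendsto_norm_zero_iff)
    from tendsto_add[OF that(2) this] show ?thesis by simp
  qed
  show "z \<in> H10 \<Omega>"
    unfolding H10_def
  proof (intro CollectI conjI zH1 exI[of _ \<phi>] allI ballI p(1))
    show "(\<lambda>k. to_L2 (\<phi> k)) \<longlonglongrightarrow> z" by (rule approx[OF p(2) lim])
    show "(\<lambda>k. to_L2 (partial e (\<phi> k))) \<longlonglongrightarrow> weak_partial \<Omega> e z" if "e \<in> Basis" for e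
      unfolding eq[OF that] by (rule approx[OF p(3)[OF that] glim[OF that]])
  qed
qed

lemma subspace_H10:
  assumes \<Omega>: "open \<Omega>"
  shows "subspace (H10 \<Omega>)"
proof -
  have "test_function \<Omega> (\<lambda>_. 0)" by (rule test_functionI[of _ "{}"]) (auto intro: Ck_const)
  then have "0 *\<^sub>R to_L2 (\<lambda>_. 0) \<in> H10 \<Omega>" using H10_scaleR(1)[OF \<Omega> test_function_in_H10[OF \<Omega>]] by blast
  then show ?thesis
    unfolding subspace_def using H10_add(1)[OF \<Omega>] H10_scaleR(1)[OF \<Omega>] by simp
qed

text \<open>
  The component of \<open>y\<close> orthogonal to \<open>H10 \<Omega>\<close> is orthogonal to all test functions, hence zero.
\<close>

lemma L2_on_subset_closure_H10:
  assumes \<Omega>: "open \<Omega>"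
  shows "L2_on \<Omega> \<subseteq> closure (H10 \<Omega>)"
proof
  fix y assume y: "y \<in> L2_on \<Omega>"
  have cl: "closed (L2_on \<Omega>)" and sub: "subspace (L2_on \<Omega>)" using \<Omega> by (auto intro!: closed_L2_on subspace_L2_on)
  obtain z where z: "z \<in> closure (H10 \<Omega>)" "\<And>w. w \<in> closure (H10 \<Omega>) \<Longrightarrow> inner (y - z) w = 0"
    using orthogonal_projection_exists[OF subspace_closure[OF subspace_H10[OF \<Omega>]] closed_closure] by metis
  have "H10 \<Omega> \<subseteq> L2_on \<Omega>" using H10_imp_H1 H1_imp_L2_on by blast
  then have "z \<in> L2_on \<Omega>" using closure_minimal[OF _ cl] z(1) by blast
  then have "y - z \<in> L2_on \<Omega>" using y sub by (simp add: subspace_diff)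
  then have "y - z = 0"
    using z(2) test_function_in_H10[OF \<Omega>] closure_subset
    by (intro L2_zero_if_orthogonal_to_test_functions[OF \<Omega>]) blast+
  then show "y \<in> closure (H10 \<Omega>)" using z(1) by simp
qed

section \<open>The heat equation as an abstract evolution equation\<close>

text \<open>
  Collecting the weak partial derivatives in one vector brings the Dirichlet form into the shape
  \<open>\<langle>D u, D v\<rangle>\<close> with a single operator \<open>D\<close>.
\<close>

definition grad :: "(real ^ 'n) set \<Rightarrow> (real ^ 'n) L2 \<Rightarrow> (real ^ 'n) L2 ^ 'n" where
  "grad \<Omega> f = (\<chi> i. weak_partial \<Omega> (axis i 1) f)"

lemma Basis_eq_axes: "(Basis :: (real ^ 'n) set) = range (\<lambda>i. axis i 1)"
  by (auto simp: Basis_vec_def)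

lemma axis_in_Basis: "axis i 1 \<in> (Basis :: (real ^ 'n) set)"
  by (simp add: Basis_eq_axes)

lemma sum_Basis_axes: "(\<Sum>e\<in>Basis. h e) = (\<Sum>i\<in>UNIV. h (axis i 1 :: real ^ 'n))"
  unfolding Basis_eq_axes by (subst sum.reindex) (auto simp: inj_on_def axis_eq_axis)

lemma inner_grad: "grad \<Omega> f \<bullet> grad \<Omega> g = (\<Sum>e\<in>Basis. weak_partial \<Omega> e f \<bullet> weak_partial \<Omega> e g)"
  by (simp add: inner_vec_def grad_def sum_Basis_axes)

lemma closed_form_grad:
  assumes \<Omega>: "open (\<Omega> :: (real ^ 'n) set)"
  shows "closed_form (H10 \<Omega>) (grad \<Omega>)"
proof
  show "subspace (H10 \<Omega>)" by (rule subspace_H10[OF \<Omega>])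
  show "grad \<Omega> (x + y) = grad \<Omega> x + grad \<Omega> y" if "x \<in> H10 \<Omega>" "y \<in> H10 \<Omega>" for x y
    using H10_add(2)[OF \<Omega> that axis_in_Basis] by (simp add: grad_def vec_eq_iff)
  show "grad \<Omega> (c *\<^sub>R x) = c *\<^sub>R grad \<Omega> x" if "x \<in> H10 \<Omega>" for c x
    using H10_scaleR(2)[OF \<Omega> that axis_in_Basis] by (simp add: grad_def vec_eq_iff)
  fix x :: "nat \<Rightarrow> (real ^ 'n) L2" and z g
  assume x: "\<And>n. x n \<in> H10 \<Omega>" and lim: "x \<longlonglongrightarrow> z" and glim: "(\<lambda>n. grad \<Omega> (x n)) \<longlonglongrightarrow> g"
  \<comment> \<open>Components of \<open>g\<close>, indexed by basis vectors instead of coordinates.\<close>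
  define g' where "g' e = g $ (THE i. e = axis i 1)" for e :: "real ^ 'n"
  have g': "g' (axis i 1) = g $ i" for i
    unfolding g'_def by (rule arg_cong[of _ _ "($) g"]) (auto simp: axis_eq_axis)
  have "(\<lambda>n. weak_partial \<Omega> e (x n)) \<longlonglongrightarrow> g' e" if basis: "e \<in> Basis" for e
  proof -
    obtain i where e: "e = axis i 1" using basis unfolding Basis_eq_axes by blast
    show ?thesis using tendsto_vec_nth[OF glim, of i] by (simp add: e g' grad_def)
  qed
  note cg = H10_closed_graph[OF \<Omega> x lim this]
  show "z \<in> H10 \<Omega> \<and> grad \<Omega> z = g"
    using cg(1) cg(2)[OF _ axis_in_Basis] by (auto simp: grad_def vec_eq_iff g')
qed

lemma measurable_vec_iff:
  fixes f :: "'a \<Rightarrow> ('b::{real_normed_vector, second_countable_topology}) ^ 'n"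
  shows "f \<in> borel_measurable M \<longleftrightarrow> (\<forall>i. (\<lambda>x. f x $ i) \<in> borel_measurable M)"
proof safe
  fix i assume f: "f \<in> borel_measurable M"
  have "(\<lambda>v. v $ i) \<in> borel_measurable (borel :: ('b ^ 'n) measure)"
    by (intro borel_measurable_continuous_onI continuous_intros)
  from measurable_compose[OF f this] show "(\<lambda>x. f x $ i) \<in> borel_measurable M" .
next
  assume f: "\<forall>i. (\<lambda>x. f x $ i) \<in> borel_measurable M"
  have cont: "continuous_on UNIV (\<lambda>v :: 'b. axis i v :: 'b ^ 'n)" for i
  proof -
    have "bounded_linear (\<lambda>v :: 'b. axis i v :: 'b ^ 'n)"
    proof (rule bounded_linear_intro[where K = 1])
      fix v w :: 'b and c :: real
      show "axis i (v + w) = axis i v + (axis i w :: 'b ^ 'n)" "axis i (c *\<^sub>R v) = c *\<^sub>R (axis i v :: 'b ^ 'n)"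
        by (simp_all add: vec_eq_iff axis_def)
      show "norm (axis i v :: 'b ^ 'n) \<le> norm v * 1"
        unfolding norm_vec_def
        by (rule order_trans[OF L2_set_le_sum]) (simp_all add: axis_def if_distrib[of norm] sum.delta cong: if_cong)
    qed
    then show ?thesis by (rule linear_continuous_on)
  qed
  have "(\<lambda>x. \<Sum>i\<in>UNIV. axis i (f x $ i) :: 'b ^ 'n) \<in> borel_measurable M"
    using f by (intro borel_measurable_sum measurable_compose[OF _ borel_measurable_continuous_onI[OF cont]]) auto
  moreover have "(\<Sum>i\<in>UNIV. axis i (f x $ i) :: 'b ^ 'n) = f x" for x
    by (simp add: vec_eq_iff axis_def sum.delta if_distrib cong: if_cong)
  ultimately show "f \<in> borel_measurable M" by simp
qed

lemma set_integral_eq_Leb: "(LINT s:{0<..<t}|lebesgue. g s) = (LINT s|Leb t. g s)"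
  for g :: "real \<Rightarrow> real"
  unfolding set_lebesgue_integral_def by (rule integral_restrict_space[symmetric]) simp

lemma set_integrable_iff_Leb: "set_integrable lebesgue {0<..<t} g \<longleftrightarrow> integrable (Leb t) g"
  for g :: "real \<Rightarrow> real"
  unfolding set_integrable_def by (rule integrable_restrict_space[symmetric]) simp

lemma norm_grad: "(norm (grad \<Omega> f))\<^sup>2 = (\<Sum>e\<in>Basis. (norm (weak_partial \<Omega> e f))\<^sup>2)"
  unfolding power2_norm_eq_inner by (rule inner_grad)

text \<open>
  The only condition on the left that has no counterpart on the right is that \<open>y t\<close> belongs to
  \<open>L2_on \<Omega>\<close> at every time; it follows because weak solutions stay in the closure of \<open>H10 \<Omega>\<close>.
\<close>

lemma is_heat_solution_iff:
  fixes \<Omega> :: "(real ^ 'n) set"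
  assumes \<Omega>: "open \<Omega>" and J: "time_domain J" and y0: "y0 \<in> L2_on \<Omega>"
  shows "is_heat_solution \<Omega> \<omega> J y0 u y \<longleftrightarrow>
    closed_form.weak_sol (H10 \<Omega>) (grad \<Omega>) J y0 (\<lambda>s. cutoff \<omega> (u s)) y"
proof -
  interpret closed_form "H10 \<Omega>" "grad \<Omega>" by (rule closed_form_grad[OF \<Omega>])
  have cl: "closed (L2_on \<Omega>)" using \<Omega> by (auto intro: closed_L2_on)
  have "H10 \<Omega> \<subseteq> L2_on \<Omega>" using H10_imp_H1 H1_imp_L2_on by blast
  then have clos: "closure (H10 \<Omega>) \<subseteq> L2_on \<Omega>" using cl by (rule closure_minimal)
  have meas: "(\<lambda>t. grad \<Omega> (y t)) \<in> borel_measurable (lebesgue_on J) \<longleftrightarrow>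
      (\<forall>e\<in>Basis. (\<lambda>t. weak_partial \<Omega> e (y t)) \<in> borel_measurable (lebesgue_on J))"
    unfolding measurable_vec_iff Basis_eq_axes by (auto simp: grad_def)
  have int: "integrable (Leb t) (\<lambda>s. (norm (grad \<Omega> (y s)))\<^sup>2) \<longleftrightarrow>
      (\<forall>e\<in>Basis. set_integrable lebesgue {0<..<t} (\<lambda>s. (norm (weak_partial \<Omega> e (y s)))\<^sup>2))"
    if t: "t \<in> J" and m: "\<forall>e\<in>Basis. (\<lambda>t. weak_partial \<Omega> e (y t)) \<in> borel_measurable (lebesgue_on J)" for t
  proof safe
    fix e :: "real ^ 'n" assume i: "integrable (Leb t) (\<lambda>s. (norm (grad \<Omega> (y s)))\<^sup>2)" and e: "e \<in> Basis"
    have [measurable]: "(\<lambda>t. weak_partial \<Omega> e (y t)) \<in> borel_measurable (Leb t)"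
      using m e by (intro measurable_Leb_restrict[OF _ time_domain_subset[OF J t]]) blast
    have "(norm (weak_partial \<Omega> e (y s)))\<^sup>2 \<le> (norm (grad \<Omega> (y s)))\<^sup>2" for s
      unfolding norm_grad using e by (intro member_le_sum) auto
    then show "set_integrable lebesgue {0<..<t} (\<lambda>s. (norm (weak_partial \<Omega> e (y s)))\<^sup>2)"
      unfolding set_integrable_iff_Leb
      by (intro Bochner_Integration.integrable_bound[OF i]) (auto intro!: AE_I2)
  next
    assume "\<forall>e\<in>Basis. set_integrable lebesgue {0<..<t} (\<lambda>s. (norm (weak_partial \<Omega> e (y s)))\<^sup>2)"
    then show "integrable (Leb t) (\<lambda>s. (norm (grad \<Omega> (y s)))\<^sup>2)"
      unfolding norm_grad set_integrable_iff_Leb by (intro Bochner_Integration.integrable_sum) blast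
  qed
  show ?thesis
  proof
    assume h: "is_heat_solution \<Omega> \<omega> J y0 u y"
    show "weak_sol J y0 (\<lambda>s. cutoff \<omega> (u s)) y"
      using h int meas unfolding is_heat_solution_def weak_sol_def
      by (simp add: inner_grad set_integral_eq_Leb)
  next
    assume w: "weak_sol J y0 (\<lambda>s. cutoff \<omega> (u s)) y"
    have "y t \<in> L2_on \<Omega>" if "t \<in> J" for t
      using weak_sol_in_closure[OF J w _ that] L2_on_subset_closure_H10[OF \<Omega>] y0 clos by blast
    then show "is_heat_solution \<Omega> \<omega> J y0 u y"
      using w int meas unfolding is_heat_solution_def weak_sol_def
      by (simp add: inner_grad set_integral_eq_Leb)
  qed
qed

text \<open>
  The solution that the definite description picks, on either kind of time interval, is the
  restriction of the global weak solution for any bounded source \<open>f\<close> that agrees almost everywhere on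
  that interval with the one given by the control. In particular controls on \<open>{0<..<T}\<close> may be
  continued by zero, and controls that are bounded almost everywhere may be truncated.
\<close>

lemma heat_solution_eq:
  fixes \<Omega> :: "(real ^ 'n) set"
  assumes \<Omega>: "open \<Omega>" and \<omega>: "\<omega> \<in> sets lebesgue" and y0: "y0 \<in> L2_on \<Omega>"
    and J: "time_domain J" "J \<subseteq> {0..}" and t: "t \<in> J"
    and u: "\<And>r. r \<in> J \<Longrightarrow> u \<in> borel_measurable (Leb r)"
    and f: "f \<in> borel_measurable lebesgue" "\<And>s. norm (f s) \<le> B"
    and ae: "\<And>r. r \<in> J \<Longrightarrow> AE s in Leb r. f s = cutoff \<omega> (u s)"
    and y: "closed_form.weak_sol (H10 \<Omega>) (grad \<Omega>) {0..} y0 f y"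
  shows "heat_solution \<Omega> \<omega> J y0 u t = y t"
proof -
  interpret closed_form "H10 \<Omega>" "grad \<Omega>" by (rule closed_form_grad[OF \<Omega>])
  let ?g = "\<lambda>s. cutoff \<omega> (u s)"
  have yJ: "weak_sol J y0 f y" by (rule weak_sol_mono[OF time_domain_halfline J(2,1) y])
  have cm: "cutoff \<omega> \<in> borel_measurable borel"
    by (intro borel_measurable_continuous_onI linear_continuous_on bounded_linear_cutoff \<omega>)
  have gm: "?g \<in> borel_measurable (Leb r)" if "r \<in> J" for r
    by (rule measurable_compose[OF u[OF that] cm])
  have gi: "integrable (Leb r) ?g" if "r \<in> J" for r
    using integrable_cong_AE[OF measurable_Leb_lebesgue[OF f(1)] gm[OF that] ae[OF that]] integrable_Leb_bounded_lebesgue[OF f] by simp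
  have "weak_sol J y0 ?g y"
    by (rule weak_sol_cong_AE[OF J(1) yJ measurable_Leb_lebesgue[OF f(1)] gm ae])
  then have hy: "is_heat_solution \<Omega> \<omega> J y0 u y" using is_heat_solution_iff[OF \<Omega> J(1) y0] by blast
  show ?thesis
    unfolding heat_solution_def
  proof (rule the_equality)
    show "\<exists>ya. is_heat_solution \<Omega> \<omega> J y0 u ya \<and> ya t = y t" using hy by blast
    fix z assume "\<exists>y. is_heat_solution \<Omega> \<omega> J y0 u y \<and> y t = z"
    then obtain y' where y': "is_heat_solution \<Omega> \<omega> J y0 u y'" "y' t = z" by blast
    then have "weak_sol J y0 ?g y'" using is_heat_solution_iff[OF \<Omega> J(1) y0] by blast
    from weak_sol_unique[OF J(1) this \<open>weak_sol J y0 ?g y\<close> gi t] show "z = y t" using y' by simp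
  qed
qed

section \<open>Minimal time and minimal norm\<close>

lemma Linf_norm_le_iff:
  fixes u :: "real \<Rightarrow> 'a::euclidean_space L2"
  assumes u: "u \<in> borel_measurable (lebesgue_on I)"
  shows "Linf_norm I u \<le> ereal M \<longleftrightarrow> (AE t in lebesgue_on I. norm (u t) \<le> M)"
proof
  assume "Linf_norm I u \<le> ereal M"
  moreover have "AE t in lebesgue_on I. ereal (norm (u t)) \<le> Linf_norm I u"
    unfolding Linf_norm_def by (rule esssup_AE)
  ultimately show "AE t in lebesgue_on I. norm (u t) \<le> M"
    by (auto elim!: eventually_mono dest: order_trans)
next
  assume "AE t in lebesgue_on I. norm (u t) \<le> M"
  then show "Linf_norm I u \<le> ereal M"
    unfolding Linf_norm_def using u by (intro esssup_I) auto
qed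


lemma measurable_extend_by_zero:
  fixes v :: "real \<Rightarrow> 'b::real_normed_vector"
  assumes "I \<in> sets lebesgue" and "v \<in> borel_measurable (lebesgue_on I)"
  shows "(\<lambda>s. if s \<in> I then v s else 0) \<in> borel_measurable lebesgue"
  using assms(2) by (subst (asm) measurable_restrict_space_iff[where c = 0]) (use assms(1) in auto)

text \<open>
  Existence of norm-optimal controls. For each \<open>n\<close> the controls of norm at most \<open>M + (1/2) ^ n\<close> that
  steer the state into \<open>Q\<close> at time \<open>T\<close> form a nonempty convex set, because \<open>Q\<close> is convex and the final
  state depends affinely on the control; these sets decrease. A sequence of nearly minimal \<open>L\<^sup>2\<close> norm
  along them is Cauchy, hence converges almost everywhere to a control of norm at most \<open>M\<close>, and
  stability together with closedness of \<open>Q\<close> shows that this control is successful. In this way strong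
  convergence takes the place of weak compactness.
\<close>

lemma minimal_norm_le_attained:
  fixes \<Omega> :: "(real ^ 'n) set"
  assumes \<Omega>: "open \<Omega>" and \<omega>: "\<omega> \<in> sets lebesgue" and y0: "y0 \<in> L2_on \<Omega>"
    and Q: "convex Q" "closed Q" and M: "0 \<le> M" and T: "0 < T"
    and N: "minimal_norm \<Omega> \<omega> T y0 Q \<le> ereal M"
  shows "\<exists>u\<in>admissible_controls \<Omega> M. heat_solution \<Omega> \<omega> {0..} y0 u T \<in> Q"
proof -
  interpret closed_form "H10 \<Omega>" "grad \<Omega>" by (rule closed_form_grad[OF \<Omega>])
  have y0V: "y0 \<in> closure (H10 \<Omega>)" using L2_on_subset_closure_H10[OF \<Omega>] y0 by blast
  have L2c: "closed (L2_on \<Omega>)" and L2s: "subspace (L2_on \<Omega>)" using \<Omega> by (auto intro!: closed_L2_on subspace_L2_on)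
  have bl: "bounded_linear (cutoff \<omega>)" by (rule bounded_linear_cutoff[OF \<omega>])
  interpret cut: bounded_linear "cutoff \<omega>" by (rule bl)
  have cm: "cutoff \<omega> \<in> borel_measurable borel"
    by (intro borel_measurable_continuous_onI linear_continuous_on bl)
  have cut_m: "(\<lambda>s. cutoff \<omega> (v s)) \<in> borel_measurable lebesgue" if "v \<in> borel_measurable lebesgue" for v
    by (rule measurable_compose[OF that cm])
  have cut_b: "norm (cutoff \<omega> v) \<le> B" if "norm v \<le> B" for v :: "(real ^ 'n) L2" and B
    using norm_cutoff_le[OF \<omega>, of v] that by linarith
  define steers where "steers v \<longleftrightarrow> (\<exists>y. weak_sol {0..} y0 (\<lambda>s. cutoff \<omega> (v s)) y \<and> y T \<in> Q)" for v
  define C where "C n = {v. v \<in> borel_measurable lebesgue \<and> (\<forall>s. v s \<in> L2_on \<Omega>) \<and>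
      (\<forall>s. norm (v s) \<le> M + (1/2) ^ n) \<and> steers v}" for n :: nat
  define q where "q v = (LINT s|Leb T. (norm (v s))\<^sup>2)" for v :: "real \<Rightarrow> (real ^ 'n) L2"
  define mid where "mid v w = (\<lambda>s. (1/2) *\<^sub>R (v s + w s))" for v w :: "real \<Rightarrow> (real ^ 'n) L2"
  have M1: "M + (1/2) ^ n \<le> M + 1" for n :: nat by (simp add: power_le_one)
  have CB: "norm (v s) \<le> M + 1" if "v \<in> C n" for v n s
    using that M1[of n] order_trans unfolding C_def by blast
  have sq_int: "integrable (Leb T) (\<lambda>s. (norm (v s))\<^sup>2)"
    if v: "v \<in> borel_measurable lebesgue" and b: "\<And>s. norm (v s) \<le> M + 1" for v :: "real \<Rightarrow> (real ^ 'n) L2"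
    using b by (intro integrable_Leb_bounded[where B = "(M + 1)\<^sup>2"] measurable_Leb_lebesgue)
      (use v in \<open>auto intro: power_mono\<close>)
  have C_decr: "C n \<subseteq> C m" if "m \<le> n" for m n
  proof -
    have "(1/2 :: real) ^ n \<le> (1/2) ^ m" using that by (intro power_decreasing) auto
    then show ?thesis unfolding C_def by (force intro: order_trans)
  qed
  have C_mid: "mid v w \<in> C n" if v: "v \<in> C n" and w: "w \<in> C n" for v w n
  proof -
    obtain y where y: "weak_sol {0..} y0 (\<lambda>s. cutoff \<omega> (v s)) y" "y T \<in> Q" using v by (auto simp: C_def steers_def)
    obtain z where z: "weak_sol {0..} y0 (\<lambda>s. cutoff \<omega> (w s)) z" "z T \<in> Q" using w by (auto simp: C_def steers_def)
    have vm: "v \<in> borel_measurable lebesgue" and wm: "w \<in> borel_measurable lebesgue" using v w by (auto simp: C_def)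
    have iv: "integrable (Leb t) (\<lambda>s. cutoff \<omega> (v s))" "integrable (Leb t) (\<lambda>s. cutoff \<omega> (w s))" for t
      by (rule integrable_Leb_bounded_lebesgue[OF cut_m[OF vm] cut_b[OF CB[OF v]]], rule integrable_Leb_bounded_lebesgue[OF cut_m[OF wm] cut_b[OF CB[OF w]]])
    have "weak_sol {0..} y0 (\<lambda>s. cutoff \<omega> (mid v w s)) (\<lambda>s. (1/2) *\<^sub>R y s + (1/2) *\<^sub>R z s)"
      using weak_sol_linear_combination(1)[OF time_domain_halfline y(1) z(1) iv, of "1/2" "1/2"]
      by (simp add: mid_def cut.add cut.scaleR scaleR_add_right flip: scaleR_add_left)
    moreover have "(1/2) *\<^sub>R y T + (1/2) *\<^sub>R z T \<in> Q"
      using Q(1) y(2) z(2) by (intro convexD) auto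
    ultimately have "steers (mid v w)" unfolding steers_def by blast
    moreover have "mid v w \<in> borel_measurable lebesgue"
      unfolding mid_def using vm wm by (intro borel_measurable_scaleR borel_measurable_add borel_measurable_const)
    moreover have "mid v w s \<in> L2_on \<Omega>" for s
      unfolding mid_def using v w L2s by (auto simp: C_def intro!: subspace_scale subspace_add)
    moreover have "norm (mid v w s) \<le> M + (1/2) ^ n" for s
    proof -
      have "norm (v s) \<le> M + (1/2) ^ n" "norm (w s) \<le> M + (1/2) ^ n" using v w by (auto simp: C_def)
      then show ?thesis using norm_triangle_ineq[of "v s" "w s"] unfolding mid_def norm_scaleR by simp
    qed
    ultimately show ?thesis by (simp add: C_def)
  qed
  have C_ne: "\<exists>v\<in>C n. q v \<le> (M + 1)\<^sup>2 * T" for n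
  proof -
    have "minimal_norm \<Omega> \<omega> T y0 Q < ereal (M + (1/2) ^ n)"
      using N by (rule order_le_less_trans) simp
    then obtain v where v: "v \<in> Linf {0<..<T} \<Omega>" "heat_solution \<Omega> \<omega> {0..T} y0 v T \<in> Q"
      "Linf_norm {0<..<T} v < ereal (M + (1/2) ^ n)"
      unfolding minimal_norm_def Inf_less_iff by auto
    have vm: "v \<in> borel_measurable (Leb T)" using v(1) by (simp add: Linf_def)
    have vb: "AE s in Leb T. norm (v s) \<le> M + (1/2) ^ n"
      using Linf_norm_le_iff[OF vm] less_imp_le[OF v(3)] by blast
    \<comment> \<open>Truncation and continuation by zero turn the bound almost everywhere into a bound everywhere.\<close>
    define w where "w s = (if s \<in> {0<..<T} \<and> norm (v s) \<le> M + (1/2) ^ n then v s else 0)" for s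
    have wm: "w \<in> borel_measurable lebesgue"
    proof -
      have "(\<lambda>s. if norm (v s) \<le> M + (1/2) ^ n then v s else 0) \<in> borel_measurable (Leb T)"
        using vm by measurable
      then have "(\<lambda>s. if s \<in> {0<..<T} then (if norm (v s) \<le> M + (1/2) ^ n then v s else 0) else 0) \<in> borel_measurable lebesgue"
        by (rule measurable_extend_by_zero[rotated]) simp
      moreover have "w = (\<lambda>s. if s \<in> {0<..<T} then (if norm (v s) \<le> M + (1/2) ^ n then v s else 0) else 0)"
        by (auto simp: w_def fun_eq_iff)
      ultimately show ?thesis by simp
    qed
    have wb: "norm (w s) \<le> M + (1/2) ^ n" for s using M by (simp add: w_def)
    have wL: "w s \<in> L2_on \<Omega>" for s using v(1) L2s by (auto simp: w_def Linf_def subspace_0)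
    obtain y where y: "weak_sol {0..} y0 (\<lambda>s. cutoff \<omega> (w s)) y"
      using weak_sol_exists[OF cut_m[OF wm] cut_b[OF wb] y0V] by blast
    have "heat_solution \<Omega> \<omega> {0..T} y0 v T = y T"
    proof (rule heat_solution_eq[OF \<Omega> \<omega> y0 time_domain_interval _ _ _ cut_m[OF wm] cut_b[OF wb] _ y])
      show "T \<in> {0..T}" "{0..T} \<subseteq> {0..}" using T by auto
      fix r assume r: "r \<in> {0..T}"
      show "v \<in> borel_measurable (Leb r)" by (rule measurable_Leb_restrict[OF vm]) (use r in auto)
      have "AE s in lebesgue. s \<in> {0<..<T} \<longrightarrow> norm (v s) \<le> M + (1/2) ^ n"
        using vb by (simp add: AE_restrict_space_iff)
      then have "AE s in lebesgue. s \<in> {0<..<r} \<longrightarrow> cutoff \<omega> (w s) = cutoff \<omega> (v s)"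
        by eventually_elim (use r in \<open>auto simp: w_def\<close>)
      then show "AE s in Leb r. cutoff \<omega> (w s) = cutoff \<omega> (v s)" by (simp add: AE_restrict_space_iff)
    qed
    then have "w \<in> C n" using v(2) y wm wL wb unfolding C_def steers_def by auto
    moreover have "q w \<le> (M + 1)\<^sup>2 * T"
    proof -
      have "norm (q w) \<le> (M + 1)\<^sup>2 * T"
        unfolding q_def using T CB[OF \<open>w \<in> C n\<close>] by (intro norm_integral_Leb_le) (auto intro: power_mono)
      then show ?thesis by simp
    qed
    ultimately show ?thesis by blast
  qed
  have q_nonneg: "0 \<le> q v" for v by (simp add: q_def)
  obtain x where x: "\<And>n. x n \<in> C n"
    and x_near: "\<And>m n. m \<le> n \<Longrightarrow> 2 * q (x m) + 2 * q (x n) - 4 * q (mid (x m) (x n)) \<le> 1 * (1/4) ^ m"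
  proof (rule midpoint_minimizing_sequence[where C = C and q = q and mid = mid and B = "(M + 1)\<^sup>2 * T" and \<epsilon> = "\<lambda>m. 1 * (1/4) ^ m"])
    show "C n \<subseteq> C m" if "m \<le> n" for m n by (rule C_decr[OF that])
    show "mid v w \<in> C n" if "v \<in> C n" "w \<in> C n" for n v w by (rule C_mid[OF that])
    show "\<exists>v\<in>C n. q v \<le> (M + 1)\<^sup>2 * T" for n by (rule C_ne)
    show "0 \<le> q v" for v by (rule q_nonneg)
    show "(0::real) < 1 * (1/4) ^ n" for n by simp
    fix x :: "nat \<Rightarrow> real \<Rightarrow> (real ^ 'n) L2"
    assume "\<And>n. x n \<in> C n"
      "\<And>m n. m \<le> n \<Longrightarrow> 2 * q (x m) + 2 * q (x n) - 4 * q (mid (x m) (x n)) \<le> 1 * (1/4) ^ m"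
    then show thesis by (rule that)
  qed
  have xm: "x n \<in> borel_measurable lebesgue" and xL: "x n s \<in> L2_on \<Omega>" and xb: "norm (x n s) \<le> M + (1/2) ^ n"
    and xs: "steers (x n)" for n s
    using x[of n] by (auto simp: C_def)
  have fast: "(\<integral>\<^sup>+s. ennreal ((norm (x m s - x n s))\<^sup>2) \<partial>Leb T) \<le> ennreal (1 * (1/4) ^ m)" if mn: "m \<le> n" for m n
  proof -
    have mm: "mid (x m) (x n) \<in> C m" using C_mid x C_decr[OF mn] by blast
    have i1: "integrable (Leb T) (\<lambda>s. (norm (x k s))\<^sup>2)" for k by (rule sq_int[OF xm CB[OF x]])
    have i2: "integrable (Leb T) (\<lambda>s. (norm (mid (x m) (x n) s))\<^sup>2)"
      using mm by (intro sq_int CB[OF mm]) (simp add: C_def)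
    have eq: "(norm (x m s - x n s))\<^sup>2 = 2 * (norm (x m s))\<^sup>2 + 2 * (norm (x n s))\<^sup>2 - 4 * (norm (mid (x m) (x n) s))\<^sup>2" for s
      unfolding mid_def by (rule parallelogram_midpoint)
    have i3: "integrable (Leb T) (\<lambda>s. (norm (x m s - x n s))\<^sup>2)" unfolding eq using i1 i2 by simp
    have "(LINT s|Leb T. (norm (x m s - x n s))\<^sup>2) = 2 * q (x m) + 2 * q (x n) - 4 * q (mid (x m) (x n))"
      unfolding eq q_def using i1 i2 by simp
    then show ?thesis using x_near[OF mn] by (subst nn_integral_eq_integral[OF i3]) (auto intro: ennreal_leI)
  qed
  obtain g where gm: "g \<in> borel_measurable (Leb T)" and xg: "AE s in Leb T. (\<lambda>n. x n s) \<longlonglongrightarrow> g s"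
  proof (rule AE_limit_of_fast_L2_Cauchy[OF measurable_Leb_lebesgue[OF xm] fast])
    fix g assume "g \<in> borel_measurable (Leb T)" "AE s in Leb T. (\<lambda>n. x n s) \<longlonglongrightarrow> g s"
    then show thesis by (rule that)
  qed
  have g_good: "AE s in Leb T. norm (g s) \<le> M \<and> g s \<in> L2_on \<Omega>"
    using xg
  proof eventually_elim
    case (elim s)
    have "(\<lambda>n. M + (1/2 :: real) ^ n) \<longlonglongrightarrow> M + 0" by (intro tendsto_intros LIMSEQ_power_zero) simp
    then have "norm (g s) \<le> M + 0"
      by (rule LIMSEQ_le[OF tendsto_norm[OF elim]]) (use xb in blast)
    moreover have "g s \<in> L2_on \<Omega>" by (rule closed_sequentially[OF L2c _ elim]) (use xL in blast)
    ultimately show ?case by simp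
  qed
  \<comment> \<open>A representative of the limit that satisfies the constraints at every time and vanishes after \<open>T\<close>.\<close>
  define u where "u s = (if s \<in> {0<..<T} \<and> norm (g s) \<le> M \<and> g s \<in> L2_on \<Omega> then g s else 0)" for s
  have um: "u \<in> borel_measurable lebesgue"
  proof -
    have [measurable]: "g \<in> borel_measurable (Leb T)" "L2_on \<Omega> \<in> sets borel" using gm L2c by (auto intro: borel_closed)
    have "(\<lambda>s. if norm (g s) \<le> M \<and> g s \<in> L2_on \<Omega> then g s else 0) \<in> borel_measurable (Leb T)" by measurable
    then have "(\<lambda>s. if s \<in> {0<..<T} then (if norm (g s) \<le> M \<and> g s \<in> L2_on \<Omega> then g s else 0) else 0) \<in> borel_measurable lebesgue"
      by (rule measurable_extend_by_zero[rotated]) simp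
    moreover have "u = (\<lambda>s. if s \<in> {0<..<T} then (if norm (g s) \<le> M \<and> g s \<in> L2_on \<Omega> then g s else 0) else 0)"
      by (auto simp: u_def fun_eq_iff)
    ultimately show ?thesis by simp
  qed
  have ub: "norm (u s) \<le> M" and uL: "u s \<in> L2_on \<Omega>" for s using M L2s by (auto simp: u_def subspace_0)
  have ub1: "norm (u s) \<le> M + 1" for s using ub[of s] by simp
  have xu: "AE s in Leb T. (\<lambda>n. x n s) \<longlonglongrightarrow> u s"
  proof -
    have "AE s in Leb T. s \<in> {0<..<T}" by (rule AE_I2) (simp add: space_restrict_space)
    with xg g_good show ?thesis by eventually_elim (simp add: u_def)
  qed
  obtain y where y: "weak_sol {0..} y0 (\<lambda>s. cutoff \<omega> (u s)) y"
    using weak_sol_exists[OF cut_m[OF um] cut_b[OF ub1] y0V] by blast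
  have "\<forall>n. \<exists>y. weak_sol {0..} y0 (\<lambda>s. cutoff \<omega> (x n s)) y \<and> y T \<in> Q" using xs by (simp add: steers_def)
  then obtain z where z: "\<And>n. weak_sol {0..} y0 (\<lambda>s. cutoff \<omega> (x n s)) (z n)" "\<And>n. z n T \<in> Q" by metis
  have "(\<lambda>n. LINT s|Leb T. norm (cutoff \<omega> (x n s) - cutoff \<omega> (u s))) \<longlonglongrightarrow> (LINT s|Leb T. 0)"
  proof (rule integral_dominated_convergence)
    show "(\<lambda>s. norm (cutoff \<omega> (x n s) - cutoff \<omega> (u s))) \<in> borel_measurable (Leb T)" for n
      using measurable_Leb_lebesgue[OF cut_m[OF xm[of n]]] measurable_Leb_lebesgue[OF cut_m[OF um]] by measurable
    show "integrable (Leb T) (\<lambda>s. (M + 1) + (M + 1))" by (rule finite_measure.integrable_const[OF finite_measure_Leb])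
    show "AE s in Leb T. (\<lambda>n. norm (cutoff \<omega> (x n s) - cutoff \<omega> (u s))) \<longlonglongrightarrow> 0"
      using xu
    proof eventually_elim
      case (elim s)
      have "(\<lambda>n. cutoff \<omega> (x n s)) \<longlonglongrightarrow> cutoff \<omega> (u s)" by (rule cut.tendsto[OF elim])
      then show ?case by (simp add: tendsto_norm_zero_iff LIM_zero_iff)
    qed
    show "AE s in Leb T. norm (norm (cutoff \<omega> (x n s) - cutoff \<omega> (u s))) \<le> (M + 1) + (M + 1)" for n
    proof (rule AE_I2)
      fix s
      show "norm (norm (cutoff \<omega> (x n s) - cutoff \<omega> (u s))) \<le> (M + 1) + (M + 1)"
        using norm_triangle_ineq4[of "cutoff \<omega> (x n s)" "cutoff \<omega> (u s)"]
          cut_b[OF CB[OF x[of n]], of s] cut_b[OF ub1[of s]]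
        unfolding real_norm_def abs_norm_cancel by linarith
    qed
  qed simp
  then have lim0: "(\<lambda>n. 2 * (LINT s|Leb T. norm (cutoff \<omega> (x n s) - cutoff \<omega> (u s)))) \<longlonglongrightarrow> 2 * 0"
    by (intro tendsto_mult tendsto_const) simp
  have "(\<lambda>n. z n T - y T) \<longlonglongrightarrow> 0"
  proof (rule Lim_null_comparison)
    show "(\<lambda>n. 2 * (LINT s|Leb T. norm (cutoff \<omega> (x n s) - cutoff \<omega> (u s)))) \<longlonglongrightarrow> 0" using lim0 by simp
    show "eventually (\<lambda>n. norm (z n T - y T) \<le> 2 * (LINT s|Leb T. norm (cutoff \<omega> (x n s) - cutoff \<omega> (u s)))) sequentially"
      using T
      by (intro always_eventually allI
          weak_sol_stability[OF cut_m[OF xm] cut_b[OF CB[OF x]] cut_m[OF um] cut_b[OF ub1] z(1) y]) simp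
  qed
  then have zy: "(\<lambda>n. z n T) \<longlonglongrightarrow> y T" by (simp add: LIM_zero_iff)
  have yQ: "y T \<in> Q" by (rule closed_sequentially[OF Q(2) _ zy]) (use z(2) in blast)
  have "heat_solution \<Omega> \<omega> {0..} y0 u T = y T"
    by (rule heat_solution_eq[OF \<Omega> \<omega> y0 time_domain_halfline order_refl _ measurable_Leb_lebesgue[OF um]
          cut_m[OF um] cut_b[OF ub1] _ y]) (use T in auto)
  moreover have "u \<in> admissible_controls \<Omega> M"
  proof -
    have um': "u \<in> borel_measurable (lebesgue_on {0<..})" by (rule measurable_restrict_space1[OF um])
    have "Linf_norm {0<..} u \<le> ereal M" using Linf_norm_le_iff[OF um'] ub by simp
    then have "Linf_norm {0<..} u < \<infinity>" using order_le_less_trans by fastforce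
    then show ?thesis using um' ub uL by (simp add: admissible_controls_def Linf_def)
  qed
  ultimately show ?thesis using yQ by (intro bexI[of _ u]) simp_all
qed

text \<open>
  An admissible control that is successful at time \<open>t\<close>, restricted to \<open>{0<..<t}\<close>, competes in the
  minimal norm problem at \<open>t\<close>; and \<open>t = 0\<close> is impossible, for then the state is \<open>y0\<close>.
\<close>

lemma admissible_control_steering_time:
  fixes \<Omega> :: "(real ^ 'n) set"
  assumes \<Omega>: "open \<Omega>" and \<omega>: "\<omega> \<in> sets lebesgue" and y0: "y0 \<in> L2_on \<Omega>" "y0 \<notin> Q"
    and M: "0 \<le> M" and t: "0 \<le> t" and u: "u \<in> admissible_controls \<Omega> M"
    and hit: "heat_solution \<Omega> \<omega> {0..} y0 u t \<in> Q"
  shows "t \<in> time_set \<Omega> \<omega> M y0 Q"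
proof -
  interpret closed_form "H10 \<Omega>" "grad \<Omega>" by (rule closed_form_grad[OF \<Omega>])
  have y0V: "y0 \<in> closure (H10 \<Omega>)" using L2_on_subset_closure_H10[OF \<Omega>] y0 by blast
  have cm: "cutoff \<omega> \<in> borel_measurable borel"
    by (intro borel_measurable_continuous_onI linear_continuous_on bounded_linear_cutoff[OF \<omega>])
  have um: "u \<in> borel_measurable (lebesgue_on {0<..})" and ub: "AE s in lebesgue_on {0<..}. norm (u s) \<le> M"
    and uL: "\<And>s. 0 < s \<Longrightarrow> u s \<in> L2_on \<Omega>"
    using u by (auto simp: admissible_controls_def Linf_def)
  define w where "w s = (if s \<in> {0<..} then (if norm (u s) \<le> M then u s else 0) else 0)" for s
  have wm: "w \<in> borel_measurable lebesgue"
  proof -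
    have "(\<lambda>s. if norm (u s) \<le> M then u s else 0) \<in> borel_measurable (lebesgue_on {0<..})" using um by measurable
    then show ?thesis unfolding w_def by (rule measurable_extend_by_zero[rotated]) simp
  qed
  have wb: "norm (w s) \<le> M" for s using M by (simp add: w_def)
  have fm: "(\<lambda>s. cutoff \<omega> (w s)) \<in> borel_measurable lebesgue" by (rule measurable_compose[OF wm cm])
  have fb: "norm (cutoff \<omega> (w s)) \<le> M" for s using norm_cutoff_le[OF \<omega>, of "w s"] wb[of s] by linarith
  obtain y where y: "weak_sol {0..} y0 (\<lambda>s. cutoff \<omega> (w s)) y"
    using weak_sol_exists[OF fm fb y0V] by blast
  have uLeb: "u \<in> borel_measurable (Leb r)" for r by (rule measurable_Leb_restrict[OF um]) auto
  have ae0: "AE s in lebesgue. 0 < s \<longrightarrow> norm (u s) \<le> M" using ub by (simp add: AE_restrict_space_iff)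
  have ae: "AE s in Leb r. cutoff \<omega> (w s) = cutoff \<omega> (u s)" for r
  proof -
    have "AE s in lebesgue. s \<in> {0<..<r} \<longrightarrow> cutoff \<omega> (w s) = cutoff \<omega> (u s)"
      using ae0 by eventually_elim (auto simp: w_def)
    then show ?thesis by (simp add: AE_restrict_space_iff)
  qed
  have inf: "heat_solution \<Omega> \<omega> {0..} y0 u t = y t"
    by (rule heat_solution_eq[OF \<Omega> \<omega> y0(1) time_domain_halfline order_refl _ uLeb fm fb ae y]) (use t in simp)
  have "t \<noteq> 0" using inf hit y0(2) weak_solD(2)[OF y] by auto
  then have t0: "0 < t" using t by simp
  have "heat_solution \<Omega> \<omega> {0..t} y0 u t = y t"
    by (rule heat_solution_eq[OF \<Omega> \<omega> y0(1) time_domain_interval _ _ uLeb fm fb ae y]) (use t in auto)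
  then have hit': "heat_solution \<Omega> \<omega> {0..t} y0 u t \<in> Q" using inf hit by simp
  have "AE s in Leb t. norm (u s) \<le> M"
  proof -
    have "AE s in lebesgue. s \<in> {0<..<t} \<longrightarrow> norm (u s) \<le> M" using ae0 by eventually_elim auto
    then show ?thesis by (simp add: AE_restrict_space_iff)
  qed
  then have le: "Linf_norm {0<..<t} u \<le> ereal M" using Linf_norm_le_iff[OF uLeb] by blast
  then have "Linf_norm {0<..<t} u < \<infinity>" using order_le_less_trans by fastforce
  then have "u \<in> Linf {0<..<t} \<Omega>" using uLeb uL by (simp add: Linf_def)
  then have "minimal_norm \<Omega> \<omega> t y0 Q \<le> Linf_norm {0<..<t} u"
    unfolding minimal_norm_def using hit' by (intro Inf_lower) blast
  then show ?thesis using le t0 by (simp add: time_set_def)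
qed

theorem theorem2p4:
  fixes \<Omega> \<omega> :: "(real ^ 'n) set" and y0 :: "(real ^ 'n) L2" and Q :: "(real ^ 'n) L2 set"
  assumes "open \<Omega>" and "connected \<Omega>" and "bounded \<Omega>" and "C2_boundary \<Omega>"
    and "open \<omega>" and "\<omega> \<noteq> {}" and "\<omega> \<subseteq> \<Omega>"
    and "Q \<in> target_sets \<Omega>"
    and "y0 \<in> L2_on \<Omega> - Q"
  shows "\<forall>M\<ge>0. minimal_time \<Omega> \<omega> M y0 Q = Inf (ereal ` time_set \<Omega> \<omega> M y0 Q)"
proof (intro allI impI antisym)
  fix M :: real assume M: "0 \<le> M"
  have \<omega>: "\<omega> \<in> sets lebesgue" and \<Omega>: "\<Omega> \<in> sets lebesgue" using assms(1,5) by auto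
  have Qc: "convex Q" "closed Q"
    using assms(8) closedin_closed_trans[OF _ closed_L2_on[OF \<Omega>]] by (auto simp: target_sets_def)
  show "minimal_time \<Omega> \<omega> M y0 Q \<le> Inf (ereal ` time_set \<Omega> \<omega> M y0 Q)"
  proof (rule INF_greatest)
    fix t assume "t \<in> time_set \<Omega> \<omega> M y0 Q"
    then have t: "0 < t" "minimal_norm \<Omega> \<omega> t y0 Q \<le> ereal M" by (auto simp: time_set_def)
    have "\<exists>u\<in>admissible_controls \<Omega> M. heat_solution \<Omega> \<omega> {0..} y0 u t \<in> Q"
      using minimal_norm_le_attained[OF assms(1) \<omega> _ Qc M t] assms(9) by simp
    then show "minimal_time \<Omega> \<omega> M y0 Q \<le> ereal t"
      unfolding minimal_time_def using t(1) by (intro Inf_lower) auto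
  qed
  show "Inf (ereal ` time_set \<Omega> \<omega> M y0 Q) \<le> minimal_time \<Omega> \<omega> M y0 Q"
    unfolding minimal_time_def
  proof (rule Inf_greatest)
    fix a assume "a \<in> {ereal t | t. t \<ge> 0 \<and> (\<exists>u\<in>admissible_controls \<Omega> M. heat_solution \<Omega> \<omega> {0..} y0 u t \<in> Q)}"
    then obtain t u where t: "a = ereal t" "0 \<le> t" "u \<in> admissible_controls \<Omega> M" "heat_solution \<Omega> \<omega> {0..} y0 u t \<in> Q"
      by blast
    have "t \<in> time_set \<Omega> \<omega> M y0 Q"
      using admissible_control_steering_time[OF assms(1) \<omega> _ _ M t(2-4)] assms(9) by simp
    then show "Inf (ereal ` time_set \<Omega> \<omega> M y0 Q) \<le> a" unfolding t(1) by (rule INF_lower)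
  qed
qed

end
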